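(* Let $A$ be a countable alphabet and let $((X_i)_{i\in\mathbb{Z}},\mathbb{P})$ be a stationary process on $A$ that is a uniform martingale and has a finite dominating measure $\mu$. Then $((X_i)_{i\in\mathbb{Z}},\mathbb{P})$ is a deterministic random-step Markov process. Moreover, in the case that $A$ is finite, $((X_i)_{i\in\mathbb{Z}},\mathbb{P})$ is a deterministic random-step Markov process with finite expected look-back distance if and only if $$\sum_{n\ge 1}\operatorname{var}_n(\mathbb{P})<\infty .$$
   Context: Notation: $\mathbb{Z}^+=\{1,2,\dots\}$, $\mathbb{Z}^-=\{-1,-2,\dots\}$. A countable alphabet may be finite or countably infinite, with all subsets measurable. $(X_i)_{i=-n}^{-1}=(\omega_i)_{i=-n}^{-1}$ abbreviates $X_{-1}=\omega_{-1},\dots,X_{-n}=\omega_{-n}$, and similarly for infinite pasts $(X_i)_{i<0}=(\omega_i)_{i<0}$. Conditional probabilities are only defined up to null sets, and conditions on them quantified over $\omega$ are understood for almost every $\omega$ (suprema over pasts being understood accordingly). Complete random-step Markov process: Given a stationary process $((X_i)_{i\in\mathbb{Z}},\mathbb{P})$ on $A$, a representation of it as a complete random-step Markov process consists of an independent stationary process $(L_i)_{i\in\mathbb{Z}}$ with values in $\mathbb{Z}^+$ (the $L_i$, called look-back distances, are independent and identically distributed) and a stationary coupling $\hat{\mathbb{P}}$ of $(X_i)_{i\in\mathbb{Z}}$ and $(L_i)_{i\in\mathbb{Z}}$ such that $L_0$ is independent of $\{X_i: i<0\}$ and, for every $n\in\mathbb{Z}^+$, $\omega\in A^{\mathbb{Z}}$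 and measurable $E_0\subseteq A$, $$\hat{\mathbb{P}}\big(X_0\in E_0\mid (X_i)_{i=-n}^{-1}=(\omega_i)_{i=-n}^{-1}\wedge L_0=n\big)=\hat{\mathbb{P}}\big(X_0\in E_0\mid (X_i)_{i<0}=(\omega_i)_{i<0}\wedge L_0=n\big).$$ A process having such a representation is called a random-step Markov process (or random Markov process). Deterministic random-step Markov process: a random-step Markov process on a countable alphabet having a representation $((X_i,L_i)_{i\in\mathbb{Z}},\hat{\mathbb{P}})$ as a complete random-step Markov process such that for every $n$ and every sequence $(\omega_i)_{i\le 0}$, $$\hat{\mathbb{P}}\big(X_0=\omega_0\mid (X_i)_{i<0}=(\omega_i)_{i<0}\wedge L_0=n\big)=\hat{\mathbb{P}}\big(X_0=\omega_0\mid (X_i)_{i=-n}^{-1}=(\omega_i)_{i=-n}^{-1}\wedge L_0=n\big)\in\{0,1\}.$$ It is a deterministic random-step Markov process with finite expected look-back distance if such a deterministic representation can be chosen with $\hat{\mathbb{E}}(L_0)<\infty$. Uniform martingale: a stationary process on $A$ such that for every $\varepsilon>0$ there is $n_\varepsilon$ such that for every $n\ge n_\varepsilon$ and every $(\omega_i)_{i<0}\in A^{\mathbb{Z}^-}$, $$\big\|\mathbb{P}(X_0\in\cdot\mid (X_i)_{i<0}=(\omega_i)_{i<0})-\mathbb{P}(X_0\in\cdot\mid (X_i)_{i=-n}^{-1}=(\omega_i)_{i=-n}^{-1})\big\|_{TV}<\varepsilon,$$ where $\|\mu-\nu\|_{TV}=\sup_E|\mu(E)-\nu(E)|$ for probability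 measures. Variation: for $k\ge 0$, $$\operatorname{var}_k(\mathbb{P})=\sup\Big\{\big|\mathbb{P}(X_0=a_0\mid (X_i)_{i=-k}^{-1}=(\omega_i)_{i=-k}^{-1})-\mathbb{P}(X_0=a_0\mid (X_i)_{i<0}=(\omega_i)_{i<0})\big| : a_0\in A,\ (\omega_i)_{i\le -1}\in A^{\mathbb{Z}^-}\Big\}.$$ Finite dominating measure: a measure $\mu$ on $A$ with $\mu(A)<\infty$ such that for every event $E$ in the $\sigma$-algebra generated by $(X_i)_{i<0}$ and every measurable $A_0\subseteq A$, $\mathbb{P}(X_0\in A_0\mid E)\le\mu(A_0)$. *)

theory Defs
  imports "HOL-Probability.Probability"
begin

section \<open>Stationary processes\<close>

text \<open>
  A process is a family \<open>X i\<close> (\<open>i :: int\<close>) of random variables with values in the alphabet \<open>A\<close>, on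
  a probability space \<open>M\<close>. Every subset of \<open>A\<close> is measurable.
\<close>

definition path_space :: "'a set \<Rightarrow> (int \<Rightarrow> 'a) measure" where
  "path_space A = Pi\<^sub>M UNIV (\<lambda>_. count_space A)"

definition stationary_process :: "'a set \<Rightarrow> 'w measure \<Rightarrow> (int \<Rightarrow> 'w \<Rightarrow> 'a) \<Rightarrow> bool" where
  "stationary_process A M X \<longleftrightarrow>
     prob_space M \<and>
     (\<forall>i. X i \<in> M \<rightarrow>\<^sub>M count_space A) \<and>
     distr M (path_space A) (\<lambda>w i. X (i + 1) w) = distr M (path_space A) (\<lambda>w i. X i w)"

text \<open>
  The sigma-algebra generated by \<open>X i\<close>, \<open>i \<in> I\<close>. The relevant index sets are
  \<open>{..<0}\<close> (the whole past) and \<open>{- int n..<0}\<close> (the last \<open>n\<close> letters).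
\<close>

definition window_algebra ::
    "'a set \<Rightarrow> 'w measure \<Rightarrow> (int \<Rightarrow> 'w \<Rightarrow> 'a) \<Rightarrow> int set \<Rightarrow> 'w measure" where
  "window_algebra A M X I =
     vimage_algebra (space M) (\<lambda>w. \<lambda>i\<in>I. X i w) (Pi\<^sub>M I (\<lambda>_. count_space A))"

section \<open>Conditional probabilities\<close>

text \<open>
  \<open>cond_pr M F Y E\<close> is a version of the conditional probability of \<open>Y \<in> E\<close> given the sub-sigma-algebra
  \<open>F\<close>; it is determined up to null sets only. Its value at \<open>w\<close> is the conditional probability given
  that the variables generating \<open>F\<close> take the values that they have at \<open>w\<close>; so \<open>for every\<close>
  realization of these variables becomes \<open>for almost every w\<close>.
\<close>

definition cond_pr :: "'w measure \<Rightarrow> 'w measure \<Rightarrow> ('w \<Rightarrow> 'a) \<Rightarrow> 'a set \<Rightarrow> 'w \<Rightarrow> real" where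
  "cond_pr M F Y E = real_cond_exp M F (indicator {w \<in> space M. Y w \<in> E})"

text \<open>
  The conditional distribution of \<open>Y\<close>. As \<open>A\<close> is countable it is determined by its point masses;
  see \<open>measure_cond_law\<close> below. Building it from point masses gives a single null set
  for all (possibly uncountably many) \<open>E \<subseteq> A\<close>, as is needed for the total variation distance.
\<close>

definition cond_law ::
    "'a set \<Rightarrow> 'w measure \<Rightarrow> 'w measure \<Rightarrow> ('w \<Rightarrow> 'a) \<Rightarrow> 'w \<Rightarrow> 'a measure" where
  "cond_law A M F Y w = point_measure A (\<lambda>a. ennreal (cond_pr M F Y {a} w))"

definition tv_dist :: "'a measure \<Rightarrow> 'a measure \<Rightarrow> real" where
  "tv_dist \<mu> \<nu> = (SUP E\<in>sets \<mu>. \<bar>measure \<mu> E - measure \<nu> E\<bar>)"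

lemma subalgebra_window_algebra:
  assumes "\<And>i. X i \<in> M \<rightarrow>\<^sub>M count_space A"
  shows "subalgebra M (window_algebra A M X I)"
proof -
  have "(\<lambda>w. \<lambda>i\<in>I. X i w) \<in> M \<rightarrow>\<^sub>M Pi\<^sub>M I (\<lambda>_. count_space A)"
    using assms by measurable
  then show ?thesis
    unfolding subalgebra_def window_algebra_def
    by (auto simp: measurable_iff_sets)
qed

lemma measure_cond_law:
  assumes "prob_space M" and sub: "subalgebra M F" and "countable A"
    and Y: "Y \<in> M \<rightarrow>\<^sub>M count_space A" and E: "E \<subseteq> A"
  shows "AE w in M. measure (cond_law A M F Y w) E = cond_pr M F Y E w"
proof -
  interpret prob_space M by fact
  interpret finite_measure_subalgebra M F
    by unfold_locales (rule sub)
  note [measurable] = Y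
  have cE: "countable E" using E \<open>countable A\<close> by (rule countable_subset)
  define S where "S B = {w \<in> space M. Y w \<in> B}" for B
  have S[measurable]: "S B \<in> sets M" if "B \<subseteq> A" for B
  proof -
    have "Y -` B \<inter> space M \<in> sets M"
      using that by (intro measurable_sets[OF Y]) auto
    then show ?thesis by (simp add: S_def vimage_def Int_def conj_commute)
  qed
  define g where "g a w = ennreal (cond_pr M F Y {a} w)" for a w
  have g[measurable]: "g a \<in> borel_measurable F" for a
    unfolding g_def cond_pr_def by measurable
  have gM[measurable]: "g a \<in> borel_measurable M" for a
    by (rule measurable_from_subalg[OF sub g])
  have int: "(\<integral>\<^sup>+w\<in>B. g a w \<partial>M) = emeasure M (B \<inter> S {a})" if a: "a \<in> E" and B: "B \<in> sets F" for a B
  proof -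
    have [measurable]: "B \<in> sets M" using B sub by (auto simp: subalgebra_def)
    have Sa[measurable]: "S {a} \<in> sets M" using a E by (intro S) auto
    have ii: "integrable M (indicator (S {a}) :: _ \<Rightarrow> real)"
      by (intro integrable_real_indicator) (auto simp: emeasure_eq_measure)
    have c: "integrable M (cond_pr M F Y {a})"
      unfolding cond_pr_def S_def[symmetric] using ii by (rule real_cond_exp_int(1))
    have p: "AE w in M. 0 \<le> cond_pr M F Y {a} w"
      unfolding cond_pr_def S_def[symmetric] by (rule real_cond_exp_pos) auto
    have "(\<integral>\<^sup>+w\<in>B. g a w \<partial>M) = (\<integral>\<^sup>+w. ennreal (indicator B w * cond_pr M F Y {a} w) \<partial>M)"
      by (intro nn_integral_cong) (auto simp: g_def indicator_def)
    also have "\<dots> = ennreal (\<integral>w\<in>B. cond_pr M F Y {a} w \<partial>M)"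
      unfolding set_lebesgue_integral_def using p
      by (subst nn_integral_eq_integral)
         (auto intro!: integrable_real_mult_indicator c simp: mult.commute[of "indicator B _"])
    also have "(\<integral>w\<in>B. cond_pr M F Y {a} w \<partial>M) = (\<integral>w\<in>B. indicator (S {a}) w \<partial>M)"
      unfolding cond_pr_def S_def[symmetric]
      by (rule real_cond_exp_intA[symmetric, OF ii B])
    also have "\<dots> = measure M (B \<inter> S {a})"
      unfolding set_lebesgue_integral_def
      by (simp add: indicator_inter_arith[symmetric])
    finally show ?thesis by (simp add: emeasure_eq_measure)
  qed
  have emb: "B \<inter> S E = (\<Union>a\<in>E. B \<inter> S {a})" for B
    by (auto simp: S_def)
  define G where "G w = (\<integral>\<^sup>+a. g a w \<partial>count_space E)" for w
  have meas_sum: "(\<lambda>w. \<integral>\<^sup>+a. h a w \<partial>count_space E) \<in> borel_measurable N"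
    if [measurable]: "\<And>a. h a \<in> borel_measurable N" for N :: "'a measure" and h :: "'b \<Rightarrow> 'a \<Rightarrow> ennreal"
  proof -
    interpret sigma_finite_measure "count_space E"
      by (rule sigma_finite_measure_count_space_countable) fact
    have "(\<lambda>(w, a). h a w) \<in> borel_measurable (N \<Otimes>\<^sub>M count_space E)"
      by (subst measurable_pair_swap_iff, rule measurable_pair_measure_countable1) (use cE in auto)
    then show ?thesis by (rule borel_measurable_nn_integral)
  qed
  have G[measurable]: "G \<in> borel_measurable F"
    unfolding G_def by (rule meas_sum) simp
  have SE[measurable]: "S E \<in> sets M" using E by (rule S)
  have 1: "AE w in M. G w = nn_cond_exp M F (indicator (S E)) w"
  proof (rule nn_cond_exp_charact)
    fix B assume B: "B \<in> sets F"
    then have [measurable]: "B \<in> sets M" using sub by (auto simp: subalgebra_def)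
    have "(\<integral>\<^sup>+w\<in>B. G w \<partial>M) = (\<integral>\<^sup>+w. \<integral>\<^sup>+a. g a w * indicator B w \<partial>count_space E \<partial>M)"
      unfolding G_def by (intro nn_integral_cong) (simp add: nn_integral_multc)
    also have "\<dots> = (\<integral>\<^sup>+a. (\<integral>\<^sup>+w\<in>B. g a w \<partial>M) \<partial>count_space E)"
      by (rule nn_integral_count_space_nn_integral) (use cE in auto)
    also have "\<dots> = (\<integral>\<^sup>+a. emeasure M (B \<inter> S {a}) \<partial>count_space E)"
      by (rule nn_integral_cong) (simp add: int B)
    also have "\<dots> = emeasure M (\<Union>a\<in>E. B \<inter> S {a})"
    proof (rule emeasure_UN_countable[symmetric])
      show "B \<inter> S {a} \<in> sets M" if "a \<in> E" for a
        using that E S[of "{a}"] by auto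
      show "disjoint_family_on (\<lambda>a. B \<inter> S {a}) E"
        by (auto simp: disjoint_family_on_def S_def)
    qed (rule cE)
    also have "\<dots> = (\<integral>\<^sup>+w\<in>B. indicator (S E) w \<partial>M)"
      unfolding emb[symmetric] by (simp add: indicator_inter_arith[symmetric] Int_commute)
    finally show "(\<integral>\<^sup>+w\<in>B. indicator (S E) w \<partial>M) = (\<integral>\<^sup>+w\<in>B. G w \<partial>M)" by simp
  qed auto
  have 2: "AE w in M. nn_cond_exp M F (\<lambda>_. 0) w = 0"
    using nn_cond_exp_F_meas[of "\<lambda>_. 0"] by auto
  have 3: "emeasure (cond_law A M F Y w) E = G w" for w
  proof -
    have "emeasure (cond_law A M F Y w) E = (\<integral>\<^sup>+a\<in>E. g a w \<partial>count_space A)"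
      unfolding cond_law_def point_measure_def g_def
      using E by (subst emeasure_density) auto
    also have "\<dots> = G w"
      unfolding G_def using E
      by (auto simp: nn_integral_count_space_indicator Int_absorb1 indicator_inter_arith
               intro!: nn_integral_cong split: split_indicator)
    finally show ?thesis .
  qed
  have 4: "ennreal (- indicator B w) = 0" for B and w :: 'a
    by (auto simp: indicator_def ennreal_neg)
  show ?thesis
    using 1 2
    by eventually_elim
       (simp add: measure_def 3 cond_pr_def S_def[symmetric] real_cond_exp_def ennreal_indicator 4)
qed

section \<open>Uniform martingales, variation, dominating measures\<close>

definition uniform_martingale :: "'a set \<Rightarrow> 'w measure \<Rightarrow> (int \<Rightarrow> 'w \<Rightarrow> 'a) \<Rightarrow> bool" where
  "uniform_martingale A M X \<longleftrightarrow>
     stationary_process A M X \<and>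
     (\<forall>\<epsilon>>0. \<exists>N. \<forall>n\<ge>N. AE w in M.
        tv_dist (cond_law A M (window_algebra A M X {..<0}) (X 0) w)
                (cond_law A M (window_algebra A M X {- int n..<0}) (X 0) w) < \<epsilon>)"

definition variation :: "'a set \<Rightarrow> 'w measure \<Rightarrow> (int \<Rightarrow> 'w \<Rightarrow> 'a) \<Rightarrow> nat \<Rightarrow> ennreal" where
  "variation A M X k =
     (SUP a\<in>A. esssup M (\<lambda>w. ennreal
        \<bar>cond_pr M (window_algebra A M X {- int k..<0}) (X 0) {a} w
          - cond_pr M (window_algebra A M X {..<0}) (X 0) {a} w\<bar>))"

definition finite_dominating_measure ::
    "'a set \<Rightarrow> 'w measure \<Rightarrow> (int \<Rightarrow> 'w \<Rightarrow> 'a) \<Rightarrow> 'a measure \<Rightarrow> bool" where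
  "finite_dominating_measure A M X \<mu> \<longleftrightarrow>
     sets \<mu> = sets (count_space A) \<and>
     emeasure \<mu> A < \<infinity> \<and>
     (\<forall>E \<in> sets (window_algebra A M X {..<0}). \<forall>A\<^sub>0 \<subseteq> A.
        measure M E > 0 \<longrightarrow> \<P>(w in M. X 0 w \<in> A\<^sub>0 \<bar> w \<in> E) \<le> measure \<mu> A\<^sub>0)"

section \<open>Random-step Markov processes\<close>

text \<open>
  A joint process of letters and look-back distances is given by its law \<open>Q\<close> on the space of
  sequences over \<open>A \<times> {1..}\<close>, with coordinate processes \<open>letter\<close> and \<open>lookback\<close>. As the defining
  properties concern the joint law only, nothing is lost by taking this particular space.
\<close>

definition letter :: "int \<Rightarrow> (int \<Rightarrow> 'a \<times> nat) \<Rightarrow> 'a" where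
  "letter i x = fst (x i)"

definition lookback :: "int \<Rightarrow> (int \<Rightarrow> 'a \<times> nat) \<Rightarrow> nat" where
  "lookback i x = snd (x i)"

text \<open>The sigma-algebra generated by \<open>letter i\<close>, \<open>i \<in> I\<close>, and \<open>lookback 0\<close>.\<close>

definition window_lookback_algebra ::
    "'a set \<Rightarrow> (int \<Rightarrow> 'a \<times> nat) measure \<Rightarrow> int set \<Rightarrow> (int \<Rightarrow> 'a \<times> nat) measure" where
  "window_lookback_algebra A Q I =
     vimage_algebra (space Q) (\<lambda>x. (\<lambda>i\<in>I. letter i x, lookback 0 x))
       (Pi\<^sub>M I (\<lambda>_. count_space A) \<Otimes>\<^sub>M count_space {1..})"

text \<open>
  The look-back distances are identically distributed because the joint process is stationary.
  Conditioning on an event \<open>lookback 0 = n\<close> together with letters is expressed by conditioning on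
  \<open>lookback 0\<close> and these letters, and evaluating where \<open>lookback 0 x = n\<close>.
\<close>

definition complete_random_step_representation ::
    "'a set \<Rightarrow> 'w measure \<Rightarrow> (int \<Rightarrow> 'w \<Rightarrow> 'a) \<Rightarrow> (int \<Rightarrow> 'a \<times> nat) measure \<Rightarrow> bool" where
  "complete_random_step_representation A M X Q \<longleftrightarrow>
     sets Q = sets (path_space (A \<times> {1..})) \<and>
     stationary_process (A \<times> {1..}) Q (\<lambda>i x. x i) \<and>
     distr Q (path_space A) (\<lambda>x i. letter i x) = distr M (path_space A) (\<lambda>w i. X i w) \<and>
     prob_space.indep_vars Q (\<lambda>_. count_space {1..}) lookback UNIV \<and>
     prob_space.indep_set Q
       (sets (vimage_algebra (space Q) (lookback 0) (count_space {1..})))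
       (sets (window_algebra A Q letter {..<0})) \<and>
     (\<forall>n\<ge>1. \<forall>E\<subseteq>A. AE x in Q. lookback 0 x = n \<longrightarrow>
        cond_pr Q (window_lookback_algebra A Q {- int n..<0}) (letter 0) E x
        = cond_pr Q (window_lookback_algebra A Q {..<0}) (letter 0) E x)"

definition deterministic_representation ::
    "'a set \<Rightarrow> 'w measure \<Rightarrow> (int \<Rightarrow> 'w \<Rightarrow> 'a) \<Rightarrow> (int \<Rightarrow> 'a \<times> nat) measure \<Rightarrow> bool" where
  "deterministic_representation A M X Q \<longleftrightarrow>
     complete_random_step_representation A M X Q \<and>
     (\<forall>n\<ge>1. \<forall>a\<in>A. AE x in Q. lookback 0 x = n \<longrightarrow>
        cond_pr Q (window_lookback_algebra A Q {..<0}) (letter 0) {a} x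
        = cond_pr Q (window_lookback_algebra A Q {- int n..<0}) (letter 0) {a} x \<and>
        cond_pr Q (window_lookback_algebra A Q {- int n..<0}) (letter 0) {a} x \<in> {0, 1})"

definition deterministic_random_step_Markov ::
    "'a set \<Rightarrow> 'w measure \<Rightarrow> (int \<Rightarrow> 'w \<Rightarrow> 'a) \<Rightarrow> bool" where
  "deterministic_random_step_Markov A M X \<longleftrightarrow>
     countable A \<and> stationary_process A M X \<and> (\<exists>Q. deterministic_representation A M X Q)"

definition deterministic_random_step_Markov_finite_lookback ::
    "'a set \<Rightarrow> 'w measure \<Rightarrow> (int \<Rightarrow> 'w \<Rightarrow> 'a) \<Rightarrow> bool" where
  "deterministic_random_step_Markov_finite_lookback A M X \<longleftrightarrow>
     countable A \<and> stationary_process A M X \<and>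
     (\<exists>Q. deterministic_representation A M X Q \<and>
          (\<integral>\<^sup>+x. of_nat (lookback 0 x) \<partial>Q) < \<infinity>)"

lemma subalgebra_window_lookback_algebra:
  assumes "sets Q = sets (path_space (A \<times> {1..}))"
  shows "subalgebra Q (window_lookback_algebra A Q I)"
proof -
  have c: "(\<lambda>x. x i) \<in> Q \<rightarrow>\<^sub>M count_space (A \<times> {1..})" for i
    unfolding measurable_cong_sets[OF assms refl] path_space_def
    by (rule measurable_component_singleton) simp
  have l: "letter i \<in> Q \<rightarrow>\<^sub>M count_space A" for i
    unfolding letter_def[abs_def] by (rule measurable_compose[OF c]) auto
  have k: "lookback i \<in> Q \<rightarrow>\<^sub>M count_space {1..}" for i
    unfolding lookback_def[abs_def] by (rule measurable_compose[OF c]) auto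
  have "(\<lambda>x. (\<lambda>i\<in>I. letter i x, lookback 0 x)) \<in>
      Q \<rightarrow>\<^sub>M Pi\<^sub>M I (\<lambda>_. count_space A) \<Otimes>\<^sub>M count_space {1..}"
    by (intro measurable_Pair measurable_restrict l k)
  then show ?thesis
    unfolding subalgebra_def window_lookback_algebra_def
    by (auto simp: measurable_iff_sets)
qed

end

theory Submission
  imports Defs
begin

text \<open>
  A deterministic representation amounts to probabilities \<open>q n\<close> and functions \<open>g n\<close> of the last \<open>n\<close>
  letters with \<open>P(X 0 = a | past) = (\<Sum>n. q n * of_bool (g n = a))\<close>. They are found greedily. If the mass
  \<open>R\<close> is left, then, given the last \<open>n\<close> letters, the dominating measure provides a finite set of at most
  \<open>\<kappa> R\<close> letters carrying at least half of it, so some letter has residual mass at least \<open>R / (2 * \<kappa> R)\<close>;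
  given the whole past, its residual mass is smaller by at most the variation \<open>v n\<close>. So
  \<open>q n = max 0 (R / (2 * \<kappa> R) - v n)\<close> can be assigned to that letter. As \<open>v n\<close> tends to \<open>0\<close>, so does \<open>R\<close>.
  For a finite alphabet \<open>\<kappa>\<close> is bounded, and then the expected look-back distance, which is the sum of the
  remaining masses, is finite if the sum of the variations is.

  The coupling is obtained by drawing the look-back distance at each time from its conditional
  distribution given the letters up to that time, independently of everything else. Conversely, in any
  representation the \<open>k\<close>-th variation is at most the probability of a look-back distance greater than \<open>k\<close>.
\<close>

section \<open>Windows and shifts\<close>

text \<open>The look-back distance has to be independent of the past, so \<open>q n\<close> must be
  a constant, although the letter that receives this mass varies with the past. Each step therefore
  spends only an amount that is certain to be available after almost every past; whatever else is
  available stays for later steps. The letter is chosen from finitely many letters of the past, yet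
  must not receive more than its probability given the whole past, since mass once assigned is never
  taken back; the subtraction of \<open>v n\<close> guarantees this.

  The letters are not generated from the look-back distances: the process is given, and the
  distances are added to it. So the law of the letters is right from the start. The delicate point
  is independence, because each distance is drawn with knowledge of the very letter that it has to
  explain.\<close>

definition depends_on :: "'i set \<Rightarrow> (('i \<Rightarrow> 'a) \<Rightarrow> 'b) \<Rightarrow> bool" where
  "depends_on I f \<longleftrightarrow> (\<forall>x y. (\<forall>i\<in>I. x i = y i) \<longrightarrow> f x = f y)"

lemma depends_onI: "(\<And>x y. (\<And>i. i \<in> I \<Longrightarrow> x i = y i) \<Longrightarrow> f x = f y) \<Longrightarrow> depends_on I f"
  unfolding depends_on_def by blast

lemma depends_onD: "depends_on I f \<Longrightarrow> (\<And>i. i \<in> I \<Longrightarrow> x i = y i) \<Longrightarrow> f x = f y"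
  unfolding depends_on_def by blast

lemma depends_on_mono: "depends_on I f \<Longrightarrow> I \<subseteq> J \<Longrightarrow> depends_on J f"
  unfolding depends_on_def by blast

lemma space_path_space: "space (path_space A) = {x. \<forall>i. x i \<in> A}"
  by (auto simp: path_space_def space_PiM)

lemma measurable_path_component [measurable (raw)]: "(\<lambda>x. x i) \<in> path_space A \<rightarrow>\<^sub>M count_space A"
  unfolding path_space_def by measurable

lemma measurable_into_path_space:
  assumes "\<And>i. X i \<in> M \<rightarrow>\<^sub>M count_space A"
  shows "(\<lambda>w i. X i w) \<in> M \<rightarrow>\<^sub>M path_space A"
  unfolding path_space_def by (rule measurable_PiM_single') (use measurable_space[OF assms] in \<open>auto intro!: assms\<close>)

lemma measurable_extend_window:
  assumes "a\<^sub>0 \<in> A"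
  shows "(\<lambda>y i. if i \<in> I then y i else a\<^sub>0) \<in> Pi\<^sub>M I (\<lambda>_. count_space A) \<rightarrow>\<^sub>M path_space A"
proof (rule measurable_into_path_space)
  fix i
  show "(\<lambda>y. if i \<in> I then y i else a\<^sub>0) \<in> Pi\<^sub>M I (\<lambda>_. count_space A) \<rightarrow>\<^sub>M count_space A"
    using assms by (cases "i \<in> I") auto
qed

text \<open>Filling the coordinates outside \<open>I\<close> with a fixed letter undoes the
  restriction as far as \<open>f\<close> can see, so \<open>f\<close> factors measurably through the
  window.\<close>

lemma window_factor:
  assumes "f \<in> path_space A \<rightarrow>\<^sub>M N" "depends_on I f" "A \<noteq> {}"
  obtains h where "h \<in> Pi\<^sub>M I (\<lambda>_. count_space A) \<rightarrow>\<^sub>M N" "\<And>x. f x = h (restrict x I)"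
proof -
  obtain a\<^sub>0 where a0: "a\<^sub>0 \<in> A" using assms(3) by blast
  show ?thesis
  proof
    show "(\<lambda>y. f (\<lambda>i. if i \<in> I then y i else a\<^sub>0)) \<in> Pi\<^sub>M I (\<lambda>_. count_space A) \<rightarrow>\<^sub>M N"
      using measurable_compose[OF measurable_extend_window[OF a0] assms(1)] .
    show "f x = f (\<lambda>i. if i \<in> I then restrict x I i else a\<^sub>0)" for x
      by (rule depends_onD[OF assms(2)]) auto
  qed
qed

lemma measurable_restrict_window:
  assumes "\<And>i. X i \<in> M \<rightarrow>\<^sub>M count_space A"
  shows "(\<lambda>w. \<lambda>i\<in>I. X i w) \<in> window_algebra A M X I \<rightarrow>\<^sub>M Pi\<^sub>M I (\<lambda>_. count_space A)"
  unfolding window_algebra_def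
  by (rule measurable_vimage_algebra1) (use measurable_space[OF assms] in \<open>auto simp: space_PiM\<close>)

lemma measurable_window_algebra:
  assumes "\<And>i. X i \<in> M \<rightarrow>\<^sub>M count_space A"
    and "f \<in> path_space A \<rightarrow>\<^sub>M N" "depends_on I f" "A \<noteq> {}"
  shows "(\<lambda>w. f (\<lambda>i. X i w)) \<in> window_algebra A M X I \<rightarrow>\<^sub>M N"
proof -
  obtain h where h: "h \<in> Pi\<^sub>M I (\<lambda>_. count_space A) \<rightarrow>\<^sub>M N" "\<And>x. f x = h (restrict x I)"
    using window_factor[OF assms(2-4)] by blast
  show ?thesis unfolding h(2) by (rule measurable_compose[OF measurable_restrict_window h(1)]) (rule assms)
qed

text \<open>A finite product of countable discrete spaces is discrete, so measurability is free.
  This is what admits the greedy letters, which are defined by choice operators.\<close>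

lemma measurable_finite_window:
  assumes "finite I" "countable A" "A \<noteq> {}" "depends_on I f"
    and f: "\<And>x. (\<And>i. x i \<in> A) \<Longrightarrow> f x \<in> space N"
  shows "f \<in> path_space A \<rightarrow>\<^sub>M N"
proof -
  obtain a\<^sub>0 where a0: "a\<^sub>0 \<in> A" using assms(3) by blast
  have eq: "f x = f (\<lambda>i. if i \<in> I then restrict x I i else a\<^sub>0)" for x
    by (rule depends_onD[OF assms(4)]) auto
  have cs: "Pi\<^sub>M I (\<lambda>_. count_space A) = count_space (PiE I (\<lambda>_. A))"
    by (rule count_space_PiM_finite) (use assms in auto)
  have r: "(\<lambda>x. restrict x I) \<in> path_space A \<rightarrow>\<^sub>M Pi\<^sub>M I (\<lambda>_. count_space A)"
    by measurable
  have e: "(\<lambda>y. f (\<lambda>i. if i \<in> I then y i else a\<^sub>0)) \<in> Pi\<^sub>M I (\<lambda>_. count_space A) \<rightarrow>\<^sub>M N"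
    unfolding cs by (auto intro!: f simp: a0)
  show ?thesis
    by (subst eq[abs_def]) (rule measurable_compose[OF r e])
qed

lemma measurable_window_eq:
  assumes "finite I" "countable A" "A \<noteq> {}" "depends_on I f"
  shows "(\<lambda>x. of_bool (f x = a) :: real) \<in> borel_measurable (path_space A)"
proof (rule measurable_finite_window[OF assms(1-3)])
  show "depends_on I (\<lambda>x. of_bool (f x = a) :: real)"
    using assms(4) unfolding depends_on_def by metis
qed auto

text \<open>The level set of \<open>f\<close> through \<open>x\<close> is a preimage under
  \<open>T\<close>, so it cannot separate points with the same image. Hence a version of a
  conditional probability is constant, without exceptional points, on each set where the
  conditioning variable is fixed.\<close>

lemma borel_measurable_vimage_algebra_const:
  fixes f :: "'w \<Rightarrow> real"
  assumes f: "f \<in> borel_measurable (vimage_algebra \<Omega> T N)" and T: "T \<in> \<Omega> \<rightarrow> space N"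
    and "x \<in> \<Omega>" "y \<in> \<Omega>" "T x = T y"
  shows "f x = f y"
proof -
  have "f -` {f x} \<inter> space (vimage_algebra \<Omega> T N) \<in> sets (vimage_algebra \<Omega> T N)"
    by (rule measurable_sets[OF f]) auto
  then obtain B where "B \<in> sets N" "f -` {f x} \<inter> \<Omega> = T -` B \<inter> \<Omega>"
    using T by (auto simp: sets_vimage_algebra2)
  then have "f z = f x \<longleftrightarrow> T z \<in> B" if "z \<in> \<Omega>" for z using that by auto
  from this[of x] this[of y] show ?thesis using assms(3-5) by simp
qed

definition shift :: "int \<Rightarrow> (int \<Rightarrow> 'a) \<Rightarrow> int \<Rightarrow> 'a" where
  "shift k x = (\<lambda>i. x (k + i))"

lemma shift_apply: "shift k x i = x (k + i)"
  by (simp add: shift_def)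

lemma shift_shift [simp]: "shift k (shift l x) = shift (l + k) x"
  by (simp add: shift_def add.assoc)

lemma shift_0 [simp]: "shift 0 x = x"
  by (simp add: shift_def)

lemma measurable_shift [measurable]: "shift k \<in> path_space A \<rightarrow>\<^sub>M path_space A"
  unfolding shift_def by (rule measurable_into_path_space) measurable

lemma distr_shift_invariant:
  fixes P :: "(int \<Rightarrow> 'a) measure"
  assumes s: "sets P = sets (path_space A)" and 1: "distr P (path_space A) (shift 1) = P"
  shows "distr P (path_space A) (shift k) = P"
proof -
  note [measurable_cong] = s
  have comp: "distr (distr P (path_space A) (shift k)) (path_space A) (shift l) = distr P (path_space A) (shift (k + l))" for k l
    by (subst distr_distr) (auto simp: comp_def)
  have z: "shift 0 = (\<lambda>x :: int \<Rightarrow> 'a. x)" by (rule ext) simp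
  have s0: "distr P (path_space A) (\<lambda>x. x) = P"
    using distr_id2[OF s[symmetric]] by simp
  \<comment> \<open>Pushing both sides of the invariance under \<open>shift 1\<close> forward by the
    inverse shift gives invariance under the inverse.\<close>
  have m1: "distr P (path_space A) (shift (-1)) = P"
    using comp[of 1 "-1"] by (simp add: 1 s0 z)
  have "distr P (path_space A) (shift (int n)) = P \<and> distr P (path_space A) (shift (- int n)) = P" for n
  proof (induction n)
    case 0
    show ?case using s0 by (simp add: z)
  next
    case (Suc n)
    then show ?case using comp[of "int n" 1] comp[of "- int n" "-1"] by (simp add: 1 m1 add.commute)
  qed
  from this[of "nat \<bar>k\<bar>"] show ?thesis by (cases "k \<ge> 0") auto
qed

section \<open>The coupling\<close>

lemma measurable_indicator_eq:
  assumes "f \<in> N \<rightarrow>\<^sub>M count_space A" "a \<in> A"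
  shows "(\<lambda>x. indicator {a} (f x) :: ennreal) \<in> borel_measurable N"
  by (rule measurable_compose[OF assms(1)]) simp

text \<open>Decomposition by the present letter: where \<open>x 0 = a\<close>, a quantity such as
  \<open>total (x 0) x\<close> becomes \<open>total a x\<close>, which depends on the past only and
  can be treated by conditioning on the past.\<close>

lemma nn_integral_over_letters:
  assumes "countable A" "sets P = sets (path_space A)" and f: "f \<in> borel_measurable P"
  shows "(\<integral>\<^sup>+x. f x \<partial>P) = (\<integral>\<^sup>+a. (\<integral>\<^sup>+x. f x * indicator {a} (x 0) \<partial>P) \<partial>count_space A)"
proof -
  note [measurable_cong] = assms(2)
  note [measurable] = f
  have sp: "x 0 \<in> A" if "x \<in> space P" for x
    using that sets_eq_imp_space_eq[OF assms(2)] by (auto simp: space_path_space)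
  have "(\<integral>\<^sup>+a. (\<integral>\<^sup>+x. f x * indicator {a} (x 0) \<partial>P) \<partial>count_space A)
      = (\<integral>\<^sup>+x. (\<integral>\<^sup>+a. f x * indicator {a} (x 0) \<partial>count_space A) \<partial>P)"
    by (rule nn_integral_count_space_nn_integral[symmetric])
       (auto intro!: borel_measurable_times_ennreal measurable_indicator_eq assms(1) f)
  also have "\<dots> = (\<integral>\<^sup>+x. f x \<partial>P)"
  proof (rule nn_integral_cong)
    fix x assume "x \<in> space P"
    then have "(\<integral>\<^sup>+a. f x * indicator {a} (x 0) \<partial>count_space A) = (\<integral>\<^sup>+a. f x * indicator {x 0} a \<partial>count_space A)"
      by (intro nn_integral_cong) (auto split: split_indicator)
    also have "\<dots> = f x"
      using sp[OF \<open>x \<in> space P\<close>] by (subst nn_integral_cmult_indicator) auto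
    finally show "(\<integral>\<^sup>+a. f x * indicator {a} (x 0) \<partial>count_space A) = f x" .
  qed
  finally show ?thesis ..
qed

text \<open>Half-open, so that \<open>r * total\<close> is strictly below \<open>total\<close> for
  every \<open>r\<close> whenever \<open>total\<close> is positive; then the \<open>LEAST\<close> in
  \<open>lag\<close> exists for every \<open>r\<close>.\<close>

definition unif :: "real measure" where
  "unif = restrict_space lborel {0..<1}"

lemma space_unif [simp]: "space unif = {0..<1}"
  by (auto simp: unif_def space_restrict_space)

lemma emeasure_unif: "B \<in> sets borel \<Longrightarrow> B \<subseteq> {0..<1} \<Longrightarrow> emeasure unif B = emeasure lborel B"
  unfolding unif_def by (subst emeasure_restrict_space) auto

interpretation unif: prob_space unif
  by (rule prob_spaceI) (simp add: emeasure_unif)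

lemma measurable_unif [measurable]: "(\<lambda>r. r) \<in> borel_measurable unif"
  unfolding unif_def by (rule measurable_restrict_space1) simp

text \<open>Distances start at \<open>1\<close>, so \<open>q m\<close> and \<open>g m\<close> belong
  to the distance \<open>Suc m\<close>. The last assumption says that mixing the predictions
  \<open>g m\<close> with weights \<open>q m\<close> gives the conditional law of the present letter
  given the past; in integrated form no version of a conditional probability has to be
  fixed.\<close>

locale lookback_law =
  fixes A :: "'a set" and P :: "(int \<Rightarrow> 'a) measure" and q :: "nat \<Rightarrow> real"
    and g :: "nat \<Rightarrow> (int \<Rightarrow> 'a) \<Rightarrow> 'a"
  assumes countable_A: "countable A"
    and prob: "prob_space P"
    and sets_P: "sets P = sets (path_space A)"
    and shift_P: "distr P (path_space A) (shift 1) = P"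
    and q_nonneg: "0 \<le> q m" and q_sums: "q sums 1"
    and g_window: "depends_on {- int (Suc m)..<0} (g m)"
    and g_in: "g m x \<in> A"
    and cond: "a \<in> A \<Longrightarrow> E \<in> sets (window_algebra A P (\<lambda>i x. x i) {..<0}) \<Longrightarrow>
      emeasure P ({x \<in> space P. x 0 = a} \<inter> E)
        = (\<integral>\<^sup>+x\<in>E. ennreal (\<Sum>m. q m * of_bool (g m x = a)) \<partial>P)"
begin

sublocale prob_space P by (rule prob)

declare sets_P [measurable_cong]

lemma space_P: "space P = {x. \<forall>i. x i \<in> A}"
  using sets_eq_imp_space_eq[OF sets_P] by (simp add: space_path_space)

lemma A_nonempty: "A \<noteq> {}"
  using g_in by blast

definition weight :: "nat \<Rightarrow> 'a \<Rightarrow> (int \<Rightarrow> 'a) \<Rightarrow> real" where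
  "weight n a x = (\<Sum>m<n. q m * of_bool (g m x = a))"

definition total :: "'a \<Rightarrow> (int \<Rightarrow> 'a) \<Rightarrow> real" where
  "total a x = (\<Sum>m. q m * of_bool (g m x = a))"

text \<open>
  If \<open>r\<close> is uniform on \<open>[0, 1)\<close>, then given the letters, \<open>lag x r = Suc m\<close> has probability
  \<open>q m / total (x 0) x\<close> if \<open>g m\<close> predicts the letter \<open>x 0\<close>, and \<open>0\<close> otherwise. The \<open>LEAST\<close> is
  unspecified, and harmless, on the null set where \<open>total (x 0) x = 0\<close>.
\<close>

definition lag :: "(int \<Rightarrow> 'a) \<Rightarrow> real \<Rightarrow> nat" where
  "lag x r = Suc (LEAST m. r * total (x 0) x < weight (Suc m) (x 0) x)"

lemma summable_total: "summable (\<lambda>m. q m * of_bool (g m x = a))"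
  by (rule summable_comparison_test[OF _ sums_summable[OF q_sums]])
     (use q_nonneg in \<open>auto simp: of_bool_def\<close>)

lemma weight_LIMSEQ: "(\<lambda>n. weight n a x) \<longlonglongrightarrow> total a x"
  unfolding weight_def total_def by (rule summable_LIMSEQ[OF summable_total])

lemma weight_mono: "m \<le> n \<Longrightarrow> weight m a x \<le> weight n a x"
  unfolding weight_def by (rule sum_mono2) (auto simp: q_nonneg)

lemma weight_nonneg: "0 \<le> weight n a x"
  unfolding weight_def by (intro sum_nonneg) (auto simp: q_nonneg)

lemma weight_le_total: "weight n a x \<le> total a x"
  by (rule incseq_le[OF _ weight_LIMSEQ]) (auto simp: incseq_def weight_mono)

lemma total_nonneg: "0 \<le> total a x"
  using weight_nonneg weight_le_total by (rule order_trans)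

lemma weight_Suc: "weight (Suc n) a x = weight n a x + q n * of_bool (g n x = a)"
  by (simp add: weight_def)

lemma depends_on_g: "depends_on {..<0} (g m)"
  by (rule depends_on_mono[OF g_window]) auto

lemma depends_on_total: "depends_on {..<0} (total a)"
proof (rule depends_onI)
  fix x y :: "int \<Rightarrow> 'a" assume "\<And>i. i \<in> {..<0} \<Longrightarrow> x i = y i"
  then have "g m x = g m y" for m by (rule depends_onD[OF depends_on_g])
  then show "total a x = total a y" by (simp add: total_def)
qed

lemma lag_cong:
  assumes "\<And>i. i \<le> 0 \<Longrightarrow> x i = y i"
  shows "lag x r = lag y r"
proof -
  have "g m x = g m y" for m by (rule depends_onD[OF depends_on_g]) (use assms in auto)
  then show ?thesis using assms[of 0] by (simp add: lag_def total_def weight_def)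
qed

lemma measurable_g_eq [measurable]: "(\<lambda>x. of_bool (g m x = a) :: real) \<in> borel_measurable (path_space A)"
  by (rule measurable_window_eq[OF _ countable_A A_nonempty g_window]) simp

lemma measurable_g_eq_0 [measurable]: "(\<lambda>x. of_bool (g m x = x 0) :: real) \<in> borel_measurable (path_space A)"
proof (rule measurable_finite_window[OF _ countable_A A_nonempty])
  show "depends_on ({- int (Suc m)..<0} \<union> {0}) (\<lambda>x. of_bool (g m x = x 0) :: real)"
  proof (rule depends_onI)
    fix x y :: "int \<Rightarrow> 'a" assume *: "\<And>i. i \<in> {- int (Suc m)..<0} \<union> {0} \<Longrightarrow> x i = y i"
    have "g m x = g m y" by (rule depends_onD[OF g_window]) (use * in auto)
    then show "of_bool (g m x = x 0) = (of_bool (g m y = y 0) :: real)" using *[of 0] by simp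
  qed
qed auto

lemma measurable_g [measurable]: "g m \<in> path_space A \<rightarrow>\<^sub>M count_space A"
  by (rule measurable_finite_window[OF _ countable_A A_nonempty g_window]) (auto simp: g_in)

lemma measurable_total [measurable]: "total a \<in> borel_measurable (path_space A)"
  unfolding total_def by measurable

lemma measurable_total_0 [measurable]: "(\<lambda>x. total (x 0) x) \<in> borel_measurable (path_space A)"
  unfolding total_def by measurable

lemma measurable_weight_0 [measurable]: "(\<lambda>x. weight n (x 0) x) \<in> borel_measurable (path_space A)"
  unfolding weight_def by measurable

lemma measurable_lag:
  assumes [measurable]: "f \<in> N \<rightarrow>\<^sub>M path_space A" "h \<in> borel_measurable N"
  shows "(\<lambda>z. lag (f z) (h z)) \<in> N \<rightarrow>\<^sub>M count_space UNIV"
proof -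
  have [measurable]: "(\<lambda>z. total (f z 0) (f z)) \<in> borel_measurable N"
    by (rule measurable_compose[OF assms(1) measurable_total_0])
  have [measurable]: "(\<lambda>z. weight n (f z 0) (f z)) \<in> borel_measurable N" for n
    by (rule measurable_compose[OF assms(1) measurable_weight_0])
  show ?thesis unfolding lag_def by measurable
qed

lemma measurable_past:
  assumes "h \<in> path_space A \<rightarrow>\<^sub>M N" "depends_on {..<0} h"
  shows "h \<in> window_algebra A P (\<lambda>i x. x i) {..<0} \<rightarrow>\<^sub>M N"
  using measurable_window_algebra[of "\<lambda>i x. x i" P A h N] assms A_nonempty by simp

text \<open>\<open>total a\<close> is a version of the conditional probability of \<open>a\<close>
  given the past: it depends on the past only and has the right integrals over past events. The
  identity then extends from events to nonnegative functions \<open>h\<close> of the past.\<close>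

lemma nn_integral_letter:
  assumes h [measurable]: "h \<in> borel_measurable (path_space A)" and "depends_on {..<0} h" "a \<in> A"
  shows "(\<integral>\<^sup>+x. h x * indicator {a} (x 0) \<partial>P) = (\<integral>\<^sup>+x. h x * ennreal (total a x) \<partial>P)"
proof -
  let ?F = "window_algebra A P (\<lambda>i x. x i) {..<0}"
  have sub: "subalgebra P ?F" by (rule subalgebra_window_algebra) measurable
  interpret finite_measure_subalgebra P ?F by unfold_locales (rule sub)
  have "{x \<in> space P. x 0 = a} = (\<lambda>x. x 0) -` {a} \<inter> space P" by auto
  also have "\<dots> \<in> sets P" using \<open>a \<in> A\<close> by measurable
  finally have [measurable]: "{x \<in> space P. x 0 = a} \<in> sets P" .
  have [measurable]: "(\<lambda>x. indicator {a} (x 0) :: ennreal) \<in> borel_measurable P"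
    by (rule measurable_indicator_eq[OF _ \<open>a \<in> A\<close>]) measurable
  have "AE x in P. ennreal (total a x) = nn_cond_exp P ?F (\<lambda>x. indicator {a} (x 0)) x"
  proof (rule nn_cond_exp_charact)
    fix E assume E: "E \<in> sets ?F"
    then have [measurable]: "E \<in> sets P" using sub by (auto simp: subalgebra_def)
    have "(\<integral>\<^sup>+x\<in>E. indicator {a} (x 0) \<partial>P) = (\<integral>\<^sup>+x. indicator ({x \<in> space P. x 0 = a} \<inter> E) x \<partial>P)"
      by (intro nn_integral_cong) (auto split: split_indicator)
    also have "\<dots> = (\<integral>\<^sup>+x\<in>E. ennreal (total a x) \<partial>P)"
      using cond[OF \<open>a \<in> A\<close> E] by (simp add: total_def)
    finally show "(\<integral>\<^sup>+x\<in>E. indicator {a} (x 0) \<partial>P) = (\<integral>\<^sup>+x\<in>E. ennreal (total a x) \<partial>P)" .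
  next
    have "(\<lambda>x. total a x) \<in> borel_measurable ?F"
      by (rule measurable_past) (auto intro: depends_on_total)
    then show "(\<lambda>x. ennreal (total a x)) \<in> borel_measurable ?F" by measurable
  qed measurable
  then have "(\<integral>\<^sup>+x. h x * ennreal (total a x) \<partial>P) = (\<integral>\<^sup>+x. h x * nn_cond_exp P ?F (\<lambda>x. indicator {a} (x 0)) x \<partial>P)"
    by (intro nn_integral_cong_AE) auto
  also have "\<dots> = (\<integral>\<^sup>+x. h x * indicator {a} (x 0) \<partial>P)"
    by (rule nn_cond_exp_intg) (use assms in \<open>auto intro: measurable_past\<close>)
  finally show ?thesis ..
qed

text \<open>The set where \<open>total a\<close> vanishes is a past event on which \<open>a\<close>
  has conditional probability \<open>0\<close>, and there are only countably many letters.\<close>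

lemma total_pos: "AE x in P. 0 < total (x 0) x"
proof -
  have "(\<integral>\<^sup>+x. indicator {0} (total (x 0) x) \<partial>P)
      = (\<integral>\<^sup>+a. (\<integral>\<^sup>+x. indicator {0} (total (x 0) x) * indicator {a} (x 0) \<partial>P) \<partial>count_space A)"
    by (rule nn_integral_over_letters[OF countable_A sets_P]) measurable
  also have "\<dots> = (\<integral>\<^sup>+a. 0 \<partial>count_space A)"
  proof (rule nn_integral_cong)
    fix a assume a: "a \<in> space (count_space A)"
    have "(\<integral>\<^sup>+x. indicator {0} (total (x 0) x) * indicator {a} (x 0) \<partial>P)
        = (\<integral>\<^sup>+x. indicator {0} (total a x) * indicator {a} (x 0) \<partial>P)"
      by (intro nn_integral_cong) (auto split: split_indicator)
    also have "\<dots> = (\<integral>\<^sup>+x. indicator {0} (total a x) * ennreal (total a x) \<partial>P)"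
    proof (rule nn_integral_letter)
      show "depends_on {..<0} (\<lambda>x. indicator {0} (total a x) :: ennreal)"
        using depends_on_total[of a] unfolding depends_on_def by metis
    qed (use a in auto)
    also have "\<dots> = (\<integral>\<^sup>+x. 0 \<partial>P)"
      by (intro nn_integral_cong) (auto split: split_indicator)
    finally show "(\<integral>\<^sup>+x. indicator {0} (total (x 0) x) * indicator {a} (x 0) \<partial>P) = (0::ennreal)" by simp
  qed
  finally have "(\<integral>\<^sup>+x. indicator {0} (total (x 0) x) \<partial>P) = (0::ennreal)" by simp
  then have "AE x in P. indicator {0} (total (x 0) x) = (0::ennreal)"
    by (subst (asm) nn_integral_0_iff_AE) measurable
  then show ?thesis
    by eventually_elim (use total_nonneg in \<open>auto simp: less_le indicator_def split: if_splits\<close>)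
qed

text \<open>Inverse-transform sampling: the weights cut \<open>[0, total)\<close> into consecutive
  intervals of lengths \<open>q m * of_bool (g m x = x 0)\<close>, and the lag names the interval
  that contains \<open>r * total (x 0) x\<close>.\<close>

lemma lag_eq_iff:
  assumes "0 < total (x 0) x" "0 \<le> r" "r < 1"
  shows "lag x r = Suc m \<longleftrightarrow> weight m (x 0) x \<le> r * total (x 0) x \<and> r * total (x 0) x < weight (Suc m) (x 0) x"
proof -
  let ?s = "r * total (x 0) x" and ?w = "\<lambda>n. weight n (x 0) x"
  have "?s < total (x 0) x" using assms by simp
  then have "\<forall>\<^sub>F n in sequentially. ?s < ?w n"
    using order_tendstoD(1)[OF weight_LIMSEQ] by blast
  then obtain n where "?s < ?w n" by (auto simp: eventually_sequentially)
  then have ex: "?s < ?w (Suc n)" using weight_mono[of n "Suc n" "x 0" x] by simp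
  show ?thesis
  proof
    assume "lag x r = Suc m"
    then have m: "(LEAST m. ?s < ?w (Suc m)) = m" by (simp add: lag_def)
    have "?s < ?w (Suc m)" using LeastI[of "\<lambda>m. ?s < ?w (Suc m)", OF ex] m by simp
    moreover have "?w m \<le> ?s"
    proof (cases m)
      case 0
      then show ?thesis using assms by (simp add: weight_def)
    next
      case (Suc k)
      then have "\<not> ?s < ?w (Suc k)" using not_less_Least[of k "\<lambda>m. ?s < ?w (Suc m)"] m by simp
      then show ?thesis using Suc by simp
    qed
    ultimately show "?w m \<le> ?s \<and> ?s < ?w (Suc m)" by blast
  next
    assume *: "?w m \<le> ?s \<and> ?s < ?w (Suc m)"
    have "(LEAST m. ?s < ?w (Suc m)) = m"
    proof (rule Least_equality)
      fix k assume "?s < ?w (Suc k)"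
      then have "\<not> Suc k \<le> m" using weight_mono[of "Suc k" m "x 0" x] * by linarith
      then show "m \<le> k" by simp
    qed (use * in blast)
    then show "lag x r = Suc m" by (simp add: lag_def)
  qed
qed

text \<open>The conditional distribution of the look-back distance at time \<open>0\<close> given
  all letters.\<close>

definition kern :: "nat set \<Rightarrow> (int \<Rightarrow> 'a) \<Rightarrow> ennreal" where
  "kern T x = emeasure unif {r \<in> space unif. lag x r \<in> T}"

lemma lag_sets: "x \<in> space P \<Longrightarrow> {r \<in> space unif. lag x r \<in> T} \<in> sets unif"
proof -
  assume "x \<in> space P"
  then have [measurable]: "(\<lambda>r. x) \<in> unif \<rightarrow>\<^sub>M path_space A"
    by (simp add: space_P space_path_space)
  have lag: "(\<lambda>r. lag x r) \<in> unif \<rightarrow>\<^sub>M count_space UNIV" by (rule measurable_lag) measurable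
  have "(\<lambda>r. lag x r) -` T \<inter> space unif \<in> sets unif"
    by (rule measurable_sets[OF lag]) simp
  then show ?thesis by (simp add: vimage_def Int_def conj_commute)
qed

lemma measurable_kern [measurable]: "kern T \<in> borel_measurable (path_space A)"
proof -
  have lag: "(\<lambda>z. lag (fst z) (snd z)) \<in> path_space A \<Otimes>\<^sub>M unif \<rightarrow>\<^sub>M count_space UNIV"
    by (rule measurable_lag) measurable
  have "(\<lambda>x. emeasure unif {r \<in> space unif. lag x r \<in> T}) \<in> borel_measurable (path_space A)"
  proof (rule unif.measurable_emeasure)
    have "(\<lambda>z. lag (fst z) (snd z)) -` T \<inter> space (path_space A \<Otimes>\<^sub>M unif) \<in> sets (path_space A \<Otimes>\<^sub>M unif)"
      by (rule measurable_sets[OF lag]) simp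
    also have "(\<lambda>z. lag (fst z) (snd z)) -` T \<inter> space (path_space A \<Otimes>\<^sub>M unif)
        = {z \<in> space (path_space A \<Otimes>\<^sub>M unif). snd z \<in> {r \<in> space unif. lag (fst z) r \<in> T}}"
      by (auto simp: space_pair_measure)
    finally show "{z \<in> space (path_space A \<Otimes>\<^sub>M unif). snd z \<in> {r \<in> space unif. lag (fst z) r \<in> T}}
        \<in> sets (path_space A \<Otimes>\<^sub>M unif)" .
  qed auto
  then show ?thesis unfolding kern_def[abs_def] .
qed

lemma depends_on_kern: "depends_on {..0} (kern T)"
proof (rule depends_onI)
  fix x y :: "int \<Rightarrow> 'a" assume "\<And>i. i \<in> {..0} \<Longrightarrow> x i = y i"
  then have "lag x r = lag y r" for r by (intro lag_cong) auto
  then show "kern T x = kern T y" by (simp add: kern_def)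
qed

lemma kern_singleton:
  assumes "0 < total (x 0) x"
  shows "kern {Suc m} x = ennreal (q m * of_bool (g m x = x 0) / total (x 0) x)"
proof -
  let ?t = "total (x 0) x" and ?w = "\<lambda>n. weight n (x 0) x"
  have "{r \<in> space unif. lag x r \<in> {Suc m}} = {?w m / ?t..<?w (Suc m) / ?t}"
  proof (intro equalityI subsetI)
    fix r assume "r \<in> {r \<in> space unif. lag x r \<in> {Suc m}}"
    then show "r \<in> {?w m / ?t..<?w (Suc m) / ?t}"
      using lag_eq_iff[OF assms, of r m] assms by (auto simp: field_simps)
  next
    fix r assume r: "r \<in> {?w m / ?t..<?w (Suc m) / ?t}"
    have "0 \<le> ?w m / ?t" using weight_nonneg assms by simp
    moreover have "?w (Suc m) / ?t \<le> 1" using weight_le_total[of "Suc m" "x 0" x] assms by simp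
    ultimately have "0 \<le> r" "r < 1" using r by auto
    then show "r \<in> {r \<in> space unif. lag x r \<in> {Suc m}}"
      using lag_eq_iff[OF assms, of r m] r assms by (auto simp: field_simps)
  qed
  moreover have "{?w m / ?t..<?w (Suc m) / ?t} \<subseteq> {0..<1}"
    using weight_nonneg[of m "x 0" x] weight_le_total[of "Suc m" "x 0" x] assms
    by (auto intro: order_trans[rotated] order_less_le_trans)
  moreover have "?w m / ?t \<le> ?w (Suc m) / ?t"
    using weight_mono[of m "Suc m" "x 0" x] assms by (simp add: divide_right_mono)
  ultimately show ?thesis
    unfolding kern_def by (simp add: emeasure_unif weight_Suc diff_divide_distrib[symmetric])
qed

definition lookback_measure :: "nat set \<Rightarrow> ennreal" where
  "lookback_measure T = (\<Sum>m. indicator T (Suc m) * ennreal (q m))"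

lemma kern_suminf:
  assumes "x \<in> space P"
  shows "kern T x = (\<Sum>m. indicator T (Suc m) * kern {Suc m} x)"
proof -
  let ?D = "\<lambda>m. {r \<in> space unif. lag x r \<in> T \<inter> {Suc m}}"
  have "(\<Union>m. ?D m) = {r \<in> space unif. lag x r \<in> T}"
    by (auto simp: lag_def)
  moreover have "(\<Sum>m. emeasure unif (?D m)) = emeasure unif (\<Union>m. ?D m)"
    by (rule suminf_emeasure) (use lag_sets[OF assms] in \<open>auto simp: disjoint_family_on_def simp del: Int_iff\<close>)
  moreover have "?D m = (if Suc m \<in> T then {r \<in> space unif. lag x r \<in> {Suc m}} else {})" for m
    by auto
  then have "emeasure unif (?D m) = indicator T (Suc m) * kern {Suc m} x" for m
    by (simp add: kern_def)
  ultimately show ?thesis by (simp add: kern_def)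
qed

text \<open>Where \<open>x 0 = a\<close>, the kernel is
  \<open>q m * of_bool (g m x = a) / total a x\<close>, and \<open>a\<close> itself has conditional
  probability \<open>total a x\<close>. Summing the product over \<open>a\<close> leaves
  \<open>q m\<close>, because \<open>g m x\<close> is exactly one letter of the alphabet.\<close>

lemma nn_integral_kern_singleton:
  assumes h [measurable]: "h \<in> borel_measurable (path_space A)" and dep: "depends_on {..<0} h"
  shows "(\<integral>\<^sup>+x. h x * kern {Suc m} x \<partial>P) = ennreal (q m) * (\<integral>\<^sup>+x. h x \<partial>P)"
proof -
  define k where "k a x = ennreal (q m * of_bool (g m x = a) / total a x)" for a x
  have [measurable]: "k a \<in> borel_measurable (path_space A)" for a
    unfolding k_def by measurable
  have dk: "depends_on {..<0} (\<lambda>x. h x * k a x)" for a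
  proof (rule depends_onI)
    fix x y :: "int \<Rightarrow> 'a" assume *: "\<And>i. i \<in> {..<0} \<Longrightarrow> x i = y i"
    show "h x * k a x = h y * k a y"
      using depends_onD[OF dep *] depends_onD[OF depends_on_g *] depends_onD[OF depends_on_total *]
      by (simp add: k_def)
  qed
  \<comment> \<open>Division by zero yields \<open>0\<close>, so for \<open>total a x = 0\<close>
    the right-hand side has to vanish too. It does, since the summand
    \<open>q m * of_bool (g m x = a)\<close> lies below \<open>total a x\<close>.\<close>
  have k: "k a x * ennreal (total a x) = ennreal (q m) * indicator {a} (g m x)" for a x
  proof (cases "total a x = 0")
    case True
    have "weight (Suc m) a x = weight m a x"
      using weight_le_total[of "Suc m" a x] weight_mono[of m "Suc m" a x] weight_nonneg[of m a x] True by linarith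
    then show ?thesis using True by (auto simp: k_def weight_Suc split: split_indicator)
  next
    case False
    then show ?thesis using q_nonneg[of m] total_nonneg[of a x]
      by (auto simp: k_def ennreal_mult'[symmetric] ennreal_mult[symmetric] split: split_indicator)
  qed
  have "(\<integral>\<^sup>+x. h x * kern {Suc m} x \<partial>P) =
      (\<integral>\<^sup>+a. (\<integral>\<^sup>+x. (h x * kern {Suc m} x) * indicator {a} (x 0) \<partial>P) \<partial>count_space A)"
    by (rule nn_integral_over_letters[OF countable_A sets_P]) measurable
  also have "\<dots> = (\<integral>\<^sup>+a. (\<integral>\<^sup>+x. (h x * k a x) * indicator {a} (x 0) \<partial>P) \<partial>count_space A)"
  proof (rule nn_integral_cong)
    fix a
    show "(\<integral>\<^sup>+x. (h x * kern {Suc m} x) * indicator {a} (x 0) \<partial>P) = (\<integral>\<^sup>+x. (h x * k a x) * indicator {a} (x 0) \<partial>P)"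
      by (rule nn_integral_cong_AE, use total_pos in eventually_elim)
         (auto simp: kern_singleton k_def split: split_indicator)
  qed
  also have "\<dots> = (\<integral>\<^sup>+a. (\<integral>\<^sup>+x. (h x * k a x) * ennreal (total a x) \<partial>P) \<partial>count_space A)"
    by (intro nn_integral_cong nn_integral_letter dk) auto
  also have "\<dots> = (\<integral>\<^sup>+a. (\<integral>\<^sup>+x. h x * ennreal (q m) * indicator {a} (g m x) \<partial>P) \<partial>count_space A)"
    by (simp add: mult.assoc k)
  also have "\<dots> = (\<integral>\<^sup>+x. (\<integral>\<^sup>+a. h x * ennreal (q m) * indicator {a} (g m x) \<partial>count_space A) \<partial>P)"
    by (rule nn_integral_count_space_nn_integral[symmetric])
       (auto intro!: borel_measurable_times_ennreal measurable_indicator_eq simp: countable_A)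
  also have "\<dots> = (\<integral>\<^sup>+x. h x * ennreal (q m) \<partial>P)"
  proof (rule nn_integral_cong)
    fix x
    have "(\<integral>\<^sup>+a. h x * ennreal (q m) * indicator {a} (g m x) \<partial>count_space A)
        = (\<integral>\<^sup>+a. h x * ennreal (q m) * indicator {g m x} a \<partial>count_space A)"
      by (intro nn_integral_cong) (auto split: split_indicator)
    then show "(\<integral>\<^sup>+a. h x * ennreal (q m) * indicator {a} (g m x) \<partial>count_space A) = h x * ennreal (q m)"
      using g_in[of m x] by (simp add: nn_integral_cmult_indicator)
  qed
  also have "\<dots> = (\<integral>\<^sup>+x. h x \<partial>P) * ennreal (q m)"
    by (rule nn_integral_multc) measurable
  finally show ?thesis by (simp only: mult.commute)
qed

text \<open>
  Averaging over the letter at time \<open>0\<close> cancels \<open>total\<close>: the lag at time \<open>0\<close> is independent of the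
  past. Applied to one time after the other, this makes the lags independent.
\<close>

lemma nn_integral_kern:
  assumes h [measurable]: "h \<in> borel_measurable (path_space A)" and dep: "depends_on {..<0} h"
  shows "(\<integral>\<^sup>+x. h x * kern T x \<partial>P) = lookback_measure T * (\<integral>\<^sup>+x. h x \<partial>P)"
proof -
  have "(\<integral>\<^sup>+x. h x * kern T x \<partial>P) = (\<integral>\<^sup>+x. (\<Sum>m. indicator T (Suc m) * (h x * kern {Suc m} x)) \<partial>P)"
  proof (rule nn_integral_cong)
    fix x assume "x \<in> space P"
    then have "h x * kern T x = (\<Sum>m. h x * (indicator T (Suc m) * kern {Suc m} x))"
      by (subst kern_suminf) simp_all
    then show "h x * kern T x = (\<Sum>m. indicator T (Suc m) * (h x * kern {Suc m} x))"
      by (simp add: mult.left_commute)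
  qed
  also have "\<dots> = (\<Sum>m. indicator T (Suc m) * (\<integral>\<^sup>+x. h x * kern {Suc m} x \<partial>P))"
    by (subst nn_integral_suminf) (auto simp: nn_integral_cmult)
  also have "\<dots> = (\<Sum>m. indicator T (Suc m) * ennreal (q m) * (\<integral>\<^sup>+x. h x \<partial>P))"
    by (simp add: nn_integral_kern_singleton[OF h dep] mult.assoc)
  finally show ?thesis by (simp add: lookback_measure_def)
qed

end

section \<open>Coupling the letters with look-back distances at all times\<close>

interpretation unif_seq: product_prob_space "\<lambda>_ :: int. unif" UNIV
  by unfold_locales

lemma unif_seq_shift: "distr (Pi\<^sub>M UNIV (\<lambda>_. unif)) (Pi\<^sub>M UNIV (\<lambda>_. unif)) (shift k) = Pi\<^sub>M UNIV (\<lambda>_. unif)"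
proof -
  have "distr (Pi\<^sub>M UNIV (\<lambda>_. unif)) (Pi\<^sub>M UNIV (\<lambda>_. unif)) (\<lambda>\<omega>. \<lambda>n\<in>UNIV. \<omega> (k + n)) = Pi\<^sub>M UNIV (\<lambda>_. unif)"
    by (rule distr_PiM_reindex[of UNIV "\<lambda>_. unif" "\<lambda>n. k + n" UNIV]) (auto simp: unif.prob_space_axioms)
  then show ?thesis by (simp add: shift_def[abs_def] restrict_def)
qed

lemma measurable_letter: "letter i \<in> path_space (A \<times> {1..}) \<rightarrow>\<^sub>M count_space A"
  unfolding letter_def[abs_def] by (rule measurable_compose[OF measurable_path_component]) auto

lemma measurable_lookback: "lookback i \<in> path_space (A \<times> {1..}) \<rightarrow>\<^sub>M count_space {1..}"
  unfolding lookback_def[abs_def] by (rule measurable_compose[OF measurable_path_component]) auto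

context lookback_law
begin

abbreviation "W \<equiv> Pi\<^sub>M (UNIV :: int set) (\<lambda>_. unif)"

text \<open>Every time has its own uniform variable, and time \<open>i\<close> applies the same rule
  to the path as seen from \<open>i\<close>. The former makes the distances conditionally
  independent given the letters, the latter makes \<open>join\<close> commute with shifts.\<close>

definition join :: "(int \<Rightarrow> 'a) \<times> (int \<Rightarrow> real) \<Rightarrow> int \<Rightarrow> 'a \<times> nat" where
  "join z i = (fst z i, lag (shift i (fst z)) (snd z i))"

definition joint :: "(int \<Rightarrow> 'a \<times> nat) measure" where
  "joint = distr (P \<Otimes>\<^sub>M W) (path_space (A \<times> {1..})) join"

lemma sets_joint: "sets joint = sets (path_space (A \<times> {1..}))"
  by (simp add: joint_def)

lemma space_joint: "space joint = space (path_space (A \<times> {1..}))"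
  by (simp add: joint_def)

declare sets_joint [measurable_cong]

lemma letter_join: "letter i (join z) = fst z i"
  by (simp add: letter_def join_def)

lemma lookback_join: "lookback i (join z) = lag (shift i (fst z)) (snd z i)"
  by (simp add: lookback_def join_def)

lemma measurable_lag_at: "(\<lambda>z. lag (shift i (fst z)) (snd z i)) \<in> P \<Otimes>\<^sub>M W \<rightarrow>\<^sub>M count_space UNIV"
proof (rule measurable_lag)
  show "(\<lambda>z. shift i (fst z)) \<in> P \<Otimes>\<^sub>M W \<rightarrow>\<^sub>M path_space A" by measurable
  show "(\<lambda>z. snd z i) \<in> borel_measurable (P \<Otimes>\<^sub>M W)"
    by (rule measurable_compose[OF _ measurable_unif]) measurable
qed

lemma measurable_join [measurable]: "join \<in> P \<Otimes>\<^sub>M W \<rightarrow>\<^sub>M path_space (A \<times> {1..})"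
proof -
  have "(\<lambda>z i. join z i) \<in> P \<Otimes>\<^sub>M W \<rightarrow>\<^sub>M path_space (A \<times> {1..})"
  proof (rule measurable_into_path_space)
    fix i
    have "(\<lambda>z. fst z i) \<in> P \<Otimes>\<^sub>M W \<rightarrow>\<^sub>M count_space A"
      by (rule measurable_compose[OF _ measurable_path_component]) measurable
    moreover have "(\<lambda>z. lag (shift i (fst z)) (snd z i)) \<in> P \<Otimes>\<^sub>M W \<rightarrow>\<^sub>M count_space {1..}"
      \<comment> \<open>A lag is a successor, so \<open>max 1\<close> does not change it and only
        moves the values into \<open>{1..}\<close>.\<close>
      using measurable_compose[OF measurable_lag_at[of i], of "\<lambda>n. max 1 n" "count_space {1..}"]
      by (simp add: lag_def)
    ultimately have "(\<lambda>z. join z i) \<in> P \<Otimes>\<^sub>M W \<rightarrow>\<^sub>M count_space A \<Otimes>\<^sub>M count_space {1..}"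
      unfolding join_def by (rule measurable_Pair)
    then show "(\<lambda>z. join z i) \<in> P \<Otimes>\<^sub>M W \<rightarrow>\<^sub>M count_space (A \<times> {1..})"
      by (simp only: pair_measure_countable[OF countable_A countableI_type])
  qed
  then show ?thesis by simp
qed

lemma prob_joint: "prob_space joint"
proof -
  interpret pair: pair_prob_space P W ..
  show ?thesis unfolding joint_def by (rule pair.prob_space_distr) measurable
qed

lemma measurable_letter_joint [measurable]: "letter i \<in> joint \<rightarrow>\<^sub>M count_space A"
  using measurable_letter by (simp add: measurable_cong_sets[OF sets_joint refl])

lemma measurable_lookback_joint [measurable]: "lookback i \<in> joint \<rightarrow>\<^sub>M count_space {1..}"
  using measurable_lookback by (simp add: measurable_cong_sets[OF sets_joint refl])

text \<open>\<open>join\<close> carries the simultaneous shift of letters and uniform variables to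
  the shift of the joint sequence, and both factors of the product law are shift invariant.\<close>

lemma stationary_joint: "stationary_process (A \<times> {1..}) joint (\<lambda>i x. x i)"
proof -
  interpret pair: pair_prob_space P W ..
  have "distr P P (shift 1) = P"
    using shift_P by (metis distr_cong sets_P)
  moreover have [measurable]: "shift 1 \<in> W \<rightarrow>\<^sub>M W"
    unfolding shift_def[abs_def]
    by (rule measurable_PiM_single') (auto simp: space_PiM intro: measurable_component_singleton)
  moreover have "shift 1 \<in> P \<rightarrow>\<^sub>M P" by measurable
  ultimately have "distr (P \<Otimes>\<^sub>M W) (P \<Otimes>\<^sub>M W) (\<lambda>(x, u). (shift 1 x, shift 1 u)) = P \<Otimes>\<^sub>M W"
    using pair_measure_distr[of "shift 1" P P "shift 1" W W] unif_seq.P.sigma_finite_measure_axioms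
    by (simp add: unif_seq_shift)
  then have inv: "joint = distr (distr (P \<Otimes>\<^sub>M W) (P \<Otimes>\<^sub>M W) (\<lambda>(x, u). (shift 1 x, shift 1 u))) (path_space (A \<times> {1..})) join"
    by (simp add: joint_def)
  have msh: "(\<lambda>(x, u). (shift 1 x, shift 1 u)) \<in> P \<Otimes>\<^sub>M W \<rightarrow>\<^sub>M P \<Otimes>\<^sub>M W"
    by measurable
  have "distr joint (path_space (A \<times> {1..})) (shift 1)
      = distr (P \<Otimes>\<^sub>M W) (path_space (A \<times> {1..})) (shift 1 \<circ> join)"
    unfolding joint_def by (rule distr_distr) measurable
  also have "shift 1 \<circ> join = join \<circ> (\<lambda>(x, u). (shift 1 x, shift 1 u))"
    by (auto simp: fun_eq_iff join_def shift_apply algebra_simps)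
  also have "distr (P \<Otimes>\<^sub>M W) (path_space (A \<times> {1..})) \<dots> = joint"
    unfolding inv by (rule distr_distr[symmetric, OF measurable_join msh])
  finally have "distr joint (path_space (A \<times> {1..})) (\<lambda>x i. x (i + 1)) = joint"
    by (simp add: shift_def[abs_def] add.commute)
  moreover have "distr joint (path_space (A \<times> {1..})) (\<lambda>x i. x i) = joint"
    using distr_id2[OF sets_joint[symmetric]] by simp
  moreover have "(\<lambda>x. x i) \<in> joint \<rightarrow>\<^sub>M count_space (A \<times> {1..})" for i
    using measurable_path_component by (simp only: measurable_cong_sets[OF sets_joint refl])
  ultimately show ?thesis
    unfolding stationary_process_def using prob_joint by simp
qed

lemma letters_law: "distr joint (path_space A) (\<lambda>x i. letter i x) = P"
proof -
  have "distr joint (path_space A) (\<lambda>x i. letter i x) = distr (P \<Otimes>\<^sub>M W) (path_space A) ((\<lambda>x i. letter i x) \<circ> join)"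
    unfolding joint_def by (intro distr_distr measurable_into_path_space measurable_letter measurable_join)
  also have "\<dots> = distr (P \<Otimes>\<^sub>M W) P fst"
    by (rule distr_cong) (auto simp: sets_P letter_join)
  finally show ?thesis by (simp add: unif_seq.distr_pair_fst)
qed

lemma measurable_letters [measurable]: "(\<lambda>y i. letter i y) \<in> joint \<rightarrow>\<^sub>M path_space A"
  by (rule measurable_into_path_space) measurable

text \<open>Fubini: once the letters are fixed, the distances at different times are functions of
  different uniform variables, so the conditional probabilities multiply.\<close>

lemma nn_integral_lookbacks:
  assumes "finite J" and [measurable]: "h \<in> borel_measurable (path_space A)"
  shows "(\<integral>\<^sup>+y. h (\<lambda>i. letter i y) * indicator {y. \<forall>j\<in>J. lookback j y \<in> T j} y \<partial>joint)
    = (\<integral>\<^sup>+x. h x * (\<Prod>j\<in>J. kern (T j) (shift j x)) \<partial>P)"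
proof -
  have [measurable]: "{y \<in> space joint. \<forall>j\<in>J. lookback j y \<in> T j} \<in> sets joint"
  proof -
    have "(\<lambda>y. lookback j y) -` (T j \<inter> {1..}) \<inter> space joint \<in> sets joint" for j
      by (rule measurable_sets[OF measurable_lookback_joint]) simp
    also have "(\<lambda>y. lookback j y) -` (T j \<inter> {1..}) \<inter> space joint = {y \<in> space joint. lookback j y \<in> T j}" for j
      using measurable_space[OF measurable_lookback_joint[of j]] by auto
    finally show ?thesis using \<open>finite J\<close> by (rule sets.sets_Collect_finite_All)
  qed
  have ind: "(\<lambda>y. h (\<lambda>i. letter i y) * indicator {y \<in> space joint. \<forall>j\<in>J. lookback j y \<in> T j} y) \<in> borel_measurable joint"
    by (intro borel_measurable_times_ennreal borel_measurable_indicator measurable_compose[OF measurable_letters]) measurable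
  have fub: "(\<lambda>z. h (fst z) * indicator {y \<in> space joint. \<forall>j\<in>J. lookback j y \<in> T j} (join z)) \<in> borel_measurable (P \<Otimes>\<^sub>M W)"
  proof -
    have "join \<in> P \<Otimes>\<^sub>M W \<rightarrow>\<^sub>M joint" by measurable
    from measurable_compose[OF this ind] show ?thesis by (simp add: letter_join)
  qed
  have "(\<integral>\<^sup>+y. h (\<lambda>i. letter i y) * indicator {y. \<forall>j\<in>J. lookback j y \<in> T j} y \<partial>joint)
      = (\<integral>\<^sup>+y. h (\<lambda>i. letter i y) * indicator {y \<in> space joint. \<forall>j\<in>J. lookback j y \<in> T j} y \<partial>joint)"
    by (rule nn_integral_cong) (auto split: split_indicator)
  also have "\<dots> = (\<integral>\<^sup>+z. h (fst z) * indicator {y \<in> space joint. \<forall>j\<in>J. lookback j y \<in> T j} (join z) \<partial>(P \<Otimes>\<^sub>M W))"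
    by (subst (1) joint_def, subst nn_integral_distr[OF measurable_join])
       (use ind in \<open>simp_all add: letter_join measurable_cong_sets[OF sets_joint refl]\<close>)
  also have "\<dots> = (\<integral>\<^sup>+x. \<integral>\<^sup>+u. h x * indicator {y \<in> space joint. \<forall>j\<in>J. lookback j y \<in> T j} (join (x, u)) \<partial>W \<partial>P)"
    using unif_seq.nn_integral_fst[OF fub] by simp
  also have "\<dots> = (\<integral>\<^sup>+x. h x * (\<Prod>j\<in>J. kern (T j) (shift j x)) \<partial>P)"
  proof (rule nn_integral_cong)
    fix x assume x: "x \<in> space P"
    let ?V = "\<lambda>j. {r \<in> space unif. lag (shift j x) r \<in> T j}"
    have V: "?V j \<in> sets unif" for j
      by (rule lag_sets) (use x in \<open>auto simp: space_P shift_apply\<close>)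
    have "(\<lambda>u. u j) -` ?V j \<inter> space W \<in> sets W" for j
      by (rule measurable_sets[OF _ V], rule measurable_component_singleton) simp
    also have "(\<lambda>u. u j) -` ?V j \<inter> space W = {u \<in> space W. u j \<in> ?V j}" for j by auto
    finally have VW: "{u \<in> space W. \<forall>j\<in>J. u j \<in> ?V j} \<in> sets W"
      using \<open>finite J\<close> by (rule sets.sets_Collect_finite_All)
    have "(\<integral>\<^sup>+u. h x * indicator {y \<in> space joint. \<forall>j\<in>J. lookback j y \<in> T j} (join (x, u)) \<partial>W)
      = (\<integral>\<^sup>+u. h x * indicator {u \<in> space W. \<forall>j\<in>J. u j \<in> ?V j} u \<partial>W)"
    proof (rule nn_integral_cong)
      fix u assume u: "u \<in> space W"
      then have "join (x, u) \<in> space joint"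
        using measurable_space[OF measurable_join, of "(x, u)"] x by (simp add: space_pair_measure space_joint)
      moreover have "u j \<in> space unif" for j using u by (auto simp: space_PiM)
      ultimately show "h x * indicator {y \<in> space joint. \<forall>j\<in>J. lookback j y \<in> T j} (join (x, u))
          = h x * indicator {u \<in> space W. \<forall>j\<in>J. u j \<in> ?V j} u"
        using u by (auto simp: lookback_join split: split_indicator)
    qed
    also have "\<dots> = h x * emeasure W {u \<in> space W. \<forall>j\<in>J. u j \<in> ?V j}"
      by (rule nn_integral_cmult_indicator[OF VW])
    also have "emeasure W {u \<in> space W. \<forall>j\<in>J. u j \<in> ?V j} = (\<Prod>j\<in>J. kern (T j) (shift j x))"
      unfolding kern_def by (rule unif_seq.emeasure_PiM_Collect) (use V \<open>finite J\<close> in auto)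
    finally show "(\<integral>\<^sup>+u. h x * indicator {y \<in> space joint. \<forall>j\<in>J. lookback j y \<in> T j} (join (x, u)) \<partial>W)
        = h x * (\<Prod>j\<in>J. kern (T j) (shift j x))" .
  qed
  finally show ?thesis .
qed

lemma nn_integral_shift:
  assumes [measurable]: "f \<in> borel_measurable (path_space A)"
  shows "(\<integral>\<^sup>+x. f (shift k x) \<partial>P) = (\<integral>\<^sup>+x. f x \<partial>P)"
proof -
  have "(\<integral>\<^sup>+x. f x \<partial>P) = (\<integral>\<^sup>+x. f x \<partial>(distr P (path_space A) (shift k)))"
    by (simp add: distr_shift_invariant[OF sets_P shift_P])
  also have "\<dots> = (\<integral>\<^sup>+x. f (shift k x) \<partial>P)"
    by (rule nn_integral_distr) measurable
  finally show ?thesis ..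
qed

text \<open>The lags at earlier times depend on the letters before time \<open>b\<close> only, so the largest time \<open>b\<close> splits off.\<close>

lemma nn_integral_prod_kern:
  "finite J \<Longrightarrow> (\<integral>\<^sup>+x. (\<Prod>j\<in>J. kern (T j) (shift j x)) \<partial>P) = (\<Prod>j\<in>J. lookback_measure (T j))"
proof (induction J rule: finite_linorder_max_induct)
  case empty
  show ?case using emeasure_space_1 by simp
next
  case (insert b J)
  let ?h = "\<lambda>x. \<Prod>j\<in>J. kern (T j) (shift (j - b) x)"
  have b: "b \<notin> J" using insert by auto
  have h: "?h \<in> borel_measurable (path_space A)" by measurable
  have dep: "depends_on {..<0} ?h"
  proof (rule depends_onI)
    fix x y :: "int \<Rightarrow> 'a" assume *: "\<And>i. i \<in> {..<0} \<Longrightarrow> x i = y i"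
    show "?h x = ?h y"
    proof (rule prod.cong[OF refl])
      fix j assume "j \<in> J"
      then have "j < b" using insert by auto
      then show "kern (T j) (shift (j - b) x) = kern (T j) (shift (j - b) y)"
        by (intro depends_onD[OF depends_on_kern]) (auto simp: shift_apply *)
    qed
  qed
  have "(\<integral>\<^sup>+x. (\<Prod>j\<in>insert b J. kern (T j) (shift j x)) \<partial>P) = (\<integral>\<^sup>+x. ?h (shift b x) * kern (T b) (shift b x) \<partial>P)"
    using insert(1) b by (simp add: mult.commute)
  also have "\<dots> = (\<integral>\<^sup>+x. ?h x * kern (T b) x \<partial>P)"
    by (rule nn_integral_shift) measurable
  also have "\<dots> = lookback_measure (T b) * (\<integral>\<^sup>+x. ?h x \<partial>P)"
    by (rule nn_integral_kern[OF h dep])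
  also have "(\<integral>\<^sup>+x. ?h x \<partial>P) = (\<integral>\<^sup>+x. ?h (shift b x) \<partial>P)"
    by (rule nn_integral_shift[OF h, symmetric])
  also have "\<dots> = (\<Prod>j\<in>J. lookback_measure (T j))"
    using insert.IH by simp
  finally show ?case using insert(1) b by simp
qed

section \<open>Law and independence of the look-back distances\<close>

lemma sets_lookback [measurable]: "{y \<in> space joint. lookback j y \<in> T} \<in> sets joint"
proof -
  have "(\<lambda>y. lookback j y) -` (T \<inter> {1..}) \<inter> space joint \<in> sets joint"
    by (rule measurable_sets[OF measurable_lookback_joint]) simp
  also have "(\<lambda>y. lookback j y) -` (T \<inter> {1..}) \<inter> space joint = {y \<in> space joint. lookback j y \<in> T}"
    using measurable_space[OF measurable_lookback_joint[of j]] by auto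
  finally show ?thesis .
qed

lemma emeasure_lookbacks:
  assumes "finite J"
  shows "emeasure joint {y \<in> space joint. \<forall>j\<in>J. lookback j y \<in> T j} = (\<Prod>j\<in>J. lookback_measure (T j))"
proof -
  have "{y \<in> space joint. \<forall>j\<in>J. lookback j y \<in> T j} \<in> sets joint"
    using assms by (intro sets.sets_Collect_finite_All) auto
  then have "emeasure joint {y \<in> space joint. \<forall>j\<in>J. lookback j y \<in> T j}
      = (\<integral>\<^sup>+y. indicator {y \<in> space joint. \<forall>j\<in>J. lookback j y \<in> T j} y \<partial>joint)" by simp
  also have "\<dots> = (\<integral>\<^sup>+y. 1 * indicator {y. \<forall>j\<in>J. lookback j y \<in> T j} y \<partial>joint)"
    by (rule nn_integral_cong) (auto split: split_indicator)
  also have "\<dots> = (\<Prod>j\<in>J. lookback_measure (T j))"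
    by (subst nn_integral_lookbacks[OF assms]) (simp_all add: nn_integral_prod_kern[OF assms])
  finally show ?thesis .
qed

text \<open>The indicator of a past event is a function \<open>h\<close> of the letters before time
  \<open>0\<close>, and averaging the kernel against such an \<open>h\<close> gives a product. The
  choice \<open>UNIV\<close> of the look-back event shows that \<open>lookback_measure\<close> has
  total mass \<open>1\<close> and identifies the other factor as the probability of
  \<open>E\<close>.\<close>

lemma emeasure_lookback_past:
  assumes "E \<in> sets (window_algebra A joint letter {..<0})"
  shows "emeasure joint ({y \<in> space joint. lookback 0 y \<in> T} \<inter> E)
    = emeasure joint {y \<in> space joint. lookback 0 y \<in> T} * emeasure joint E"
proof -
  have "(\<lambda>w. \<lambda>i\<in>{..<0}. letter i w) \<in> space joint \<rightarrow> space (Pi\<^sub>M {..<0::int} (\<lambda>_. count_space A))"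
    using measurable_space[OF measurable_letter_joint] by (auto simp: space_PiM)
  then obtain B where B [measurable]: "B \<in> sets (Pi\<^sub>M {..<0::int} (\<lambda>_. count_space A))"
    and E: "E = (\<lambda>w. \<lambda>i\<in>{..<0}. letter i w) -` B \<inter> space joint"
    using assms by (auto simp: window_algebra_def sets_vimage_algebra2)
  define h :: "(int \<Rightarrow> 'a) \<Rightarrow> ennreal" where "h x = indicator B (restrict x {..<0})" for x
  have h: "h \<in> borel_measurable (path_space A)"
  proof -
    have "(\<lambda>x. restrict x {..<0}) \<in> path_space A \<rightarrow>\<^sub>M Pi\<^sub>M {..<0::int} (\<lambda>_. count_space A)" by measurable
    then show ?thesis unfolding h_def by measurable
  qed
  have dep: "depends_on {..<0} h"
  proof (rule depends_onI)
    fix x y :: "int \<Rightarrow> 'a" assume "\<And>i. i \<in> {..<0} \<Longrightarrow> x i = y i"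
    then have "restrict x {..<0} = restrict y {..<0}" by auto
    then show "h x = h y" by (simp add: h_def)
  qed
  have "E \<in> sets joint" using assms subalgebra_window_algebra[of letter joint A "{..<0}"]
    by (auto simp: subalgebra_def)
  have *: "emeasure joint ({y \<in> space joint. lookback 0 y \<in> S} \<inter> E) = lookback_measure S * (\<integral>\<^sup>+x. h x \<partial>P)" for S
  proof -
    have "emeasure joint ({y \<in> space joint. lookback 0 y \<in> S} \<inter> E)
        = (\<integral>\<^sup>+y. indicator ({y \<in> space joint. lookback 0 y \<in> S} \<inter> E) y \<partial>joint)"
      using \<open>E \<in> sets joint\<close> by simp
    also have "\<dots> = (\<integral>\<^sup>+y. h (\<lambda>i. letter i y) * indicator {y. \<forall>j\<in>{0}. lookback j y \<in> S} y \<partial>joint)"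
      by (rule nn_integral_cong) (auto simp: E h_def split: split_indicator)
    also have "\<dots> = (\<integral>\<^sup>+x. h x * kern S x \<partial>P)"
      by (subst nn_integral_lookbacks[OF _ h]) simp_all
    finally show ?thesis by (simp add: nn_integral_kern[OF h dep])
  qed
  have T: "emeasure joint {y \<in> space joint. lookback 0 y \<in> S} = lookback_measure S" for S
    using emeasure_lookbacks[of "{0}" "\<lambda>_. S"] by simp
  have "lookback_measure UNIV = 1"
    using T[of UNIV] prob_space.emeasure_space_1[OF prob_joint] by simp
  then have "emeasure joint E = (\<integral>\<^sup>+x. h x \<partial>P)"
    using *[of UNIV] sets.sets_into_space[OF \<open>E \<in> sets joint\<close>] by (simp add: Int_absorb1)
  then show ?thesis by (simp add: * T)
qed

lemma indep_lookbacks: "prob_space.indep_vars joint (\<lambda>_. count_space {1..}) lookback UNIV"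
proof -
  interpret Q: prob_space joint by (rule prob_joint)
  have pr: "ennreal (Q.prob {y \<in> space joint. \<forall>j\<in>J. lookback j y \<in> T j})
      = ennreal (\<Prod>j\<in>J. Q.prob {y \<in> space joint. lookback j y \<in> T j})" if "finite J" for J T
  proof -
    have "lookback_measure (T j) = ennreal (Q.prob {y \<in> space joint. lookback j y \<in> T j})" for j
      using emeasure_lookbacks[of "{j}" T] by (simp add: Q.emeasure_eq_measure)
    then show ?thesis
      using emeasure_lookbacks[OF that, of T] by (simp add: Q.emeasure_eq_measure prod_ennreal)
  qed
  show ?thesis
    unfolding Q.indep_vars_def2
  proof (intro conjI ballI Q.indep_setsI)
    fix B and J :: "int set" assume J: "J \<noteq> {}" "finite J" and B: "\<forall>j\<in>J. B j \<in> {lookback j -` T \<inter> space joint |T. T \<in> sets (count_space {1..})}"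
    then have "\<forall>j\<in>J. \<exists>T. B j = lookback j -` T \<inter> space joint" by blast
    then obtain T where "\<forall>j\<in>J. B j = lookback j -` T j \<inter> space joint"
      by (rule bchoice[THEN exE])
    then have "B j = {y \<in> space joint. lookback j y \<in> T j}" if "j \<in> J" for j using that by auto
    moreover from this have "(\<Inter>j\<in>J. B j) = {y \<in> space joint. \<forall>j\<in>J. lookback j y \<in> T j}" using J by auto
    ultimately show "Q.prob (\<Inter>j\<in>J. B j) = (\<Prod>j\<in>J. Q.prob (B j))"
      using pr[OF J(2), of T] by (simp add: prod_nonneg)
  qed (rule measurable_lookback_joint, auto intro: measurable_sets[OF measurable_lookback_joint])
qed

lemma indep_lookback_past:
  "prob_space.indep_set joint
    (sets (vimage_algebra (space joint) (lookback 0) (count_space {1..})))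
    (sets (window_algebra A joint letter {..<0}))"
proof -
  interpret Q: prob_space joint by (rule prob_joint)
  have sub: "sets (window_algebra A joint letter {..<0}) \<subseteq> sets joint"
    using subalgebra_window_algebra[of letter joint A] by (auto simp: subalgebra_def)
  have s: "D \<in> sets (vimage_algebra (space joint) (lookback 0) (count_space {1..})) \<Longrightarrow>
      \<exists>T. D = {y \<in> space joint. lookback 0 y \<in> T}" for D
    using measurable_space[OF measurable_lookback_joint[of 0]]
    by (subst (asm) sets_vimage_algebra2) auto
  show ?thesis
  proof (rule Q.indep_setI)
    fix D E assume "D \<in> sets (vimage_algebra (space joint) (lookback 0) (count_space {1..}))"
      and E: "E \<in> sets (window_algebra A joint letter {..<0})"
    then obtain T where D: "D = {y \<in> space joint. lookback 0 y \<in> T}" using s by blast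
    show "Q.prob (D \<inter> E) = Q.prob D * Q.prob E"
      using emeasure_lookback_past[OF E, of T] unfolding D
      by (simp add: Q.emeasure_eq_measure ennreal_mult[symmetric])
  qed (use sub s sets_lookback in blast)+
qed

section \<open>The past and the look-back distance determine the letter\<close>

lemma sets_g_letter: "{y \<in> space joint. g m (\<lambda>i. letter i y) = letter 0 y} \<in> sets joint"
proof -
  have "(\<lambda>y. of_bool (g m (\<lambda>i. letter i y) = letter 0 y) :: real) \<in> borel_measurable joint"
    by (rule measurable_compose[OF measurable_letters measurable_g_eq_0])
  then have "(\<lambda>y. of_bool (g m (\<lambda>i. letter i y) = letter 0 y) :: real) -` {1} \<inter> space joint \<in> sets joint"
    by (rule measurable_sets) simp
  also have "(\<lambda>y. of_bool (g m (\<lambda>i. letter i y) = letter 0 y) :: real) -` {1} \<inter> space joint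
      = {y \<in> space joint. g m (\<lambda>i. letter i y) = letter 0 y}" by auto
  finally show ?thesis .
qed

text \<open>If the distance is \<open>Suc m\<close>, then \<open>r * total\<close> lies in the
  interval with index \<open>m\<close>. This interval is therefore not empty, which means that
  \<open>g m\<close> predicts the present letter.\<close>

lemma AE_letter: "AE y in joint. lookback 0 y = Suc m \<longrightarrow> g m (\<lambda>i. letter i y) = letter 0 y"
proof -
  have meas: "{y \<in> space joint. lookback 0 y = Suc m \<longrightarrow> g m (\<lambda>i. letter i y) = letter 0 y} \<in> sets joint"
    using sets_lookback[of 0 "- {Suc m}"] sets_g_letter[of m]
    by (auto intro: sets.sets_Collect_imp sets.sets_Collect_neg)
  have fst: "distr (P \<Otimes>\<^sub>M W) P fst = P" by (rule unif_seq.distr_pair_fst)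
  have "AE x in distr (P \<Otimes>\<^sub>M W) P fst. 0 < total (x 0) x"
    unfolding fst by (rule total_pos)
  then have "AE z in P \<Otimes>\<^sub>M W. 0 < total (fst z 0) (fst z)"
    by (rule AE_distrD[rotated]) measurable
  then have "AE z in P \<Otimes>\<^sub>M W. lookback 0 (join z) = Suc m \<longrightarrow> g m (\<lambda>i. letter i (join z)) = letter 0 (join z)"
  proof (rule AE_mp, intro AE_I2 impI)
    fix z assume z: "z \<in> space (P \<Otimes>\<^sub>M W)" and pos: "0 < total (fst z 0) (fst z)" and "lookback 0 (join z) = Suc m"
    then have lag: "lag (fst z) (snd z 0) = Suc m" by (simp add: lookback_join)
    have "snd z \<in> space W" using z by (auto simp: space_pair_measure)
    then have "snd z 0 \<in> space unif" by (auto simp: space_PiM)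
    then have "0 \<le> snd z 0" "snd z 0 < 1" by auto
    from lag_eq_iff[of "fst z", OF pos this, of m] lag
    have "q m * of_bool (g m (fst z) = fst z 0) > 0" by (simp add: weight_Suc)
    then show "g m (\<lambda>i. letter i (join z)) = letter 0 (join z)"
      by (simp add: letter_join of_bool_def split: if_splits)
  qed
  then show ?thesis
    unfolding joint_def by (subst AE_distr_iff[OF measurable_join]) (use meas in \<open>auto simp: space_joint sets_joint\<close>)
qed

text \<open>The event \<open>lookback 0 y = Suc m\<close> and the prediction \<open>g m\<close> are
  both known to the conditioning algebra once \<open>I\<close> contains the last
  \<open>Suc m\<close> letters, and on this event the present letter is the prediction. Since
  \<open>I\<close> may be the window or the whole past, the Markov property and the values in
  \<open>{0, 1}\<close> come out together.\<close>

lemma cond_pr_joint: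
  assumes I: "{- int (Suc m)..<0} \<subseteq> I" and E: "E \<subseteq> A"
  shows "AE y in joint. lookback 0 y = Suc m \<longrightarrow>
    cond_pr joint (window_lookback_algebra A joint I) (letter 0) E y = indicator E (g m (\<lambda>i. letter i y))"
proof -
  interpret Q: prob_space joint by (rule prob_joint)
  let ?F = "window_lookback_algebra A joint I"
  have sub: "subalgebra joint ?F" by (rule subalgebra_window_lookback_algebra[OF sets_joint])
  interpret finite_measure_subalgebra joint ?F by unfold_locales (rule sub)
  define l where "l y = (indicator {Suc m} (lookback 0 y) :: real)" for y :: "int \<Rightarrow> 'a \<times> nat"
  define e where "e y = (indicator E (g m (\<lambda>i. letter i y)) :: real)" for y :: "int \<Rightarrow> 'a \<times> nat"
  define f where "f = (indicator {y \<in> space joint. letter 0 y \<in> E} :: _ \<Rightarrow> real)"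
  have T: "(\<lambda>x. (\<lambda>i\<in>I. letter i x, lookback 0 x)) \<in> ?F \<rightarrow>\<^sub>M Pi\<^sub>M I (\<lambda>_. count_space A) \<Otimes>\<^sub>M count_space {1..}"
    unfolding window_lookback_algebra_def
    using measurable_space[OF measurable_letter_joint] measurable_space[OF measurable_lookback_joint]
    by (intro measurable_vimage_algebra1) (auto simp: space_PiM space_pair_measure)
  have l: "l \<in> borel_measurable ?F"
  proof -
    have "lookback 0 \<in> ?F \<rightarrow>\<^sub>M count_space {1..}"
      using measurable_compose[OF T measurable_snd] by simp
    then show ?thesis unfolding l_def by (rule measurable_compose) simp
  qed
  have e: "e \<in> borel_measurable ?F"
  proof -
    obtain h where h: "h \<in> Pi\<^sub>M I (\<lambda>_. count_space A) \<rightarrow>\<^sub>M count_space A" "\<And>x. g m x = h (restrict x I)"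
      using window_factor[OF measurable_g depends_on_mono[OF g_window I] A_nonempty] by blast
    have "(\<lambda>y. h (fst (\<lambda>i\<in>I. letter i y, lookback 0 y))) \<in> ?F \<rightarrow>\<^sub>M count_space A"
      using measurable_compose[OF measurable_compose[OF T measurable_fst] h(1)] .
    then have "(\<lambda>y. g m (\<lambda>i. letter i y)) \<in> ?F \<rightarrow>\<^sub>M count_space A"
      by (simp add: h(2))
    then show ?thesis unfolding e_def by (rule measurable_compose) simp
  qed
  have f: "f \<in> borel_measurable joint"
  proof -
    have "letter 0 -` E \<inter> space joint \<in> sets joint"
      by (rule measurable_sets[OF measurable_letter_joint]) (use E in auto)
    then have "{y \<in> space joint. letter 0 y \<in> E} \<in> sets joint" by (simp add: vimage_def Int_def conj_commute)
    then show ?thesis unfolding f_def by simp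
  qed
  note lM = measurable_from_subalg[OF sub l] and eM = measurable_from_subalg[OF sub e]
  have "(\<lambda>y. l y * f y) \<in> borel_measurable joint" "(\<lambda>y. l y * e y) \<in> borel_measurable joint"
    by (intro borel_measurable_times lM eM f)+
  moreover have "norm (l y * f y) \<le> 1" "norm (l y * e y) \<le> 1" for y
    by (auto simp: l_def e_def f_def split: split_indicator)
  ultimately have int: "integrable joint (\<lambda>y. l y * f y)" "integrable joint (\<lambda>y. l y * e y)"
    by (auto intro!: Q.integrable_const_bound[where B=1])
  \<comment> \<open>Multiplying by the known factor \<open>l\<close> localises to the event. There
    the letter may be replaced by the prediction, which is its own conditional expectation.\<close>
  have "AE y in joint. real_cond_exp joint ?F (\<lambda>y. l y * f y) y = l y * real_cond_exp joint ?F f y"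
    by (rule real_cond_exp_mult[OF l f int(1)])
  moreover have "AE y in joint. real_cond_exp joint ?F (\<lambda>y. l y * f y) y = real_cond_exp joint ?F (\<lambda>y. l y * e y) y"
  proof (rule real_cond_exp_cong)
    show "AE y in joint. l y * f y = l y * e y"
      using AE_letter[of m] AE_space by eventually_elim (auto simp: l_def e_def f_def split: split_indicator)
  qed (use lM eM f in measurable)
  moreover have "AE y in joint. real_cond_exp joint ?F (\<lambda>y. l y * e y) y = l y * e y"
    by (rule real_cond_exp_F_meas[OF int(2)]) (use l e in measurable)
  ultimately show ?thesis
    by eventually_elim (auto simp: l_def e_def f_def cond_pr_def)
qed

lemma deterministic_joint:
  assumes "distr M (path_space A) (\<lambda>w i. X i w) = P"
  shows "deterministic_representation A M X joint"
proof -
  have eq: "AE y in joint. lookback 0 y = n \<longrightarrow>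
      cond_pr joint (window_lookback_algebra A joint {..<0}) (letter 0) E y
        = cond_pr joint (window_lookback_algebra A joint {- int n..<0}) (letter 0) E y \<and>
      cond_pr joint (window_lookback_algebra A joint {- int n..<0}) (letter 0) E y \<in> {0, 1}"
    if n: "n \<ge> 1" and E: "E \<subseteq> A" for n E
  proof -
    obtain m where m: "n = Suc m" using n by (cases n) auto
    have "{- int (Suc m)..<0} \<subseteq> {..<0}" "{- int (Suc m)..<0} \<subseteq> {- int n..<0}"
      unfolding m by auto
    from this[THEN cond_pr_joint, OF E] show ?thesis
      unfolding m by eventually_elim (simp add: indicator_def)
  qed
  show ?thesis
    unfolding deterministic_representation_def complete_random_step_representation_def
  proof (intro conjI allI impI ballI)
    show "AE x in joint. lookback 0 x = n \<longrightarrow>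
          cond_pr joint (window_lookback_algebra A joint {- int n..<0}) (letter 0) E x =
          cond_pr joint (window_lookback_algebra A joint {..<0}) (letter 0) E x"
      if "n \<ge> 1" "E \<subseteq> A" for n E
      using eq[OF that] by eventually_elim auto
  next
    fix n :: nat and a assume "1 \<le> n" "a \<in> A"
    then show "AE x in joint. lookback 0 x = n \<longrightarrow>
        cond_pr joint (window_lookback_algebra A joint {..<0}) (letter 0) {a} x
        = cond_pr joint (window_lookback_algebra A joint {- int n..<0}) (letter 0) {a} x \<and>
        cond_pr joint (window_lookback_algebra A joint {- int n..<0}) (letter 0) {a} x \<in> {0, 1}"
      by (intro eq) auto
  next
    show "distr joint (path_space A) (\<lambda>x i. letter i x) = distr M (path_space A) (\<lambda>w i. X i w)"
      by (rule trans[OF letters_law assms[symmetric]])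
  qed (rule sets_joint stationary_joint indep_lookbacks indep_lookback_past)+
qed

lemma nn_integral_lookback_joint:
  "(\<integral>\<^sup>+y. of_nat (lookback 0 y) \<partial>joint) = (\<Sum>n. ennreal (1 - (\<Sum>m<n. q m)))"
proof -
  interpret Q: prob_space joint by (rule prob_joint)
  have m: "lookback 0 \<in> joint \<rightarrow>\<^sub>M count_space UNIV"
    by (rule measurable_compose[OF measurable_lookback_joint, of "\<lambda>x. x"]) simp
  have "emeasure joint {y \<in> space joint. n < lookback 0 y} = ennreal (1 - (\<Sum>m<n. q m))" for n
  proof -
    have "{y \<in> space joint. n < lookback 0 y} = space joint - {y \<in> space joint. lookback 0 y \<in> {..n}}"
      by auto
    moreover have "emeasure joint {y \<in> space joint. lookback 0 y \<in> {..n}} = ennreal (\<Sum>m<n. q m)"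
    proof -
      have "emeasure joint {y \<in> space joint. lookback 0 y \<in> {..n}} = (\<Sum>m. indicator {..n} (Suc m) * ennreal (q m))"
        using emeasure_lookbacks[of "{0}" "\<lambda>_. {..n}"] by (simp add: lookback_measure_def)
      also have "\<dots> = (\<Sum>m<n. indicator {..n} (Suc m) * ennreal (q m))"
        by (rule suminf_finite) auto
      also have "\<dots> = ennreal (\<Sum>m<n. q m)"
        by (subst sum_ennreal[symmetric]) (auto simp: q_nonneg intro!: sum.cong)
      finally show ?thesis .
    qed
    ultimately show ?thesis
      using Q.emeasure_space_1 q_nonneg
      by (simp add: emeasure_compl sum_nonneg ennreal_minus flip: ennreal_1)
  qed
  then show ?thesis by (simp add: nn_integral_nat_function[OF m])
qed

end

section \<open>The greedy choice\<close>

text \<open>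
  \<open>budget \<kappa> v n\<close> is the probability not yet assigned to a look-back distance \<open>\<le> n\<close>. Some letter still
  has at least the fraction \<open>1 / (2 * \<kappa>)\<close> of it; \<open>v\<close> is the error made by seeing \<open>Suc n\<close> letters only.
\<close>

fun budget :: "(real \<Rightarrow> real) \<Rightarrow> (nat \<Rightarrow> real) \<Rightarrow> nat \<Rightarrow> real" where
  "budget \<kappa> v 0 = 1"
| "budget \<kappa> v (Suc n) =
    budget \<kappa> v n - max 0 (budget \<kappa> v n / (2 * \<kappa> (budget \<kappa> v n)) - v (Suc n))"

text \<open>\<open>\<kappa> r\<close> will bound the number of letters needed to carry all but
  \<open>r / 2\<close> of the mass. It may grow without bound as \<open>r\<close> shrinks, so the
  fraction of the budget that a step spends may tend to \<open>0\<close>.\<close>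

locale budget_recursion =
  fixes \<kappa> :: "real \<Rightarrow> real" and v :: "nat \<Rightarrow> real"
  assumes \<kappa>_ge_1: "0 < r \<Longrightarrow> 1 \<le> \<kappa> r"
    and \<kappa>_antimono: "0 < r \<Longrightarrow> r \<le> s \<Longrightarrow> \<kappa> s \<le> \<kappa> r"
    and v_nonneg: "0 \<le> v n"
begin

abbreviation "R \<equiv> budget \<kappa> v"

lemma R_pos: "0 < R n"
proof (induction n)
  case (Suc n)
  \<comment> \<open>As \<open>\<kappa>\<close> is at least \<open>1\<close>, a step spends at most
    half of the budget, which therefore never runs out.\<close>
  have "R n / (2 * \<kappa> (R n)) \<le> R n / 2"
    using \<kappa>_ge_1[OF Suc] Suc by (intro divide_left_mono) auto
  then show ?case using Suc v_nonneg[of "Suc n"] by simp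
qed simp

lemma R_Suc_le: "R (Suc n) \<le> R n"
  by simp

lemma R_decreasing: "R n - R (Suc n) \<ge> R n / (2 * \<kappa> (R n)) - v (Suc n)"
  by simp

text \<open>As \<open>\<kappa>\<close> is antimonotone, a positive limit \<open>L\<close> would
  force every step to spend at least \<open>L / (2 * \<kappa> L) - v (Suc n)\<close>, whereas the
  amounts spent tend to \<open>0\<close>.\<close>

lemma R_LIMSEQ:
  assumes "v \<longlonglongrightarrow> 0"
  shows "R \<longlonglongrightarrow> 0"
proof -
  have dec: "decseq R" by (rule decseq_SucI) (rule R_Suc_le)
  obtain L where L: "R \<longlonglongrightarrow> L" and LR: "\<And>n. L \<le> R n"
    using decseq_convergent[OF dec, of 0] R_pos by (metis less_imp_le)
  have "0 \<le> L" using L R_pos by (intro LIMSEQ_le_const[OF L]) (auto intro: less_imp_le)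
  moreover have "\<not> 0 < L"
  proof
    assume pos: "0 < L"
    have "L / (2 * \<kappa> L) - v (Suc n) \<le> R n - R (Suc n)" for n
    proof -
      have "L / (2 * \<kappa> L) \<le> R n / (2 * \<kappa> (R n))"
        using \<kappa>_antimono[OF pos LR[of n]] \<kappa>_ge_1[OF R_pos[of n]] LR[of n] pos
        by (intro frac_le) auto
      then show ?thesis using R_decreasing[of n] by linarith
    qed
    moreover have "(\<lambda>n. L / (2 * \<kappa> L) - v (Suc n)) \<longlonglongrightarrow> L / (2 * \<kappa> L) - 0"
      using LIMSEQ_Suc[OF assms] by (intro tendsto_intros)
    moreover have "(\<lambda>n. R n - R (Suc n)) \<longlonglongrightarrow> L - L"
      using L LIMSEQ_Suc[OF L] by (intro tendsto_intros)
    ultimately have "L / (2 * \<kappa> L) - 0 \<le> L - L"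
      by (intro LIMSEQ_le) auto
    moreover have "0 < L / (2 * \<kappa> L)" using pos \<kappa>_ge_1[OF pos] by simp
    ultimately show False by simp
  qed
  ultimately show ?thesis using L by simp
qed

text \<open>With \<open>\<kappa>\<close> bounded by \<open>d\<close>, every step spends at least the
  fixed fraction \<open>1 / (2 * d)\<close> of the budget up to the error \<open>v (Suc n)\<close>,
  and the amounts spent telescope to at most \<open>1\<close>.\<close>

lemma R_summable:
  assumes d: "\<And>r. 0 < r \<Longrightarrow> \<kappa> r \<le> d" and v: "summable (\<lambda>n. v (Suc n))"
  shows "summable R"
proof (rule summableI_nonneg_bounded)
  have d0: "1 \<le> d" using d[of 1] \<kappa>_ge_1[of 1] by simp
  fix N
  have "R n / (2 * d) \<le> R n - R (Suc n) + v (Suc n)" for n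
  proof -
    have "R n / (2 * d) \<le> R n / (2 * \<kappa> (R n))"
      using d[OF R_pos[of n]] \<kappa>_ge_1[OF R_pos[of n]] R_pos[of n] by (intro divide_left_mono) auto
    then show ?thesis using R_decreasing[of n] by linarith
  qed
  then have "(\<Sum>n<N. R n / (2 * d)) \<le> (\<Sum>n<N. R n - R (Suc n) + v (Suc n))"
    by (intro sum_mono)
  also have "\<dots> = 1 - R N + (\<Sum>n<N. v (Suc n))"
    by (simp add: sum.distrib sum_lessThan_telescope' del: budget.simps(2))
  also have "\<dots> \<le> 1 + (\<Sum>n. v (Suc n))"
    using R_pos[of N] sum_le_suminf[OF v, of "{..<N}"] v_nonneg by auto
  finally show "(\<Sum>n<N. R n) \<le> 2 * d * (1 + (\<Sum>n. v (Suc n)))"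
    using d0 by (simp add: sum_divide_distrib[symmetric] divide_le_eq mult.commute)
qed (simp add: R_pos less_imp_le)

end

section \<open>Finite sets of letters outside which the dominating measure is small\<close>

lemma finite_approximation:
  assumes A: "countable A" "A \<noteq> {}" and \<mu>: "sets \<mu> = sets (count_space A)" "emeasure \<mu> A < \<infinity>" and "0 < r"
  shows "\<exists>B\<subseteq>A. finite B \<and> B \<noteq> {} \<and> measure \<mu> (A - B) \<le> r"
proof -
  let ?B = "\<lambda>n. from_nat_into A ` {..n}"
  have BA: "?B n \<subseteq> A" for n using from_nat_into[OF A(2)] by auto
  have "(\<lambda>n. measure \<mu> (A - ?B n)) \<longlonglongrightarrow> measure \<mu> (\<Inter>n. A - ?B n)"
  proof (rule Lim_measure_decseq)
    show "decseq (\<lambda>n. A - ?B n)" by (auto simp: decseq_def)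
    show "emeasure \<mu> (A - ?B n) \<noteq> \<infinity>" for n
      using emeasure_mono[of "A - ?B n" A \<mu>] \<mu> by (auto simp: top_unique)
  qed (auto simp: \<mu>)
  moreover have "(\<Inter>n. A - ?B n) = {}"
    using from_nat_into_surj[OF A(1)] by fastforce
  ultimately have "(\<lambda>n. measure \<mu> (A - ?B n)) \<longlonglongrightarrow> 0" by (simp only: measure_empty)
  then have "\<forall>\<^sub>F n in sequentially. measure \<mu> (A - ?B n) < r"
    using \<open>0 < r\<close> by (rule order_tendstoD(2))
  then obtain n where "measure \<mu> (A - ?B n) < r" by (auto simp: eventually_sequentially)
  then show ?thesis using BA[of n] by (intro exI[of _ "?B n"]) auto
qed

text \<open>The size is the least cardinality of a suitable set. It is antimonotone because a set
  good for \<open>r\<close> is good for every larger \<open>s\<close>, and bounded for a finite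
  alphabet because the whole alphabet is always good. Sets are nonempty so that the size is at least
  \<open>1\<close> and a letter can be found by averaging.\<close>

lemma exists_alphabet_size:
  assumes A: "countable A" "A \<noteq> {}" and \<mu>: "sets \<mu> = sets (count_space A)" "emeasure \<mu> A < \<infinity>"
  obtains \<kappa> :: "real \<Rightarrow> real" where
    "\<And>r. 0 < r \<Longrightarrow> 1 \<le> \<kappa> r" "\<And>r s. 0 < r \<Longrightarrow> r \<le> s \<Longrightarrow> \<kappa> s \<le> \<kappa> r"
    "\<And>r. 0 < r \<Longrightarrow> \<exists>B\<subseteq>A. finite B \<and> B \<noteq> {} \<and> real (card B) \<le> \<kappa> r \<and> measure \<mu> (A - B) \<le> r / 2"
    "finite A \<Longrightarrow> (\<And>r. 0 < r \<Longrightarrow> \<kappa> r \<le> real (card A))"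
proof -
  let ?Q = "\<lambda>r k. \<exists>B\<subseteq>A. finite B \<and> B \<noteq> {} \<and> card B \<le> k \<and> measure \<mu> (A - B) \<le> r / 2"
  define k where "k r = (LEAST k. ?Q r k)" for r :: real
  have Q: "?Q r (k r)" if r: "0 < r" for r
  proof -
    from r have "0 < r / 2" by simp
    from finite_approximation[OF A \<mu> this] obtain B where "B \<subseteq> A" "finite B" "B \<noteq> {}" "measure \<mu> (A - B) \<le> r / 2"
      by blast
    then have "?Q r (card B)" by blast
    then show ?thesis unfolding k_def by (rule LeastI)
  qed
  show ?thesis
  proof
    show "1 \<le> real (k r)" if "0 < r" for r
    proof -
      from Q[OF that] obtain B where "B \<subseteq> A" "finite B" "B \<noteq> {}" "card B \<le> k r" by blast
      then have "card B \<noteq> 0" by simp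
      with \<open>card B \<le> k r\<close> show ?thesis by linarith
    qed
    show "real (k s) \<le> real (k r)" if "0 < r" "r \<le> s" for r s
    proof -
      from Q[OF \<open>0 < r\<close>] obtain B where "B \<subseteq> A" "finite B" "B \<noteq> {}" "card B \<le> k r" "measure \<mu> (A - B) \<le> r / 2" by blast
      moreover from this that have "measure \<mu> (A - B) \<le> s / 2" by linarith
      ultimately have "?Q s (k r)" by blast
      then have "k s \<le> k r" unfolding k_def[of s] by (rule Least_le)
      then show ?thesis by simp
    qed
    show "\<exists>B\<subseteq>A. finite B \<and> B \<noteq> {} \<and> real (card B) \<le> real (k r) \<and> measure \<mu> (A - B) \<le> r / 2" if "0 < r" for r
      using Q[OF that] by simp
    show "real (k r) \<le> real (card A)" if "finite A" "0 < r" for r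
    proof -
      have "?Q r (card A)" using that A by (intro exI[of _ A]) auto
      then have "k r \<le> card A" unfolding k_def by (rule Least_le)
      then show ?thesis by simp
    qed
  qed
qed

text \<open>The fallback matters: selected letters must lie in the alphabet for every sequence,
  whereas a letter with enough residual mass is guaranteed only after almost every past.\<close>

definition pick :: "'a set \<Rightarrow> ('a \<Rightarrow> bool) \<Rightarrow> 'a" where
  "pick A p = (if \<exists>a\<in>A. p a then SOME a. a \<in> A \<and> p a else SOME a. a \<in> A)"

lemma pick_in: "A \<noteq> {} \<Longrightarrow> pick A p \<in> A"
  unfolding pick_def by (auto intro: someI2 simp: some_in_eq)

lemma pick_satisfies: "a \<in> A \<Longrightarrow> p a \<Longrightarrow> p (pick A p)"
  unfolding pick_def by (auto intro: someI2)

text \<open>\<open>C n a x\<close> stands for the probability of the letter \<open>a\<close> given that the last \<open>n\<close> letters are as in \<open>x\<close>.\<close>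

locale greedy =
  fixes A :: "'a set" and C :: "nat \<Rightarrow> 'a \<Rightarrow> (int \<Rightarrow> 'a) \<Rightarrow> real"
    and q :: "nat \<Rightarrow> real" and c :: "nat \<Rightarrow> real"
  assumes A_nonempty: "A \<noteq> {}"
    and C_window: "depends_on {- int n..<0} (C n a)"
begin

text \<open>The mass already promised to each letter. The next choice looks at residual masses,
  which depend on the earlier choices, so it is written out inside the recursion and named
  \<open>select\<close> afterwards.\<close>

primrec used :: "nat \<Rightarrow> (int \<Rightarrow> 'a) \<Rightarrow> 'a \<Rightarrow> real" where
  "used 0 x a = 0"
| "used (Suc n) x a = used n x a + q n * of_bool (pick A (\<lambda>b. c n \<le> C (Suc n) b x - used n x b) = a)"

definition select :: "nat \<Rightarrow> (int \<Rightarrow> 'a) \<Rightarrow> 'a" where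
  "select n x = pick A (\<lambda>b. c n \<le> C (Suc n) b x - used n x b)"

lemma used_eq: "used n x a = (\<Sum>m<n. q m * of_bool (select m x = a))"
  by (induction n) (simp_all add: select_def)

lemma select_in: "select n x \<in> A"
  unfolding select_def by (rule pick_in[OF A_nonempty])

lemma used_cong: "(\<And>i. i \<in> {- int n..<0} \<Longrightarrow> x i = y i) \<Longrightarrow> used n x = used n y"
proof (induction n)
  case (Suc n)
  have "used n x = used n y" by (rule Suc.IH) (use Suc.prems in auto)
  moreover have "C (Suc n) b x = C (Suc n) b y" for b by (rule depends_onD[OF C_window]) (rule Suc.prems)
  ultimately show ?case by (simp add: fun_eq_iff)
qed (simp add: fun_eq_iff)

lemma select_window: "depends_on {- int (Suc n)..<0} (select n)"
proof (rule depends_onI)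
  fix x y :: "int \<Rightarrow> 'a" assume *: "\<And>i. i \<in> {- int (Suc n)..<0} \<Longrightarrow> x i = y i"
  have "used n x = used n y" by (rule used_cong) (use * in auto)
  moreover have "C (Suc n) b x = C (Suc n) b y" for b by (rule depends_onD[OF C_window *])
  ultimately show "select n x = select n y" by (simp add: select_def)
qed

text \<open>The letters of \<open>B\<close> together have been promised at most the mass spent so
  far. By averaging, one of them has residual mass at least \<open>c n\<close> with respect to
  \<open>C (Suc n)\<close>, hence so has the selected letter. Passing from \<open>C (Suc n)\<close>
  to \<open>p\<close> costs at most \<open>v (Suc n)\<close>, so \<open>q n\<close> still
  fits.\<close>

lemma used_le:
  assumes p: "\<And>a. a \<in> A \<Longrightarrow> 0 \<le> p a"
    and close: "\<And>n a. a \<in> A \<Longrightarrow> \<bar>C n a x - p a\<bar> \<le> v n"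
    and q: "\<And>n. q n = max 0 (c n - v (Suc n))"
    and avail: "\<And>n. \<exists>B\<subseteq>A. finite B \<and> B \<noteq> {} \<and> real (card B) * c n \<le> (\<Sum>b\<in>B. C (Suc n) b x) - (\<Sum>m<n. q m)"
    and "a \<in> A"
  shows "used n x a \<le> p a"
  using \<open>a \<in> A\<close>
proof (induction n arbitrary: a)
  case 0
  then show ?case using p by simp
next
  case (Suc n)
  obtain B where B: "B \<subseteq> A" "finite B" "B \<noteq> {}"
    and card: "real (card B) * c n \<le> (\<Sum>b\<in>B. C (Suc n) b x) - (\<Sum>m<n. q m)"
    using avail by blast
  have "(\<Sum>b\<in>B. used n x b) = (\<Sum>m<n. q m * (\<Sum>b\<in>B. of_bool (select m x = b)))"
    unfolding used_eq sum_distrib_left by (rule sum.swap)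
  also have "\<dots> \<le> (\<Sum>m<n. q m * 1)"
  proof (intro sum_mono mult_left_mono)
    fix m
    show "(\<Sum>b\<in>B. of_bool (select m x = b)) \<le> (1 :: real)"
      using B(2) by (simp add: of_bool_def sum.delta)
    show "0 \<le> q m" by (simp add: q)
  qed
  finally have "(\<Sum>b\<in>B. c n) \<le> (\<Sum>b\<in>B. C (Suc n) b x - used n x b)"
    using card by (simp add: sum_subtractf)
  then have "\<exists>b\<in>B. c n \<le> C (Suc n) b x - used n x b"
    using sum_strict_mono[OF B(2,3), of "\<lambda>b. C (Suc n) b x - used n x b" "\<lambda>_. c n"] by force
  then obtain b where "b \<in> A" "c n \<le> C (Suc n) b x - used n x b" using B(1) by blast
  then have sel: "c n \<le> C (Suc n) (select n x) x - used n x (select n x)"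
    unfolding select_def by (rule pick_satisfies)
  show ?case
  proof (cases "select n x = a")
    \<comment> \<open>If \<open>q n\<close> was cut off at \<open>0\<close>, nothing is added and
      the induction hypothesis suffices; otherwise \<open>q n = c n - v (Suc n)\<close>, which fits
      into the residual mass.\<close>
    case True
    then show ?thesis
      using sel Suc.IH[OF Suc.prems] close[OF Suc.prems, of "Suc n"] q[of n]
      by (auto simp: select_def[symmetric] max_def abs_le_iff)
  next
    case False
    then show ?thesis using Suc.IH[OF Suc.prems] by (simp add: select_def[symmetric])
  qed
qed

end

section \<open>Conditioning on a variable with countably many values\<close>

lemma AE_atom_pos:
  assumes "prob_space M" and T: "T \<in> M \<rightarrow>\<^sub>M count_space C" and "countable C"
  shows "AE w in M. 0 < measure M {w' \<in> space M. T w' = T w}"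
proof -
  interpret prob_space M by fact
  have S: "{w \<in> space M. T w = u} \<in> sets M" if "u \<in> C" for u
  proof -
    have "T -` {u} \<inter> space M \<in> sets M" by (rule measurable_sets[OF T]) (use that in auto)
    then show ?thesis by (simp add: vimage_def Int_def conj_commute)
  qed
  have "AE w in M. \<forall>u\<in>C. measure M {w' \<in> space M. T w' = u} = 0 \<longrightarrow> T w \<noteq> u"
    unfolding AE_ball_countable[OF \<open>countable C\<close>]
  proof
    fix u assume u: "u \<in> C"
    show "AE w in M. measure M {w' \<in> space M. T w' = u} = 0 \<longrightarrow> T w \<noteq> u"
    proof (cases "measure M {w' \<in> space M. T w' = u} = 0")
      case True
      then have "{w' \<in> space M. T w' = u} \<in> null_sets M"
        using S[OF u] by (auto simp: emeasure_eq_measure)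
      from AE_not_in[OF this] show ?thesis using AE_space by eventually_elim auto
    qed simp
  qed
  then show ?thesis using AE_space
    by eventually_elim (use measurable_space[OF T] in \<open>auto simp: zero_less_measure_iff measure_nonneg less_le\<close>)
qed

text \<open>A version of the conditional probability is constant on the set where \<open>T\<close>
  equals \<open>T x\<close>, and integrating it over this set gives the elementary formula. The
  product form also covers null sets.\<close>

lemma cond_pr_atom:
  assumes "prob_space M" and T: "T \<in> M \<rightarrow>\<^sub>M N" and "{T x} \<in> sets N" and x: "x \<in> space M"
    and Y: "{w \<in> space M. Y w \<in> E} \<in> sets M"
  shows "cond_pr M (vimage_algebra (space M) T N) Y E x * measure M {w \<in> space M. T w = T x}
    = measure M ({w \<in> space M. Y w \<in> E} \<inter> {w \<in> space M. T w = T x})"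
proof -
  interpret prob_space M by fact
  let ?F = "vimage_algebra (space M) T N" and ?D = "{w \<in> space M. T w = T x}" and ?f = "cond_pr M (vimage_algebra (space M) T N) Y E"
  have sub: "subalgebra M ?F"
    using T unfolding subalgebra_def by (auto simp: measurable_iff_sets)
  interpret finite_measure_subalgebra M ?F by unfold_locales (rule sub)
  have "T -` {T x} \<inter> space M \<in> sets ?F" by (rule in_vimage_algebra[OF assms(3)])
  then have D: "?D \<in> sets ?F" by (simp add: vimage_def Int_def conj_commute)
  then have DM: "?D \<in> sets M" using sub by (auto simp: subalgebra_def)
  have T': "T \<in> space M \<rightarrow> space N" using measurable_space[OF T] by auto
  have const: "?f w = ?f x" if "w \<in> ?D" for w
    by (rule borel_measurable_vimage_algebra_const[OF _ T']) (use that x in \<open>auto simp: cond_pr_def\<close>)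
  have int: "integrable M (indicator {w \<in> space M. Y w \<in> E} :: _ \<Rightarrow> real)"
    using Y by (intro integrable_real_indicator) (auto simp: emeasure_eq_measure)
  have "measure M ({w \<in> space M. Y w \<in> E} \<inter> ?D) = (\<integral>w\<in>?D. indicator {w \<in> space M. Y w \<in> E} w \<partial>M)"
    unfolding set_lebesgue_integral_def
    using Y DM by (simp add: indicator_inter_arith[symmetric] Int_commute)
  also have "\<dots> = (\<integral>w\<in>?D. ?f w \<partial>M)"
    unfolding cond_pr_def by (rule real_cond_exp_intA[OF int D])
  also have "\<dots> = (\<integral>w\<in>?D. ?f x \<partial>M)"
    unfolding set_lebesgue_integral_def by (rule Bochner_Integration.integral_cong) (auto simp: const split: split_indicator)
  also have "\<dots> = measure M ?D * ?f x"
    unfolding set_lebesgue_integral_def using DM by (simp add: emeasure_eq_measure)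
  finally show ?thesis by (simp add: mult.commute)
qed

lemma cond_pr_bounds:
  assumes "prob_space M" "subalgebra M F" "{w \<in> space M. Y w \<in> E} \<in> sets M"
  shows "AE w in M. 0 \<le> cond_pr M F Y E w \<and> cond_pr M F Y E w \<le> 1"
proof -
  interpret prob_space M by fact
  interpret finite_measure_subalgebra M F by unfold_locales fact
  have int: "integrable M (indicator {w \<in> space M. Y w \<in> E} :: _ \<Rightarrow> real)"
    using assms(3) by (intro integrable_real_indicator) (auto simp: emeasure_eq_measure)
  have "AE w in M. real_cond_exp M F (indicator {w \<in> space M. Y w \<in> E}) w \<ge> 0"
    by (rule real_cond_exp_ge_c[OF int]) auto
  moreover have "AE w in M. real_cond_exp M F (indicator {w \<in> space M. Y w \<in> E}) w \<le> 1"
    by (rule real_cond_exp_le_c[OF int]) (auto split: split_indicator)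
  ultimately show ?thesis unfolding cond_pr_def by eventually_elim auto
qed

section \<open>Conditional probabilities of a stationary process\<close>

locale letter_process =
  fixes A :: "'a set" and M :: "'w measure" and X :: "int \<Rightarrow> 'w \<Rightarrow> 'a"
  assumes countable_A: "countable A" and stationary: "stationary_process A M X"
begin

sublocale prob_space M
  using stationary by (simp add: stationary_process_def)

lemma measurable_X [measurable]: "X i \<in> M \<rightarrow>\<^sub>M count_space A"
  using stationary by (simp add: stationary_process_def)

lemma A_nonempty: "A \<noteq> {}"
  using measurable_space[OF measurable_X] not_empty by fastforce

definition path :: "'w \<Rightarrow> int \<Rightarrow> 'a" where
  "path w = (\<lambda>i. X i w)"

lemma measurable_path [measurable]: "path \<in> M \<rightarrow>\<^sub>M path_space A"
  unfolding path_def by (rule measurable_into_path_space) measurable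

abbreviation past :: "'w measure" where
  "past \<equiv> window_algebra A M X {..<0}"

abbreviation window :: "nat \<Rightarrow> 'w measure" where
  "window n \<equiv> window_algebra A M X {- int n..<0}"

lemma subalgebra_window: "subalgebra M (window_algebra A M X I)"
  by (rule subalgebra_window_algebra) measurable

lemma letter_event [measurable]: "B \<subseteq> A \<Longrightarrow> {w \<in> space M. X i w \<in> B} \<in> sets M"
proof -
  assume "B \<subseteq> A"
  then have "X i -` B \<inter> space M \<in> sets M" by (intro measurable_sets[OF measurable_X]) auto
  then show ?thesis by (simp add: vimage_def Int_def conj_commute)
qed

definition cylinder :: "nat \<Rightarrow> (int \<Rightarrow> 'a) \<Rightarrow> 'w set" where
  "cylinder n x = {w \<in> space M. \<forall>j\<in>{- int n..<0}. X j w = x j}"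

text \<open>Elementary conditional probabilities, with value \<open>0\<close> on null cylinders by
  division by zero. Unlike versions of \<open>cond_pr\<close>, they are functions of the letter
  sequence itself and defined everywhere, as the greedy choice requires.\<close>

definition transition :: "nat \<Rightarrow> 'a set \<Rightarrow> (int \<Rightarrow> 'a) \<Rightarrow> real" where
  "transition n B x = measure M ({w \<in> space M. X 0 w \<in> B} \<inter> cylinder n x) / measure M (cylinder n x)"

lemma cylinder_past: "cylinder n x \<in> sets past"
proof -
  let ?f = "\<lambda>y. \<forall>j\<in>{- int n..<0}. y j = x j"
  have dep: "depends_on {- int n..<0} ?f" by (rule depends_onI) auto
  have m: "?f \<in> path_space A \<rightarrow>\<^sub>M count_space UNIV"
    by (rule measurable_finite_window[OF _ countable_A A_nonempty dep]) auto
  have "(\<lambda>w. ?f (\<lambda>i. X i w)) \<in> past \<rightarrow>\<^sub>M count_space UNIV"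
    by (rule measurable_window_algebra[OF measurable_X m depends_on_mono[OF dep] A_nonempty]) auto
  then have "(\<lambda>w. ?f (\<lambda>i. X i w)) -` {True} \<inter> space past \<in> sets past"
    by (rule measurable_sets) auto
  moreover have "space past = space M" by (simp add: window_algebra_def)
  ultimately show ?thesis by (simp add: cylinder_def vimage_def Int_def conj_commute)
qed

lemma cylinder_sets [measurable]: "cylinder n x \<in> sets M"
  using cylinder_past[of n x] subalgebra_window[of "{..<0}"] by (auto simp: subalgebra_def)

lemma transition_window: "depends_on {- int n..<0} (transition n B)"
proof (rule depends_onI)
  fix x y :: "int \<Rightarrow> 'a" assume "\<And>i. i \<in> {- int n..<0} \<Longrightarrow> x i = y i"
  then have "cylinder n x = cylinder n y" by (auto simp: cylinder_def)
  then show "transition n B x = transition n B y" by (simp add: transition_def)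
qed

lemma window_count_space:
  "Pi\<^sub>M {- int n..<0} (\<lambda>_. count_space A) = count_space (PiE {- int n..<0} (\<lambda>_. A))"
  by (rule count_space_PiM_finite) (auto simp: countable_A)

lemma cylinder_path: "cylinder n (path w) = {w' \<in> space M. (\<lambda>i\<in>{- int n..<0}. X i w') = (\<lambda>i\<in>{- int n..<0}. X i w)}"
  by (auto simp: cylinder_def path_def fun_eq_iff restrict_def)

lemma measurable_window_map: "(\<lambda>w. \<lambda>i\<in>I. X i w) \<in> M \<rightarrow>\<^sub>M Pi\<^sub>M I (\<lambda>_. count_space A)"
  by measurable

lemma AE_cylinder_pos: "AE w in M. \<forall>n. 0 < measure M (cylinder n (path w))"
  unfolding AE_all_countable
proof
  fix n
  have "countable (PiE {- int n..<0} (\<lambda>_. A))" by (rule countable_PiE) (auto simp: countable_A)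
  moreover have "(\<lambda>w. \<lambda>i\<in>{- int n..<0}. X i w) \<in> M \<rightarrow>\<^sub>M count_space (PiE {- int n..<0} (\<lambda>_. A))"
    using measurable_window_map[of "{- int n..<0}"] by (simp only: window_count_space)
  ultimately show "AE w in M. 0 < measure M (cylinder n (path w))"
    unfolding cylinder_path by (intro AE_atom_pos prob_space_axioms)
qed

lemma cond_pr_window:
  "AE w in M. \<forall>n. \<forall>a\<in>A. cond_pr M (window n) (X 0) {a} w = transition n {a} (path w)"
  using AE_cylinder_pos AE_space
proof eventually_elim
  fix w assume pos: "\<forall>n. 0 < measure M (cylinder n (path w))" and w: "w \<in> space M"
  show "\<forall>n. \<forall>a\<in>A. cond_pr M (window n) (X 0) {a} w = transition n {a} (path w)"
  proof (intro allI ballI)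
    fix n a assume a: "a \<in> A"
    have "cond_pr M (window n) (X 0) {a} w * measure M (cylinder n (path w))
        = measure M ({w \<in> space M. X 0 w \<in> {a}} \<inter> cylinder n (path w))"
      unfolding window_algebra_def cylinder_path
    proof (rule cond_pr_atom[OF prob_space_axioms measurable_window_map _ w])
      show "{\<lambda>i\<in>{- int n..<0}. X i w} \<in> sets (Pi\<^sub>M {- int n..<0} (\<lambda>_. count_space A))"
        unfolding window_count_space using measurable_space[OF measurable_X w] by auto
    qed (use a in \<open>auto intro!: letter_event\<close>)
    then show "cond_pr M (window n) (X 0) {a} w = transition n {a} (path w)"
      using pos by (simp add: transition_def eq_divide_eq less_imp_neq[THEN not_sym])
  qed
qed

lemma transition_finite_sum:
  assumes "finite B" "B \<subseteq> A"
  shows "(\<Sum>b\<in>B. transition n {b} x) = transition n B x"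
proof -
  have "(\<Sum>b\<in>B. measure M ({w \<in> space M. X 0 w \<in> {b}} \<inter> cylinder n x))
      = measure M (\<Union>b\<in>B. {w \<in> space M. X 0 w \<in> {b}} \<inter> cylinder n x)"
  proof (rule finite_measure_finite_Union[symmetric, OF assms(1)])
    show "(\<lambda>b. {w \<in> space M. X 0 w \<in> {b}} \<inter> cylinder n x) ` B \<subseteq> events"
      using assms letter_event[of "{b}" 0 for b] by (auto intro!: sets.Int letter_event)
  qed (auto simp: disjoint_family_on_def)
  also have "(\<Union>b\<in>B. {w \<in> space M. X 0 w \<in> {b}} \<inter> cylinder n x) = {w \<in> space M. X 0 w \<in> B} \<inter> cylinder n x"
    by auto
  finally show ?thesis by (simp add: transition_def sum_divide_distrib[symmetric])
qed

text \<open>A cylinder is a past event, so the dominating measure bounds the conditional probability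
  of the letters outside \<open>B\<close>, uniformly over all windows of positive
  probability.\<close>

lemma transition_lower_bound:
  assumes dom: "finite_dominating_measure A M X \<mu>" and pos: "0 < measure M (cylinder n x)" and B: "B \<subseteq> A"
  shows "1 - measure \<mu> (A - B) \<le> transition n B x"
proof -
  let ?S = "\<lambda>B. {w \<in> space M. X 0 w \<in> B} \<inter> cylinder n x"
  have "cylinder n x \<subseteq> space M" by (auto simp: cylinder_def)
  then have sub: "{w \<in> space M. X 0 w \<in> A - B \<and> w \<in> cylinder n x} = ?S (A - B)" "{w \<in> space M. w \<in> cylinder n x} = cylinder n x"
    by auto
  have "\<P>(w in M. X 0 w \<in> A - B \<bar> w \<in> cylinder n x) \<le> measure \<mu> (A - B)"
    using dom cylinder_past pos unfolding finite_dominating_measure_def by blast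
  then have le: "measure M (?S (A - B)) / measure M (cylinder n x) \<le> measure \<mu> (A - B)"
    unfolding cond_prob_def sub .
  have "cylinder n x = ?S B \<union> ?S (A - B)"
    using measurable_space[OF measurable_X[of 0]] by (auto simp: cylinder_def)
  moreover have "measure M (?S B \<union> ?S (A - B)) = measure M (?S B) + measure M (?S (A - B))"
    by (rule finite_measure_Union) (use B in \<open>auto intro!: sets.Int letter_event\<close>)
  ultimately have "measure M (cylinder n x) = measure M (?S B) + measure M (?S (A - B))" by simp
  then have "transition n B x + measure M (?S (A - B)) / measure M (cylinder n x) = 1"
    using pos by (simp add: transition_def add_divide_distrib[symmetric])
  then show ?thesis using le by linarith
qed

section \<open>The variation as a real error bound\<close>

definition var :: "nat \<Rightarrow> real" where
  "var n = enn2real (variation A M X n)"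

lemma cond_pr_01:
  assumes "a \<in> A"
  shows "AE w in M. 0 \<le> cond_pr M (window_algebra A M X I) (X 0) {a} w \<and> cond_pr M (window_algebra A M X I) (X 0) {a} w \<le> 1"
  by (rule cond_pr_bounds[OF prob_space_axioms subalgebra_window]) (use assms in \<open>auto intro!: letter_event\<close>)

lemma measurable_cond_pr [measurable]: "cond_pr M (window_algebra A M X I) (X 0) E \<in> borel_measurable M"
  unfolding cond_pr_def by simp

lemma variation_leI:
  assumes "\<And>a. a \<in> A \<Longrightarrow> AE w in M. \<bar>cond_pr M (window k) (X 0) {a} w - cond_pr M past (X 0) {a} w\<bar> \<le> t"
  shows "variation A M X k \<le> ennreal t"
  unfolding variation_def
proof (rule SUP_least, rule esssup_I)
  fix a assume "a \<in> A"
  from assms[OF this] show "AE w in M. ennreal \<bar>cond_pr M (window k) (X 0) {a} w - cond_pr M past (X 0) {a} w\<bar> \<le> ennreal t"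
    by eventually_elim (rule ennreal_leI)
qed measurable

lemma variation_le_1: "variation A M X n \<le> 1"
  unfolding ennreal_1[symmetric]
proof (rule variation_leI)
  fix a assume "a \<in> A"
  from cond_pr_01[OF this, of "{- int n..<0}"] cond_pr_01[OF this, of "{..<0}"]
  show "AE w in M. \<bar>cond_pr M (window n) (X 0) {a} w - cond_pr M past (X 0) {a} w\<bar> \<le> 1"
    by eventually_elim linarith
qed

lemma ennreal_var: "ennreal (var n) = variation A M X n"
  unfolding var_def using variation_le_1[of n] by (intro ennreal_enn2real) (auto simp: less_top[symmetric] top_unique)

lemma var_nonneg: "0 \<le> var n"
  by (simp add: var_def)

text \<open>One null set serves all \<open>n\<close> and \<open>a\<close>, because the alphabet is
  countable. The greedy recursion needs this, as it compares all windows and letters along a single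
  path.\<close>

lemma transition_close:
  "AE w in M. \<forall>n. \<forall>a\<in>A. \<bar>transition n {a} (path w) - cond_pr M past (X 0) {a} w\<bar> \<le> var n"
proof -
  have "AE w in M. \<bar>cond_pr M (window n) (X 0) {a} w - cond_pr M past (X 0) {a} w\<bar> \<le> var n" if a: "a \<in> A" for n a
  proof -
    let ?f = "\<lambda>w. ennreal \<bar>cond_pr M (window n) (X 0) {a} w - cond_pr M past (X 0) {a} w\<bar>"
    have "esssup M ?f \<le> ennreal (var n)"
      unfolding ennreal_var variation_def by (rule SUP_upper[OF a])
    then show ?thesis
      using esssup_AE[of ?f M] by (auto elim!: eventually_mono simp: var_nonneg dest: order_trans)
  qed
  then have "AE w in M. \<forall>n. \<forall>a\<in>A. \<bar>cond_pr M (window n) (X 0) {a} w - cond_pr M past (X 0) {a} w\<bar> \<le> var n"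
    unfolding AE_all_countable AE_ball_countable[OF countable_A] by blast
  then show ?thesis using cond_pr_window by eventually_elim simp
qed

text \<open>A supremum of reals bounds its members only if they are bounded above; total mass
  \<open>1\<close> ensures this.\<close>

lemma tv_dist_ge:
  assumes "measure \<mu> A = 1" "measure \<nu> A = 1" "sets \<mu> = Pow A" "sets \<nu> = Pow A" "E \<subseteq> A"
  shows "\<bar>measure \<mu> E - measure \<nu> E\<bar> \<le> tv_dist \<mu> \<nu>"
  unfolding tv_dist_def
proof (rule cSUP_upper)
  have le: "measure \<rho> D \<le> 1" if "measure \<rho> A = 1" "sets \<rho> = Pow A" "D \<subseteq> A" for \<rho> D
  proof -
    have "emeasure \<rho> A \<noteq> \<infinity>" using that(1) by (auto simp: measure_def)
    then have "measure \<rho> D \<le> measure \<rho> A"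
      using that by (intro measure_mono_fmeasurable) (auto simp: fmeasurable_def less_top)
    then show ?thesis using that by simp
  qed
  show "bdd_above ((\<lambda>E. \<bar>measure \<mu> E - measure \<nu> E\<bar>) ` sets \<mu>)"
  proof (rule bdd_aboveI2)
    fix D assume "D \<in> sets \<mu>"
    then have "measure \<mu> D \<le> 1" "measure \<nu> D \<le> 1" using le[of _ D] assms by auto
    then show "\<bar>measure \<mu> D - measure \<nu> D\<bar> \<le> 1" using measure_nonneg[of \<mu> D] measure_nonneg[of \<nu> D] by linarith
  qed
qed (use assms in auto)

lemma var_LIMSEQ:
  assumes "uniform_martingale A M X"
  shows "var \<longlonglongrightarrow> 0"
proof (rule LIMSEQ_I)
  fix \<epsilon> :: real assume "0 < \<epsilon>"
  \<comment> \<open>Quantities below \<open>\<epsilon> / 2\<close> have an essential supremum that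
    is only at most \<open>\<epsilon> / 2\<close>; halving restores the strict inequality.\<close>
  then have "0 < \<epsilon> / 2" by simp
  with assms obtain N where N: "\<And>n. n \<ge> N \<Longrightarrow> AE w in M.
      tv_dist (cond_law A M past (X 0) w) (cond_law A M (window n) (X 0) w) < \<epsilon> / 2"
    unfolding uniform_martingale_def by blast
  have law: "AE w in M. measure (cond_law A M (window_algebra A M X I) (X 0) w) E = cond_pr M (window_algebra A M X I) (X 0) E w"
    if "E \<subseteq> A" for I E
    by (rule measure_cond_law[OF prob_space_axioms subalgebra_window countable_A measurable_X that])
  have one: "AE w in M. cond_pr M (window_algebra A M X I) (X 0) A w = 1" for I
  proof -
    interpret F: finite_measure_subalgebra M "window_algebra A M X I" by unfold_locales (rule subalgebra_window)
    have "{w \<in> space M. X 0 w \<in> A} = space M" using measurable_space[OF measurable_X] by auto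
    moreover have "AE w in M. real_cond_exp M (window_algebra A M X I) (indicator (space M)) w = indicator (space M) w"
    proof (rule F.real_cond_exp_F_meas)
      have "space M \<in> sets (window_algebra A M X I)"
        using sets.top[of "window_algebra A M X I"] by (simp add: window_algebra_def)
      then show "indicator (space M) \<in> borel_measurable (window_algebra A M X I)" by simp
    qed (auto intro!: integrable_real_indicator simp: emeasure_eq_measure)
    ultimately show ?thesis unfolding cond_pr_def using AE_space by (auto elim!: eventually_elim2)
  qed
  have sets: "sets (cond_law A M F Y w) = Pow A" for F Y w
    by (simp add: cond_law_def sets_point_measure)
  have "var n \<le> \<epsilon> / 2" if "n \<ge> N" for n
  proof -
    have "variation A M X n \<le> ennreal (\<epsilon> / 2)"
    proof (rule variation_leI)
      fix a assume "a \<in> A"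
      then have a: "{a} \<subseteq> A" by simp
      show "AE w in M. \<bar>cond_pr M (window n) (X 0) {a} w - cond_pr M past (X 0) {a} w\<bar> \<le> \<epsilon> / 2"
        using N[OF that] law[OF a, of "{..<0}"] law[OF a, of "{- int n..<0}"]
          law[OF order_refl, of "{..<0}"] law[OF order_refl, of "{- int n..<0}"] one[of "{..<0}"] one[of "{- int n..<0}"]
      proof eventually_elim
        fix w assume *: "tv_dist (cond_law A M past (X 0) w) (cond_law A M (window n) (X 0) w) < \<epsilon> / 2"
          "measure (cond_law A M past (X 0) w) {a} = cond_pr M past (X 0) {a} w"
          "measure (cond_law A M (window n) (X 0) w) {a} = cond_pr M (window n) (X 0) {a} w"
          "measure (cond_law A M past (X 0) w) A = cond_pr M past (X 0) A w"
          "measure (cond_law A M (window n) (X 0) w) A = cond_pr M (window n) (X 0) A w"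
          "cond_pr M past (X 0) A w = 1" "cond_pr M (window n) (X 0) A w = 1"
        then show "\<bar>cond_pr M (window n) (X 0) {a} w - cond_pr M past (X 0) {a} w\<bar> \<le> \<epsilon> / 2"
          using tv_dist_ge[of "cond_law A M past (X 0) w" "cond_law A M (window n) (X 0) w" "{a}"] a
          by (simp add: sets abs_minus_commute)
      qed
    qed
    then show ?thesis unfolding ennreal_var[symmetric] using \<open>0 < \<epsilon> / 2\<close> by (simp add: ennreal_le_iff)
  qed
  then show "\<exists>N. \<forall>n\<ge>N. norm (var n - 0) < \<epsilon>"
    using \<open>0 < \<epsilon>\<close> var_nonneg by (intro exI[of _ N]) force
qed

text \<open>
  An inequality between the masses of single letters suffices, because both sides sum to \<open>1\<close> over the alphabet.
\<close>

lemma cond_pr_past_total: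
  assumes q: "\<And>m. 0 \<le> q m" "q sums 1" and g: "\<And>m x. g m x \<in> A" "\<And>m. depends_on {- int (Suc m)..<0} (g m)"
    and le: "AE w in M. \<forall>n. \<forall>a\<in>A. (\<Sum>m<n. q m * of_bool (g m (path w) = a)) \<le> cond_pr M past (X 0) {a} w"
    and a: "a \<in> A" and E: "E \<in> sets past"
  shows "emeasure M ({w \<in> space M. X 0 w = a} \<inter> E) = (\<integral>\<^sup>+w\<in>E. ennreal (\<Sum>m. q m * of_bool (g m (path w) = a)) \<partial>M)"
proof -
  interpret F: finite_measure_subalgebra M past by unfold_locales (rule subalgebra_window)
  have EM [measurable]: "E \<in> sets M" using E subalgebra_window[of "{..<0}"] by (auto simp: subalgebra_def)
  define t where "t a w = (\<Sum>m. q m * of_bool (g m (path w) = a))" for a w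
  have summ: "summable (\<lambda>m. q m * of_bool (g m x = a))" for a x
    by (rule summable_comparison_test[OF _ sums_summable[OF q(2)]]) (use q(1) in \<open>auto simp: of_bool_def\<close>)
  have g_eq [measurable]: "(\<lambda>w. of_bool (g m (path w) = a) :: real) \<in> borel_measurable M" for m a
    by (rule measurable_compose[OF measurable_path measurable_window_eq[OF _ countable_A A_nonempty g(2)]]) simp
  have tm [measurable]: "t a \<in> borel_measurable M" for a unfolding t_def by measurable
  define F G where "F a = (\<integral>\<^sup>+w\<in>E. ennreal (t a w) \<partial>M)" and "G a = emeasure M ({w \<in> space M. X 0 w \<in> {a}} \<inter> E)" for a
  have FG: "F a \<le> G a" if a: "a \<in> A" for a
  proof -
    let ?p = "cond_pr M past (X 0) {a}"
    have S: "{w \<in> space M. X 0 w \<in> {a}} \<in> sets M" using a by (intro letter_event) simp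
    have int: "integrable M (indicator {w \<in> space M. X 0 w \<in> {a}} :: _ \<Rightarrow> real)"
      using S by (intro integrable_real_indicator) (auto simp: emeasure_eq_measure)
    have intp: "integrable M ?p" unfolding cond_pr_def by (rule F.real_cond_exp_int(1)[OF int])
    have "AE w in M. t a w \<le> ?p w"
      using le
    proof eventually_elim
      fix w assume "\<forall>n. \<forall>a\<in>A. (\<Sum>m<n. q m * of_bool (g m (path w) = a)) \<le> cond_pr M past (X 0) {a} w"
      then show "t a w \<le> ?p w" unfolding t_def using a by (intro suminf_le_const[OF summ]) auto
    qed
    then have "F a \<le> (\<integral>\<^sup>+w\<in>E. ennreal (?p w) \<partial>M)"
      unfolding F_def by (intro nn_integral_mono_AE) (auto elim!: eventually_mono split: split_indicator intro: ennreal_leI)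
    also have "\<dots> = (\<integral>\<^sup>+w. ennreal (indicator E w * ?p w) \<partial>M)"
      by (intro nn_integral_cong) (auto split: split_indicator)
    also have "\<dots> = ennreal (\<integral>w. indicator E w * ?p w \<partial>M)"
      using cond_pr_01[OF a, of "{..<0}"] intp
      by (intro nn_integral_eq_integral) (auto intro!: integrable_real_mult_indicator simp: mult.commute[of "indicator E _"])
    also have "(\<integral>w. indicator E w * ?p w \<partial>M) = (\<integral>w\<in>E. indicator {w \<in> space M. X 0 w \<in> {a}} w \<partial>M)"
      using F.real_cond_exp_intA[OF int E] by (simp add: set_lebesgue_integral_def cond_pr_def)
    also have "\<dots> = measure M ({w \<in> space M. X 0 w \<in> {a}} \<inter> E)"
      unfolding set_lebesgue_integral_def using S by (simp add: indicator_inter_arith[symmetric] Int_commute)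
    finally show ?thesis by (simp add: G_def emeasure_eq_measure)
  qed
  have sumF: "(\<integral>\<^sup>+a. F a \<partial>count_space A) = emeasure M E"
  proof -
    have "(\<integral>\<^sup>+a. F a \<partial>count_space A) = (\<integral>\<^sup>+w. (\<integral>\<^sup>+a. ennreal (t a w) * indicator E w \<partial>count_space A) \<partial>M)"
      unfolding F_def by (rule nn_integral_count_space_nn_integral[symmetric]) (auto simp: countable_A)
    also have "\<dots> = (\<integral>\<^sup>+w. indicator E w \<partial>M)"
    proof (rule nn_integral_cong)
      fix w
      have "(\<integral>\<^sup>+a. ennreal (t a w) * indicator E w \<partial>count_space A)
          = (\<integral>\<^sup>+a. (\<Sum>m. ennreal (q m) * indicator {g m (path w)} a) * indicator E w \<partial>count_space A)"
      proof (rule nn_integral_cong)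
        fix a
        have "ennreal (t a w) = (\<Sum>m. ennreal (q m * of_bool (g m (path w) = a)))"
          unfolding t_def by (rule suminf_ennreal2[symmetric]) (use q(1) summ in auto)
        also have "\<dots> = (\<Sum>m. ennreal (q m) * indicator {g m (path w)} a)"
          by (intro suminf_cong) (auto split: split_indicator)
        finally show "ennreal (t a w) * indicator E w = (\<Sum>m. ennreal (q m) * indicator {g m (path w)} a) * indicator E w" by simp
      qed
      also have "\<dots> = (\<Sum>m. \<integral>\<^sup>+a. ennreal (q m) * indicator {g m (path w)} a \<partial>count_space A) * indicator E w"
        by (simp add: nn_integral_multc nn_integral_suminf)
      also have "(\<Sum>m. \<integral>\<^sup>+a. ennreal (q m) * indicator {g m (path w)} a \<partial>count_space A) = (\<Sum>m. ennreal (q m))"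
        using g(1) by (simp add: nn_integral_cmult_indicator)
      also have "\<dots> = 1" using q by (simp add: suminf_ennreal2 sums_summable sums_unique[symmetric])
      finally show "(\<integral>\<^sup>+a. ennreal (t a w) * indicator E w \<partial>count_space A) = indicator E w" by simp
    qed
    finally show ?thesis by simp
  qed
  have sumG: "(\<integral>\<^sup>+a. G a \<partial>count_space A) = emeasure M E"
  proof -
    have "(\<integral>\<^sup>+a. G a \<partial>count_space A) = emeasure M (\<Union>a\<in>A. {w \<in> space M. X 0 w \<in> {a}} \<inter> E)"
      unfolding G_def
    proof (rule emeasure_UN_countable[symmetric])
      show "{w \<in> space M. X 0 w \<in> {a}} \<inter> E \<in> events" if "a \<in> A" for a
        using that by (intro sets.Int letter_event EM) auto
    qed (auto simp: countable_A disjoint_family_on_def)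
    also have "(\<Union>a\<in>A. {w \<in> space M. X 0 w \<in> {a}} \<inter> E) = E"
      using measurable_space[OF measurable_X[of 0]] sets.sets_into_space[OF EM] by auto
    finally show ?thesis .
  qed
  \<comment> \<open>The common sum is finite, so the sums may be subtracted; a vanishing sum of
    nonnegative differences vanishes termwise.\<close>
  have "(\<integral>\<^sup>+a. G a - F a \<partial>count_space A) = (\<integral>\<^sup>+a. G a \<partial>count_space A) - (\<integral>\<^sup>+a. F a \<partial>count_space A)"
    by (rule nn_integral_diff) (use FG in \<open>auto simp: sumF AE_count_space\<close>)
  also have "\<dots> = 0" by (simp add: sumF sumG)
  finally have "AE a in count_space A. G a - F a = 0"
    by (subst (asm) nn_integral_0_iff_AE) auto
  then have "G a \<le> F a" using a by (simp add: AE_count_space diff_eq_0_iff_ennreal)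
  then have "G a = F a" using FG[OF a] by simp
  then show ?thesis by (simp add: F_def G_def t_def)
qed

text \<open>The clause on summability is carried along because only inside this proof is it visible
  that the mass unassigned after \<open>n\<close> steps is the budget \<open>R n\<close>.\<close>

lemma exists_lookback_law:
  fixes \<kappa> :: "real \<Rightarrow> real"
  assumes um: "uniform_martingale A M X" and dom: "finite_dominating_measure A M X \<mu>"
    and \<kappa>: "\<And>r. 0 < r \<Longrightarrow> 1 \<le> \<kappa> r" "\<And>r s. 0 < r \<Longrightarrow> r \<le> s \<Longrightarrow> \<kappa> s \<le> \<kappa> r"
    and B: "\<And>r. 0 < r \<Longrightarrow> \<exists>B\<subseteq>A. finite B \<and> B \<noteq> {} \<and> real (card B) \<le> \<kappa> r \<and> measure \<mu> (A - B) \<le> r / 2"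
  shows "\<exists>q g. lookback_law A (distr M (path_space A) path) q g \<and>
    ((\<exists>d. \<forall>r>0. \<kappa> r \<le> d) \<longrightarrow> summable (\<lambda>n. var (Suc n)) \<longrightarrow> summable (\<lambda>n. 1 - (\<Sum>m<n. q m)))"
proof -
  interpret budget_recursion \<kappa> var
    by unfold_locales (use \<kappa> var_nonneg in auto)
  define c where "c n = R n / (2 * \<kappa> (R n))" for n
  define q where "q n = R n - R (Suc n)" for n
  have q_max: "q n = max 0 (c n - var (Suc n))" for n
    by (simp add: q_def c_def)
  have q_sum: "(\<Sum>m<n. q m) = 1 - R n" for n
    unfolding q_def by (simp add: sum_lessThan_telescope' del: budget.simps(2))
  interpret greedy A "\<lambda>n a. transition n {a}" q c
    by unfold_locales (rule A_nonempty, rule transition_window)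
  have q_sums: "q sums 1"
    unfolding sums_def q_sum using tendsto_diff[OF tendsto_const R_LIMSEQ[OF var_LIMSEQ[OF um]], of 1] by simp
  have "AE w in M. \<forall>a\<in>A. 0 \<le> cond_pr M past (X 0) {a} w"
    unfolding AE_ball_countable[OF countable_A] using cond_pr_01 by (auto elim!: eventually_mono)
  then have le: "AE w in M. \<forall>n. \<forall>a\<in>A. (\<Sum>m<n. q m * of_bool (select m (path w) = a)) \<le> cond_pr M past (X 0) {a} w"
    using transition_close AE_cylinder_pos
  proof eventually_elim
    fix w assume p: "\<forall>a\<in>A. 0 \<le> cond_pr M past (X 0) {a} w"
      and close: "\<forall>n. \<forall>a\<in>A. \<bar>transition n {a} (path w) - cond_pr M past (X 0) {a} w\<bar> \<le> var n"
      and pos: "\<forall>n. 0 < measure M (cylinder n (path w))"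
    \<comment> \<open>\<open>B\<close> carries at least \<open>1 - R n / 2\<close> of the transition
      probability, and \<open>1 - R n\<close> has been spent so far. So at least
      \<open>R n / 2\<close> is left on \<open>B\<close>, and this equals
      \<open>\<kappa> (R n) * c n\<close>.\<close>
    have avail: "\<exists>B\<subseteq>A. finite B \<and> B \<noteq> {} \<and>
        real (card B) * c n \<le> (\<Sum>b\<in>B. transition (Suc n) {b} (path w)) - (\<Sum>m<n. q m)" for n
    proof -
      obtain B where B: "B \<subseteq> A" "finite B" "B \<noteq> {}" "real (card B) \<le> \<kappa> (R n)" "measure \<mu> (A - B) \<le> R n / 2"
        using B[OF R_pos[of n]] by blast
      have "0 \<le> c n" using R_pos[of n] \<kappa>(1)[OF R_pos[of n]] by (simp add: c_def)
      then have "real (card B) * c n \<le> \<kappa> (R n) * c n" using B(4) by (rule mult_right_mono[rotated])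
      also have "\<dots> = R n / 2" using \<kappa>(1)[OF R_pos[of n]] by (simp add: c_def)
      also have "\<dots> \<le> 1 - measure \<mu> (A - B) - (1 - R n)" using B(5) by simp
      also have "\<dots> \<le> transition (Suc n) B (path w) - (1 - R n)"
        using transition_lower_bound[OF dom pos[rule_format, of "Suc n"] B(1)] by simp
      finally show ?thesis using B by (intro exI[of _ B]) (simp add: transition_finite_sum q_sum)
    qed
    show "\<forall>n. \<forall>a\<in>A. (\<Sum>m<n. q m * of_bool (select m (path w) = a)) \<le> cond_pr M past (X 0) {a} w"
      unfolding used_eq[symmetric]
      by (intro allI ballI used_le[where p="\<lambda>a. cond_pr M past (X 0) {a} w" and v=var])
         (use p close avail q_max in auto)
  qed
  let ?P = "distr M (path_space A) path"
  have "lookback_law A ?P q select"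
  proof (rule lookback_law.intro)
    show "countable A" by (rule countable_A)
    show "prob_space ?P" by (rule prob_space_distr) measurable
    show "sets ?P = sets (path_space A)" by simp
    have "distr ?P (path_space A) (shift 1) = distr M (path_space A) (shift 1 \<circ> path)"
      by (rule distr_distr) measurable
    also have "shift 1 \<circ> path = (\<lambda>w i. X (i + 1) w)"
      by (auto simp: fun_eq_iff shift_apply path_def add.commute)
    also have "distr M (path_space A) \<dots> = ?P"
      using stationary by (simp add: stationary_process_def path_def[abs_def])
    finally show "distr ?P (path_space A) (shift 1) = ?P" .
    show "0 \<le> q m" for m by (simp add: q_max)
    show "q sums 1" by (rule q_sums)
    show "depends_on {- int (Suc m)..<0} (select m)" for m by (rule select_window)
    show "select m x \<in> A" for m x by (rule select_in)
    fix a E assume a: "a \<in> A" and E: "E \<in> sets (window_algebra A ?P (\<lambda>i x. x i) {..<0})"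
    have comp: "(\<lambda>x. x i) \<in> ?P \<rightarrow>\<^sub>M count_space A" for i :: int by measurable
    have EP: "E \<in> sets (path_space A)"
      using E subalgebra_window_algebra[of "\<lambda>i x. x i" ?P A "{..<0}", OF comp] by (auto simp: subalgebra_def)
    have "(\<lambda>x. \<lambda>i\<in>{..<0}. x i) \<in> space ?P \<rightarrow> space (Pi\<^sub>M {..<0::int} (\<lambda>_. count_space A))"
      by (auto simp: space_path_space space_PiM)
    then obtain D where D: "D \<in> sets (Pi\<^sub>M {..<0::int} (\<lambda>_. count_space A))"
      and ED: "E = (\<lambda>x. \<lambda>i\<in>{..<0}. x i) -` D \<inter> space ?P"
      using E by (auto simp: window_algebra_def sets_vimage_algebra2)
    \<comment> \<open>A past event of the path space pulls back to a past event of the process, so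
      the required identity can be proved on \<open>M\<close>.\<close>
    have "path -` E \<inter> space M = (\<lambda>w. \<lambda>i\<in>{..<0}. X i w) -` D \<inter> space M"
      using measurable_space[OF measurable_path] by (auto simp: ED path_def)
    also have "\<dots> \<in> sets past"
      unfolding window_algebra_def by (rule in_vimage_algebra[OF D])
    finally have Ep: "path -` E \<inter> space M \<in> sets past" .
    have ae: "{x \<in> space ?P. x 0 = a} \<in> sets (path_space A)"
    proof -
      have "(\<lambda>x. x 0) -` {a} \<inter> space (path_space A) \<in> sets (path_space A)"
        by (rule measurable_sets[OF measurable_path_component]) (use a in auto)
      then show ?thesis by (simp add: vimage_def Int_def conj_commute)
    qed
    have "emeasure ?P ({x \<in> space ?P. x 0 = a} \<inter> E) = emeasure M (path -` ({x \<in> space ?P. x 0 = a} \<inter> E) \<inter> space M)"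
      by (rule emeasure_distr) (use ae EP in auto)
    also have "path -` ({x \<in> space ?P. x 0 = a} \<inter> E) \<inter> space M = {w \<in> space M. X 0 w = a} \<inter> (path -` E \<inter> space M)"
      using measurable_space[OF measurable_path] by (auto simp: path_def)
    also have "emeasure M \<dots> = (\<integral>\<^sup>+w\<in>path -` E \<inter> space M. ennreal (\<Sum>m. q m * of_bool (select m (path w) = a)) \<partial>M)"
      by (rule cond_pr_past_total[OF _ q_sums select_in select_window le a Ep]) (simp add: q_max)
    also have "\<dots> = (\<integral>\<^sup>+w. ennreal (\<Sum>m. q m * of_bool (select m (path w) = a)) * indicator E (path w) \<partial>M)"
      by (rule nn_integral_cong) (auto split: split_indicator)
    also have "\<dots> = (\<integral>\<^sup>+x\<in>E. ennreal (\<Sum>m. q m * of_bool (select m x = a)) \<partial>?P)"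
    proof (rule nn_integral_distr[symmetric])
      have [measurable]: "(\<lambda>x. of_bool (select m x = a) :: real) \<in> borel_measurable (path_space A)" for m
        by (rule measurable_window_eq[OF _ countable_A A_nonempty select_window]) simp
      note EP [measurable]
      show "(\<lambda>x. ennreal (\<Sum>m. q m * of_bool (select m x = a)) * indicator E x) \<in> borel_measurable (distr M (path_space A) path)"
        by measurable
    qed measurable
    finally show "emeasure ?P ({x \<in> space ?P. x 0 = a} \<inter> E)
      = (\<integral>\<^sup>+x\<in>E. ennreal (\<Sum>m. q m * of_bool (select m x = a)) \<partial>?P)" .
  qed
  moreover have "summable (\<lambda>n. 1 - (\<Sum>m<n. q m))" if "\<exists>d. \<forall>r>0. \<kappa> r \<le> d" "summable (\<lambda>n. var (Suc n))"
    using R_summable[OF _ that(2)] that(1) by (auto simp: q_sum)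
  ultimately show ?thesis by blast
qed

section \<open>Variation bounded by the tail of the look-back distance\<close>

lemma subalgebra_window_past: "subalgebra past (window n)"
proof -
  have m: "(\<lambda>w. \<lambda>i\<in>{- int n..<0}. X i w) \<in> past \<rightarrow>\<^sub>M Pi\<^sub>M {- int n..<0} (\<lambda>_. count_space A)"
  proof (rule measurable_restrict)
    fix i assume "i \<in> {- int n..<0}"
    then have i: "i \<in> {..<0}" by auto
    have "(\<lambda>w. (\<lambda>i\<in>{..<0}. X i w) i) \<in> past \<rightarrow>\<^sub>M count_space A"
      by (rule measurable_compose[OF measurable_restrict_window measurable_component_singleton[OF i]]) (rule measurable_X)
    then show "X i \<in> past \<rightarrow>\<^sub>M count_space A" using i by simp
  qed
  show ?thesis unfolding subalgebra_def
    using m by (auto simp: window_algebra_def measurable_iff_sets)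
qed

text \<open>
  A look-back distance \<open>\<le> k\<close> makes the conditional law of the next letter a function of the last \<open>k\<close>
  letters. So the law given the whole past lies between \<open>s\<^sub>k\<close> and \<open>s\<^sub>k + t\<close>, where \<open>s\<^sub>k\<close> depends on
  these letters and \<open>t\<close> is the probability of a longer look-back distance; then so does the law given the
  last \<open>k\<close> letters.
\<close>

lemma variation_le_lookback_tail:
  assumes rep: "complete_random_step_representation A M X Q"
  shows "variation A M X k \<le> emeasure Q {y \<in> space Q. k < lookback 0 y}"
proof -
  have sQ [measurable_cong]: "sets Q = sets (path_space (A \<times> {1..}))"
    and pQ: "prob_space Q"
    and lawQ: "distr Q (path_space A) (\<lambda>y i. letter i y) = distr M (path_space A) path"
    and ind: "prob_space.indep_set Q
       (sets (vimage_algebra (space Q) (lookback 0) (count_space {1..})))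
       (sets (window_algebra A Q letter {..<0}))"
    and step: "\<And>n E. n \<ge> 1 \<Longrightarrow> E \<subseteq> A \<Longrightarrow> AE x in Q. lookback 0 x = n \<longrightarrow>
        cond_pr Q (window_lookback_algebra A Q {- int n..<0}) (letter 0) E x
        = cond_pr Q (window_lookback_algebra A Q {..<0}) (letter 0) E x"
    using rep unfolding complete_random_step_representation_def stationary_process_def path_def[abs_def] by auto
  interpret Q: prob_space Q by (rule pQ)
  have mlet [measurable]: "letter i \<in> Q \<rightarrow>\<^sub>M count_space A" for i
    using measurable_letter by (simp add: measurable_cong_sets[OF sQ refl])
  have mlook: "lookback i \<in> Q \<rightarrow>\<^sub>M count_space {1..}" for i
    using measurable_lookback by (simp add: measurable_cong_sets[OF sQ refl])
  have mlets [measurable]: "(\<lambda>y i. letter i y) \<in> Q \<rightarrow>\<^sub>M path_space A"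
    by (rule measurable_into_path_space) measurable
  let ?wl = "\<lambda>I. window_lookback_algebra A Q I"
  have sub: "subalgebra Q (?wl I)" for I by (rule subalgebra_window_lookback_algebra[OF sQ])
  define L where "L T = {y \<in> space Q. lookback 0 y \<in> T}" for T
  have Leq: "L T = lookback 0 -` (T \<inter> {1..}) \<inter> space Q" for T
    using measurable_space[OF mlook[of 0]] by (auto simp: L_def)
  have Lsets [measurable]: "L T \<in> sets Q" for T
    unfolding Leq by (rule measurable_sets[OF mlook]) simp
  have law: "(\<integral>\<^sup>+y. f (\<lambda>i. letter i y) \<partial>Q) = (\<integral>\<^sup>+w. f (path w) \<partial>M)"
    if [measurable]: "f \<in> borel_measurable (path_space A)" for f
  proof -
    have "(\<integral>\<^sup>+y. f (\<lambda>i. letter i y) \<partial>Q) = (\<integral>\<^sup>+x. f x \<partial>distr Q (path_space A) (\<lambda>y i. letter i y))"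
      by (rule nn_integral_distr[symmetric]) measurable
    also have "\<dots> = (\<integral>\<^sup>+w. f (path w) \<partial>M)"
      unfolding lawQ by (rule nn_integral_distr) measurable
    finally show ?thesis .
  qed
  \<comment> \<open>Independence of the look-back distance and the past, extended from events to
    functions: given the past, the conditional probability of \<open>L T\<close> is
    constant.\<close>
  have indep: "(\<integral>\<^sup>+y. h (\<lambda>i. letter i y) * indicator (L T) y \<partial>Q) = emeasure Q (L T) * (\<integral>\<^sup>+y. h (\<lambda>i. letter i y) \<partial>Q)"
    if h: "h \<in> borel_measurable (path_space A)" "depends_on {..<0} h" for h T
  proof -
    let ?F = "window_algebra A Q letter {..<0}"
    have subF: "subalgebra Q ?F" by (rule subalgebra_window_algebra) measurable
    interpret F: finite_measure_subalgebra Q ?F by unfold_locales (rule subF)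
    have hF: "(\<lambda>y. h (\<lambda>i. letter i y)) \<in> borel_measurable ?F"
      by (rule measurable_window_algebra[OF mlet h A_nonempty])
    have "AE y in Q. (\<lambda>_. emeasure Q (L T)) y = nn_cond_exp Q ?F (indicator (L T)) y"
    proof (rule F.nn_cond_exp_charact)
      fix E assume E: "E \<in> sets ?F"
      then have [measurable]: "E \<in> sets Q" using subF by (auto simp: subalgebra_def)
      have "L T \<in> sets (vimage_algebra (space Q) (lookback 0) (count_space {1..}))"
        unfolding Leq by (rule in_vimage_algebra) simp
      then have "emeasure Q (L T \<inter> E) = emeasure Q (L T) * emeasure Q E"
        using Q.indep_setD[OF ind _ E] by (simp add: Q.emeasure_eq_measure ennreal_mult)
      moreover have "(\<integral>\<^sup>+y\<in>E. indicator (L T) y \<partial>Q) = emeasure Q (L T \<inter> E)"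
        by (simp add: indicator_inter_arith[symmetric])
      ultimately show "(\<integral>\<^sup>+y\<in>E. indicator (L T) y \<partial>Q) = (\<integral>\<^sup>+y\<in>E. emeasure Q (L T) \<partial>Q)"
        by (simp add: nn_integral_cmult_indicator)
    qed measurable
    then have "(\<integral>\<^sup>+y. h (\<lambda>i. letter i y) * emeasure Q (L T) \<partial>Q)
        = (\<integral>\<^sup>+y. h (\<lambda>i. letter i y) * nn_cond_exp Q ?F (indicator (L T)) y \<partial>Q)"
      by (intro nn_integral_cong_AE) auto
    also have "\<dots> = (\<integral>\<^sup>+y. h (\<lambda>i. letter i y) * indicator (L T) y \<partial>Q)"
      by (rule F.nn_cond_exp_intg[OF hF]) measurable
    finally show ?thesis
      using measurable_from_subalg[OF subF hF] by (simp add: nn_integral_multc mult.commute[of "emeasure Q (L T)"])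
  qed
  define t where "t = measure Q {y \<in> space Q. k < lookback 0 y}"
  define l where "l n = measure Q (L {n})" for n
  have l_sums: "l sums 1"
  proof -
    have "(\<lambda>n. measure Q (L {n})) sums measure Q (\<Union>n. L {n})"
      by (rule Q.finite_measure_UNION) (blast intro: Lsets, auto simp: disjoint_family_on_def L_def)
    moreover have "(\<Union>n. L {n}) = space Q" by (auto simp: L_def)
    ultimately show ?thesis using Q.prob_space by (simp add: l_def[abs_def])
  qed
  have l_nonneg: "0 \<le> l n" for n by (simp add: l_def)
  \<comment> \<open>Distances are at least \<open>1\<close>; the index \<open>0\<close> is kept,
    with mass \<open>0\<close>, so that the sums can run over all natural numbers.\<close>
  have l0: "l 0 = 0"
    using Leq[of "{0}"] by (simp add: l_def)
  have t_eq: "1 - (\<Sum>n\<le>k. l n) = t"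
  proof -
    have "measure Q (\<Union>n\<in>{..k}. L {n}) = (\<Sum>n\<le>k. l n)"
      unfolding l_def
      by (rule Q.finite_measure_finite_Union) (simp, blast intro: Lsets, auto simp: disjoint_family_on_def L_def)
    moreover have "space Q - (\<Union>n\<in>{..k}. L {n}) = {y \<in> space Q. k < lookback 0 y}"
      by (auto simp: L_def)
    ultimately show ?thesis
      using Q.prob_compl[of "\<Union>n\<in>{..k}. L {n}"] by (simp add: t_def)
  qed
  have "variation A M X k \<le> ennreal t"
  proof (rule variation_leI)
    fix a assume a: "a \<in> A"
    \<comment> \<open>\<open>D n x\<close> is an atom of the algebra generated by the last
      \<open>n\<close> letters and the look-back distance. The ratio \<open>c n\<close> is an
      explicit form of the conditional probability there, and visibly depends on \<open>n\<close>
      letters only.\<close>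
    define D where "D n x = {y \<in> space Q. lookback 0 y = n \<and> (\<forall>j\<in>{- int n..<0}. letter j y = x j)}" for n and x :: "int \<Rightarrow> 'a"
    define c where "c n x = measure Q ({y \<in> space Q. letter 0 y \<in> {a}} \<inter> D n x) / measure Q (D n x)" for n x
    have c_win: "depends_on {- int n..<0} (c n)" for n
    proof (rule depends_onI)
      fix x y :: "int \<Rightarrow> 'a" assume "\<And>i. i \<in> {- int n..<0} \<Longrightarrow> x i = y i"
      then have "D n x = D n y" by (auto simp: D_def)
      then show "c n x = c n y" by (simp add: c_def)
    qed
    have c_past: "depends_on {..<0} (c n)" for n by (rule depends_on_mono[OF c_win]) auto
    have cm [measurable]: "c n \<in> borel_measurable (path_space A)" for n
      by (rule measurable_finite_window[OF _ countable_A A_nonempty c_win]) auto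
    have letter_event_Q [measurable]: "{y \<in> space Q. letter 0 y \<in> {a}} \<in> sets Q"
    proof -
      have "letter 0 -` {a} \<inter> space Q \<in> sets Q" by (rule measurable_sets[OF mlet]) (use a in auto)
      then show ?thesis by (simp add: vimage_def Int_def conj_commute)
    qed
    have c_cond: "AE y in Q. lookback 0 y = n \<longrightarrow> cond_pr Q (?wl {- int n..<0}) (letter 0) {a} y = c n (\<lambda>i. letter i y)" for n
    proof -
      let ?T = "\<lambda>x. (\<lambda>i\<in>{- int n..<0}. letter i x, lookback 0 x)" and ?C = "PiE {- int n..<0} (\<lambda>_. A) \<times> {1::nat..}"
      have cC: "countable (PiE {- int n..<0} (\<lambda>_. A))" by (rule countable_PiE) (auto simp: countable_A)
      have N: "Pi\<^sub>M {- int n..<0} (\<lambda>_. count_space A) \<Otimes>\<^sub>M count_space {1::nat..} = count_space ?C"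
        unfolding window_count_space by (rule pair_measure_countable[OF cC]) simp
      have "?T \<in> Q \<rightarrow>\<^sub>M Pi\<^sub>M {- int n..<0} (\<lambda>_. count_space A) \<Otimes>\<^sub>M count_space {1..}"
        by (intro measurable_Pair measurable_restrict mlet mlook)
      then have T: "?T \<in> Q \<rightarrow>\<^sub>M count_space ?C" by (simp only: N)
      have "countable ?C" using cC by (intro countable_SIGMA) auto
      from AE_atom_pos[OF pQ T this] show ?thesis using AE_space
      proof eventually_elim
        fix y assume pos: "0 < measure Q {y' \<in> space Q. ?T y' = ?T y}" and y: "y \<in> space Q"
        show "lookback 0 y = n \<longrightarrow> cond_pr Q (?wl {- int n..<0}) (letter 0) {a} y = c n (\<lambda>i. letter i y)"
        proof
          assume ln: "lookback 0 y = n"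
          have eqD: "{y' \<in> space Q. ?T y' = ?T y} = D n (\<lambda>i. letter i y)"
            by (auto simp: D_def ln fun_eq_iff restrict_def)
          have "cond_pr Q (vimage_algebra (space Q) ?T (count_space ?C)) (letter 0) {a} y * measure Q {y' \<in> space Q. ?T y' = ?T y}
              = measure Q ({y \<in> space Q. letter 0 y \<in> {a}} \<inter> {y' \<in> space Q. ?T y' = ?T y})"
            by (rule cond_pr_atom[OF pQ T _ y letter_event_Q]) (use measurable_space[OF T y] in auto)
          then show "cond_pr Q (?wl {- int n..<0}) (letter 0) {a} y = c n (\<lambda>i. letter i y)"
            using pos unfolding window_lookback_algebra_def N eqD
            by (simp add: c_def eq_divide_eq less_imp_neq[THEN not_sym])
        qed
      qed
    qed
    have c01: "0 \<le> c n x" "c n x \<le> 1" for n x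
    proof -
      show "0 \<le> c n x" by (simp add: c_def)
      have "D n x \<in> sets Q"
      proof -
        have "{y \<in> space Q. \<forall>j\<in>{- int n..<0}. letter j y = x j} \<in> sets Q"
        proof (rule sets.sets_Collect_finite_All)
          fix j
          have "letter j -` ({x j} \<inter> A) \<inter> space Q \<in> sets Q" by (rule measurable_sets[OF mlet]) auto
          moreover have "letter j -` ({x j} \<inter> A) \<inter> space Q = {y \<in> space Q. letter j y = x j}"
            using measurable_space[OF mlet] by auto
          ultimately show "{y \<in> space Q. letter j y = x j} \<in> sets Q" by simp
        qed simp
        moreover have "D n x = L {n} \<inter> {y \<in> space Q. \<forall>j\<in>{- int n..<0}. letter j y = x j}"
          by (auto simp: D_def L_def)
        ultimately show ?thesis by simp
      qed
      then have "measure Q ({y \<in> space Q. letter 0 y \<in> {a}} \<inter> D n x) \<le> measure Q (D n x)"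
        by (intro Q.finite_measure_mono) auto
      then show "c n x \<le> 1"
        unfolding c_def using divide_right_mono[of _ "measure Q (D n x)" "measure Q (D n x)"]
        by (cases "measure Q (D n x) = 0") force+
    qed
    \<comment> \<open>\<open>s\<close> averages over all distances and will turn out to be the
      conditional probability given the whole past. Its part \<open>s\<^sub>k\<close> from distances
      up to \<open>k\<close> sees the last \<open>k\<close> letters only.\<close>
    define s where "s x = (\<Sum>n. l n * c n x)" for x
    define s\<^sub>k where "s\<^sub>k x = (\<Sum>n\<le>k. l n * c n x)" for x
    have summ: "summable (\<lambda>n. l n * c n x)" for x
      by (rule summable_comparison_test[OF _ sums_summable[OF l_sums]])
         (use c01 l_nonneg in \<open>auto simp: abs_mult intro!: exI[of _ 0] mult_left_le\<close>)
    have sm [measurable]: "s \<in> borel_measurable (path_space A)" "s\<^sub>k \<in> borel_measurable (path_space A)"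
      unfolding s_def s\<^sub>k_def by measurable
    have s_past: "depends_on {..<0} s"
    proof (rule depends_onI)
      fix x y :: "int \<Rightarrow> 'a" assume "\<And>i. i \<in> {..<0} \<Longrightarrow> x i = y i"
      then have "c n x = c n y" for n by (rule depends_onD[OF c_past])
      then show "s x = s y" by (simp add: s_def)
    qed
    have sk_window: "depends_on {- int k..<0} s\<^sub>k"
    proof (rule depends_onI)
      fix x y :: "int \<Rightarrow> 'a" assume *: "\<And>i. i \<in> {- int k..<0} \<Longrightarrow> x i = y i"
      have "c n x = c n y" if "n \<le> k" for n by (rule depends_onD[OF c_win]) (use * that in auto)
      then show "s\<^sub>k x = s\<^sub>k y" by (simp add: s\<^sub>k_def)
    qed
    have sk_le: "s\<^sub>k x \<le> s x" for x
      unfolding s_def s\<^sub>k_def by (rule sum_le_suminf[OF summ]) (use c01 l_nonneg in auto)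
    have s_le: "s x \<le> s\<^sub>k x + t" for x
    proof -
      have "s x - s\<^sub>k x = (\<Sum>n. l (n + Suc k) * c (n + Suc k) x)"
        using suminf_split_initial_segment[OF summ, of x "Suc k"] by (simp add: s_def s\<^sub>k_def lessThan_Suc_atMost)
      also have "\<dots> \<le> (\<Sum>n. l (n + Suc k))"
        by (rule suminf_le)
           (use c01 l_nonneg summ[of x] sums_summable[OF l_sums] in
             \<open>auto intro!: mult_left_le simp del: add_Suc_right add_Suc simp: summable_iff_shift[where f="\<lambda>n. l n * c n x" and k="Suc k", simplified]
               summable_iff_shift[where f=l and k="Suc k", simplified]\<close>)
      also have "\<dots> = t"
        using suminf_split_initial_segment[OF sums_summable[OF l_sums], of "Suc k"] sums_unique[OF l_sums] t_eq
        by (simp add: lessThan_Suc_atMost)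
      finally show ?thesis by simp
    qed
    have t_nonneg: "0 \<le> t" by (simp add: t_def)
    have s01: "0 \<le> s x" "s x \<le> 1" for x
    proof -
      show "0 \<le> s x" unfolding s_def by (rule suminf_nonneg[OF summ]) (use c01 l_nonneg in auto)
      have "s x \<le> (\<Sum>n. l n)" unfolding s_def
        by (rule suminf_le[OF _ summ sums_summable[OF l_sums]]) (use c01 l_nonneg in \<open>auto intro: mult_left_le\<close>)
      then show "s x \<le> 1" using sums_unique[OF l_sums] by simp
    qed
    \<comment> \<open>The event is split by the value \<open>n\<close> of the look-back distance.
      The random-step property turns the conditional probability given past and distance into
      \<open>c n\<close>, and independence of distance and past turns \<open>L {n}\<close> into the
      factor \<open>l n\<close>.\<close>
    have key: "emeasure M ({w \<in> space M. X 0 w \<in> {a}} \<inter> E) = (\<integral>\<^sup>+w\<in>E. ennreal (s (path w)) \<partial>M)"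
      if E: "E \<in> sets past" for E
    proof -
      have "(\<lambda>w. \<lambda>i\<in>{..<0}. X i w) \<in> space M \<rightarrow> space (Pi\<^sub>M {..<0::int} (\<lambda>_. count_space A))"
        using measurable_space[OF measurable_X] by (auto simp: space_PiM)
      then obtain B where B [measurable]: "B \<in> sets (Pi\<^sub>M {..<0::int} (\<lambda>_. count_space A))"
        and EB: "E = (\<lambda>w. \<lambda>i\<in>{..<0}. X i w) -` B \<inter> space M"
        using E by (auto simp: window_algebra_def sets_vimage_algebra2)
      have EM [measurable]: "E \<in> sets M" using E subalgebra_window[of "{..<0}"] by (auto simp: subalgebra_def)
      define h :: "(int \<Rightarrow> 'a) \<Rightarrow> ennreal" where "h x = indicator B (restrict x {..<0})" for x
      have h [measurable]: "h \<in> borel_measurable (path_space A)"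
      proof -
        have "(\<lambda>x. restrict x {..<0}) \<in> path_space A \<rightarrow>\<^sub>M Pi\<^sub>M {..<0::int} (\<lambda>_. count_space A)" by measurable
        then show ?thesis unfolding h_def by measurable
      qed
      have h_past: "h x = h y" if "\<And>i. i \<in> {..<0} \<Longrightarrow> x i = y i" for x y
      proof -
        have "restrict x {..<0} = restrict y {..<0}" using that by auto
        then show ?thesis by (simp add: h_def)
      qed
      have hE: "h (path w) = indicator E w" if "w \<in> space M" for w
        using that by (auto simp: h_def EB path_def restrict_def split: split_indicator)
      define G where "G = {y \<in> space Q. (\<lambda>i\<in>{..<0}. letter i y) \<in> B}"
      have hG: "h (\<lambda>i. letter i y) = indicator G y" if "y \<in> space Q" for y
        using that by (auto simp: h_def G_def restrict_def split: split_indicator)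
      have ia [measurable]: "(\<lambda>x. indicator {a} (x 0) :: ennreal) \<in> borel_measurable (path_space A)"
        by (rule measurable_indicator_eq[OF measurable_path_component a])
      have Tw: "(\<lambda>x. (\<lambda>i\<in>{..<0}. letter i x, lookback 0 x)) \<in> ?wl {..<0} \<rightarrow>\<^sub>M Pi\<^sub>M {..<0} (\<lambda>_. count_space A) \<Otimes>\<^sub>M count_space {1..}"
        unfolding window_lookback_algebra_def
        using measurable_space[OF mlet] measurable_space[OF mlook]
        by (intro measurable_vimage_algebra1) (auto simp: space_PiM space_pair_measure)
      have space_wl: "space (?wl I) = space Q" for I by (simp add: window_lookback_algebra_def)
      have GL: "G \<inter> L {n} \<in> sets (?wl {..<0})" for n
      proof -
        have "(\<lambda>x. fst (\<lambda>i\<in>{..<0}. letter i x, lookback 0 x)) -` B \<inter> space (?wl {..<0}) \<in> sets (?wl {..<0})"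
          by (rule measurable_sets[OF measurable_compose[OF Tw measurable_fst] B])
        moreover have "(\<lambda>x. snd (\<lambda>i\<in>{..<0}. letter i x, lookback 0 x)) -` ({n} \<inter> {1..}) \<inter> space (?wl {..<0}) \<in> sets (?wl {..<0})"
          by (rule measurable_sets[OF measurable_compose[OF Tw measurable_snd]]) simp
        moreover have "G \<inter> L {n} = ((\<lambda>x. fst (\<lambda>i\<in>{..<0}. letter i x, lookback 0 x)) -` B \<inter> space (?wl {..<0}))
            \<inter> ((\<lambda>x. snd (\<lambda>i\<in>{..<0}. letter i x, lookback 0 x)) -` ({n} \<inter> {1..}) \<inter> space (?wl {..<0}))"
          unfolding Leq space_wl by (auto simp: G_def)
        ultimately show ?thesis by (simp only: sets.Int)
      qed
      have GLQ: "G \<inter> L {n} \<in> sets Q" for n using GL[of n] sub[of "{..<0}"] by (auto simp: subalgebra_def)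
      have part: "emeasure Q ({y \<in> space Q. letter 0 y \<in> {a}} \<inter> (G \<inter> L {n})) = ennreal (l n) * (\<integral>\<^sup>+w\<in>E. ennreal (c n (path w)) \<partial>M)" for n
      proof (cases "n = 0")
        case True
        have "L {0} = {}" unfolding Leq by simp
        then show ?thesis using True by (simp add: l0)
      next
        case False
        interpret F: finite_measure_subalgebra Q "?wl {..<0}" by unfold_locales (rule sub)
        let ?p = "cond_pr Q (?wl {..<0}) (letter 0) {a}"
        have intI: "integrable Q (indicator {y \<in> space Q. letter 0 y \<in> {a}} :: _ \<Rightarrow> real)"
          using letter_event_Q by (intro integrable_real_indicator) (auto simp: Q.emeasure_eq_measure)
        have "AE y in Q. lookback 0 y = n \<longrightarrow> ?p y = c n (\<lambda>i. letter i y)"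
          using step[of n "{a}"] c_cond[of n] a False by (auto elim!: eventually_elim2)
        then have ae: "AE y in Q. indicator (G \<inter> L {n}) y * ?p y = indicator (G \<inter> L {n}) y * c n (\<lambda>i. letter i y)"
          by eventually_elim (auto simp: L_def split: split_indicator)
        have cmQ [measurable]: "(\<lambda>y. c n (\<lambda>i. letter i y)) \<in> borel_measurable Q"
          by (rule measurable_compose[OF mlets cm])
        note GLQ[measurable]
        have "measure Q ({y \<in> space Q. letter 0 y \<in> {a}} \<inter> (G \<inter> L {n}))
            = (\<integral>y\<in>G \<inter> L {n}. indicator {y \<in> space Q. letter 0 y \<in> {a}} y \<partial>Q)"
          unfolding set_lebesgue_integral_def
          using letter_event_Q GLQ[of n] by (simp add: indicator_inter_arith[symmetric] Int_commute)
        also have "\<dots> = (\<integral>y. indicator (G \<inter> L {n}) y * ?p y \<partial>Q)"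
          using F.real_cond_exp_intA[OF intI GL[of n]] by (simp add: set_lebesgue_integral_def cond_pr_def)
        also have "\<dots> = (\<integral>y. indicator (G \<inter> L {n}) y * c n (\<lambda>i. letter i y) \<partial>Q)"
          by (rule integral_cong_AE[OF _ _ ae]) (auto simp: cond_pr_def)
        finally have "emeasure Q ({y \<in> space Q. letter 0 y \<in> {a}} \<inter> (G \<inter> L {n}))
            = ennreal (\<integral>y. indicator (G \<inter> L {n}) y * c n (\<lambda>i. letter i y) \<partial>Q)"
          by (simp add: Q.emeasure_eq_measure)
        also have "\<dots> = (\<integral>\<^sup>+y. ennreal (indicator (G \<inter> L {n}) y * c n (\<lambda>i. letter i y)) \<partial>Q)"
        proof (rule nn_integral_eq_integral[symmetric])
          show "integrable Q (\<lambda>y. indicator (G \<inter> L {n}) y * c n (\<lambda>i. letter i y))"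
            by (rule Q.integrable_const_bound[where B=1]) (auto simp: c01 split: split_indicator)
        qed (simp add: c01)
        also have "\<dots> = (\<integral>\<^sup>+y. (h (\<lambda>i. letter i y) * ennreal (c n (\<lambda>i. letter i y))) * indicator (L {n}) y \<partial>Q)"
          by (rule nn_integral_cong) (auto simp: hG split: split_indicator)
        also have "\<dots> = emeasure Q (L {n}) * (\<integral>\<^sup>+y. h (\<lambda>i. letter i y) * ennreal (c n (\<lambda>i. letter i y)) \<partial>Q)"
        proof (rule indep[of "\<lambda>x. h x * ennreal (c n x)"])
          show "depends_on {..<0} (\<lambda>x. h x * ennreal (c n x))"
          proof (rule depends_onI)
            fix x y :: "int \<Rightarrow> 'a" assume *: "\<And>i. i \<in> {..<0} \<Longrightarrow> x i = y i"
            show "h x * ennreal (c n x) = h y * ennreal (c n y)"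
              using h_past[OF *] depends_onD[OF c_past *] by simp
          qed
        qed measurable
        also have "(\<integral>\<^sup>+y. h (\<lambda>i. letter i y) * ennreal (c n (\<lambda>i. letter i y)) \<partial>Q) = (\<integral>\<^sup>+w. h (path w) * ennreal (c n (path w)) \<partial>M)"
          by (rule law) measurable
        also have "\<dots> = (\<integral>\<^sup>+w\<in>E. ennreal (c n (path w)) \<partial>M)"
          by (rule nn_integral_cong) (simp add: hE mult.commute)
        finally show ?thesis by (simp add: l_def Q.emeasure_eq_measure)
      qed
      have "emeasure M ({w \<in> space M. X 0 w \<in> {a}} \<inter> E) = (\<integral>\<^sup>+w. indicator {a} (path w 0) * h (path w) \<partial>M)"
      proof -
        have "{w \<in> space M. X 0 w \<in> {a}} \<in> sets M" using a by (intro letter_event) simp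
        then have "emeasure M ({w \<in> space M. X 0 w \<in> {a}} \<inter> E) = (\<integral>\<^sup>+w. indicator ({w \<in> space M. X 0 w \<in> {a}} \<inter> E) w \<partial>M)"
          by simp
        also have "\<dots> = (\<integral>\<^sup>+w. indicator {a} (path w 0) * h (path w) \<partial>M)"
        proof (rule nn_integral_cong)
          fix w assume w: "w \<in> space M"
          show "indicator ({w \<in> space M. X 0 w \<in> {a}} \<inter> E) w = (indicator {a} (path w 0) * h (path w) :: ennreal)"
            unfolding hE[OF w] using w by (auto simp: path_def split: split_indicator)
        qed
        finally show ?thesis .
      qed
      also have "\<dots> = (\<integral>\<^sup>+y. indicator {a} (letter 0 y) * h (\<lambda>i. letter i y) \<partial>Q)"
        by (rule law[symmetric, of "\<lambda>x. indicator {a} (x 0) * h x"]) measurable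
      also have "\<dots> = (\<integral>\<^sup>+y. indicator (\<Union>n. {y \<in> space Q. letter 0 y \<in> {a}} \<inter> (G \<inter> L {n})) y \<partial>Q)"
        by (rule nn_integral_cong) (auto simp: hG L_def split: split_indicator)
      also have "\<dots> = emeasure Q (\<Union>n. {y \<in> space Q. letter 0 y \<in> {a}} \<inter> (G \<inter> L {n}))"
        by (rule nn_integral_indicator) (use GLQ letter_event_Q in blast)
      also have "\<dots> = (\<Sum>n. emeasure Q ({y \<in> space Q. letter 0 y \<in> {a}} \<inter> (G \<inter> L {n})))"
        by (rule suminf_emeasure[symmetric]) (use GLQ letter_event_Q in \<open>auto simp: disjoint_family_on_def L_def\<close>)
      also have "\<dots> = (\<Sum>n. \<integral>\<^sup>+w. ennreal (l n) * (ennreal (c n (path w)) * indicator E w) \<partial>M)"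
        by (simp only: part) (subst nn_integral_cmult, measurable)
      also have "\<dots> = (\<integral>\<^sup>+w. (\<Sum>n. ennreal (l n) * (ennreal (c n (path w)) * indicator E w)) \<partial>M)"
        by (rule nn_integral_suminf[symmetric]) measurable
      also have "\<dots> = (\<integral>\<^sup>+w\<in>E. ennreal (s (path w)) \<partial>M)"
      proof (rule nn_integral_cong)
        fix w
        have "ennreal (s (path w)) = (\<Sum>n. ennreal (l n * c n (path w)))"
          unfolding s_def by (rule suminf_ennreal2[symmetric]) (use summ c01 l_nonneg in auto)
        then show "(\<Sum>n. ennreal (l n) * (ennreal (c n (path w)) * indicator E w)) = ennreal (s (path w)) * indicator E w"
          by (simp add: ennreal_mult c01 l_nonneg mult.assoc[symmetric])
      qed
      finally show ?thesis .
    qed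
    let ?I = "indicator {w \<in> space M. X 0 w \<in> {a}} :: 'w \<Rightarrow> real"
    have S: "{w \<in> space M. X 0 w \<in> {a}} \<in> sets M" using a by (intro letter_event) simp
    have int: "integrable M ?I"
      using S by (intro integrable_real_indicator) (auto simp: emeasure_eq_measure)
    have smM [measurable]: "(\<lambda>w. s (path w)) \<in> borel_measurable M" "(\<lambda>w. s\<^sub>k (path w)) \<in> borel_measurable M"
      by (rule measurable_compose[OF measurable_path sm(1)], rule measurable_compose[OF measurable_path sm(2)])
    have ints: "integrable M (\<lambda>w. s (path w))"
      by (rule integrable_const_bound[where B=1]) (auto simp: s01)
    have sk01: "\<bar>s\<^sub>k x\<bar> \<le> 1" for x
    proof -
      have "0 \<le> s\<^sub>k x" unfolding s\<^sub>k_def by (intro sum_nonneg mult_nonneg_nonneg c01 l_nonneg)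
      then show ?thesis using sk_le[of x] s01(2)[of x] by simp
    qed
    have intsk: "integrable M (\<lambda>w. s\<^sub>k (path w))"
      by (rule integrable_const_bound[where B=1]) (auto simp: sk01)
    interpret past: finite_measure_subalgebra M past by unfold_locales (rule subalgebra_window)
    interpret win: finite_measure_subalgebra M "window k" by unfold_locales (rule subalgebra_window)
    have p: "AE w in M. cond_pr M past (X 0) {a} w = s (path w)"
      unfolding cond_pr_def
    proof (rule past.real_cond_exp_charact[OF _ int ints])
      show "(\<lambda>w. s (path w)) \<in> borel_measurable past"
        using measurable_window_algebra[OF measurable_X sm(1) s_past A_nonempty] by (simp add: path_def)
      fix E assume E: "E \<in> sets past"
      then have EM [measurable]: "E \<in> sets M" using subalgebra_window[of "{..<0}"] by (auto simp: subalgebra_def)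
      have "(\<integral>w\<in>E. ?I w \<partial>M) = measure M ({w \<in> space M. X 0 w \<in> {a}} \<inter> E)"
        unfolding set_lebesgue_integral_def using S by (simp add: indicator_inter_arith[symmetric] Int_commute)
      moreover have "ennreal (measure M ({w \<in> space M. X 0 w \<in> {a}} \<inter> E)) = ennreal (\<integral>w\<in>E. s (path w) \<partial>M)"
      proof -
        have "ennreal (measure M ({w \<in> space M. X 0 w \<in> {a}} \<inter> E)) = (\<integral>\<^sup>+w\<in>E. ennreal (s (path w)) \<partial>M)"
          using key[OF E] by (simp add: emeasure_eq_measure)
        also have "\<dots> = (\<integral>\<^sup>+w. ennreal (indicator E w * s (path w)) \<partial>M)"
          by (intro nn_integral_cong) (auto split: split_indicator)
        also have "\<dots> = ennreal (\<integral>w. indicator E w * s (path w) \<partial>M)"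
          by (rule nn_integral_eq_integral)
             (auto simp: s01 intro!: integrable_const_bound[where B=1] split: split_indicator)
        finally show ?thesis by (simp add: set_lebesgue_integral_def)
      qed
      moreover have "0 \<le> (\<integral>w\<in>E. s (path w) \<partial>M)"
        unfolding set_lebesgue_integral_def by (rule integral_nonneg_AE) (auto simp: s01)
      ultimately show "(\<integral>w\<in>E. ?I w \<partial>M) = (\<integral>w\<in>E. s (path w) \<partial>M)" by simp
    qed
    have skw: "(\<lambda>w. s\<^sub>k (path w)) \<in> borel_measurable (window k)"
      using measurable_window_algebra[OF measurable_X sm(2) sk_window A_nonempty] by (simp add: path_def)
    \<comment> \<open>By the tower property, the probability given the window is the conditional
      expectation of \<open>s (path w)\<close>. Both bounds on \<open>s\<close> are known to the
      window, so conditioning leaves them unchanged.\<close>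
    have "AE w in M. real_cond_exp M (window k) (real_cond_exp M past ?I) w = real_cond_exp M (window k) ?I w"
      by (rule win.real_cond_exp_nested_subalg[OF subalgebra_window subalgebra_window_past int])
    moreover have "AE w in M. real_cond_exp M (window k) (real_cond_exp M past ?I) w = real_cond_exp M (window k) (\<lambda>w. s (path w)) w"
      by (rule win.real_cond_exp_cong) (use p in \<open>auto simp: cond_pr_def\<close>)
    moreover have "AE w in M. real_cond_exp M (window k) (\<lambda>w. s\<^sub>k (path w)) w \<le> real_cond_exp M (window k) (\<lambda>w. s (path w)) w"
      by (rule win.real_cond_exp_mono) (auto simp: sk_le ints intsk)
    moreover have "AE w in M. real_cond_exp M (window k) (\<lambda>w. s (path w)) w \<le> real_cond_exp M (window k) (\<lambda>w. s\<^sub>k (path w) + t) w"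
      by (rule win.real_cond_exp_mono) (auto simp: s_le ints intsk)
    moreover have "AE w in M. real_cond_exp M (window k) (\<lambda>w. s\<^sub>k (path w)) w = s\<^sub>k (path w)"
      by (rule win.real_cond_exp_F_meas[OF intsk skw])
    moreover have "AE w in M. real_cond_exp M (window k) (\<lambda>w. s\<^sub>k (path w) + t) w = s\<^sub>k (path w) + t"
      by (rule win.real_cond_exp_F_meas) (use intsk skw in auto)
    ultimately show "AE w in M. \<bar>cond_pr M (window k) (X 0) {a} w - cond_pr M past (X 0) {a} w\<bar> \<le> t"
      using p unfolding cond_pr_def
    proof eventually_elim
      case (elim w)
      then show ?case using sk_le[of "path w"] s_le[of "path w"] by linarith
    qed
  qed
  then show ?thesis by (simp add: t_def Q.emeasure_eq_measure)
qed

end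

theorem theorem1:
  fixes A :: "'a set" and M :: "'w measure" and X :: "int \<Rightarrow> 'w \<Rightarrow> 'a" and \<mu> :: "'a measure"
  assumes "countable A"
    and "stationary_process A M X"
    and "uniform_martingale A M X"
    and "finite_dominating_measure A M X \<mu>"
  shows "deterministic_random_step_Markov A M X \<and>
    (finite A \<longrightarrow>
      (deterministic_random_step_Markov_finite_lookback A M X \<longleftrightarrow>
        (\<Sum>n. variation A M X (Suc n)) < \<infinity>))"
proof -
  interpret letter_process A M X by unfold_locales fact+
  have \<mu>: "sets \<mu> = sets (count_space A)" "emeasure \<mu> A < \<infinity>"
    using assms(4) by (auto simp: finite_dominating_measure_def)
  obtain \<kappa> :: "real \<Rightarrow> real" where \<kappa>: "\<And>r. 0 < r \<Longrightarrow> 1 \<le> \<kappa> r" "\<And>r s. 0 < r \<Longrightarrow> r \<le> s \<Longrightarrow> \<kappa> s \<le> \<kappa> r"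
      "\<And>r. 0 < r \<Longrightarrow> \<exists>B\<subseteq>A. finite B \<and> B \<noteq> {} \<and> real (card B) \<le> \<kappa> r \<and> measure \<mu> (A - B) \<le> r / 2"
    and bound: "finite A \<Longrightarrow> \<forall>r>0. \<kappa> r \<le> real (card A)"
    by (rule exists_alphabet_size[OF countable_A A_nonempty \<mu>]) blast
  obtain q g where law: "lookback_law A (distr M (path_space A) path) q g"
    and "(\<exists>d. \<forall>r>0. \<kappa> r \<le> d) \<longrightarrow> summable (\<lambda>n. var (Suc n)) \<longrightarrow> summable (\<lambda>n. 1 - (\<Sum>m<n. q m))"
    using exists_lookback_law[OF assms(3,4) \<kappa>] by blast
  then have tail: "finite A \<Longrightarrow> summable (\<lambda>n. var (Suc n)) \<Longrightarrow> summable (\<lambda>n. 1 - (\<Sum>m<n. q m))"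
    using bound by blast
  interpret law: lookback_law A "distr M (path_space A) path" q g by (rule law)
  have rep: "deterministic_representation A M X law.joint"
    by (rule law.deterministic_joint) (simp add: path_def[abs_def])
  have "deterministic_random_step_Markov A M X"
    unfolding deterministic_random_step_Markov_def using assms(1,2) rep by blast
  moreover have "deterministic_random_step_Markov_finite_lookback A M X \<longleftrightarrow> (\<Sum>n. variation A M X (Suc n)) < \<infinity>"
    if "finite A"
  proof
    assume "deterministic_random_step_Markov_finite_lookback A M X"
    then obtain Q where Q: "deterministic_representation A M X Q" and fin: "(\<integral>\<^sup>+y. of_nat (lookback 0 y) \<partial>Q) < \<infinity>"
      unfolding deterministic_random_step_Markov_finite_lookback_def by blast
    then have crep: "complete_random_step_representation A M X Q"
      by (simp add: deterministic_representation_def)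
    then have sQ: "sets Q = sets (path_space (A \<times> {1..}))"
      by (simp add: complete_random_step_representation_def)
    have "lookback 0 \<in> Q \<rightarrow>\<^sub>M count_space {1..}"
      using measurable_lookback by (simp add: measurable_cong_sets[OF sQ refl])
    then have m: "lookback 0 \<in> Q \<rightarrow>\<^sub>M count_space UNIV"
      by (rule measurable_compose[of _ _ _ "\<lambda>x. x"]) simp
    \<comment> \<open>The tail beyond \<open>Suc n\<close> is enlarged to the tail beyond
      \<open>n\<close>, because the latter tails, summed from \<open>n = 0\<close>, give exactly the
      expectation.\<close>
    have "(\<Sum>n. variation A M X (Suc n)) \<le> (\<Sum>n. emeasure Q {y \<in> space Q. n < lookback 0 y})"
    proof (rule suminf_le)
      fix n
      have "{y \<in> space Q. n < lookback 0 y} = lookback 0 -` {n<..} \<inter> space Q" by auto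
      also have "\<dots> \<in> sets Q" by (rule measurable_sets[OF m]) simp
      finally have "emeasure Q {y \<in> space Q. Suc n < lookback 0 y} \<le> emeasure Q {y \<in> space Q. n < lookback 0 y}"
        by (intro emeasure_mono) auto
      then show "variation A M X (Suc n) \<le> emeasure Q {y \<in> space Q. n < lookback 0 y}"
        using variation_le_lookback_tail[OF crep, of "Suc n"] by (rule order_trans[rotated])
    qed auto
    also have "\<dots> < \<infinity>" using fin by (simp add: nn_integral_nat_function[OF m])
    finally show "(\<Sum>n. variation A M X (Suc n)) < \<infinity>" .
  next
    assume "(\<Sum>n. variation A M X (Suc n)) < \<infinity>"
    then have "(\<Sum>n. ennreal (var (Suc n))) \<noteq> \<top>" by (simp add: ennreal_var)
    then have "summable (\<lambda>n. var (Suc n))" by (rule summable_suminf_not_top[rotated]) (rule var_nonneg)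
    from tail[OF that this] have s: "summable (\<lambda>n. 1 - (\<Sum>m<n. q m))" .
    have "(\<Sum>m<n. q m) \<le> 1" for n
      using sum_le_suminf[OF sums_summable[OF law.q_sums], of "{..<n}"] sums_unique[OF law.q_sums] law.q_nonneg by simp
    \<comment> \<open>The expectation is the sum of the unassigned masses; these are nonnegative
      reals, so their summability makes it finite.\<close>
    then have "(\<integral>\<^sup>+y. of_nat (lookback 0 y) \<partial>law.joint) < \<infinity>"
      unfolding law.nn_integral_lookback_joint by (subst suminf_ennreal2[OF _ s]) auto
    then show "deterministic_random_step_Markov_finite_lookback A M X"
      unfolding deterministic_random_step_Markov_finite_lookback_def using assms(1,2) rep by blast
  qed
  ultimately show ?thesis by blast
qed

end
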